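(* Let $\mathfrak g$ be of type $D_n$ and let $v=v(c_1,\dots,c_n)$ where $c_1,\dots,c_n\in\{\pm1\}$; identify $v$ with $v\otimes1\in V$. 1) Let $n=2m$. (i) $v$ is a singular vector if and only if $c_{2j-1}=1$ for $j=1,2,\dots,m-1$. In this case the weight of $v$ is determined by $(c_{2m-1},c_{2m})$, for any choice of $c_2,c_4,\dots,c_{2m-2}\in\{\pm1\}$: it is $\widetilde\Lambda'_m$ if $(c_{2m-1},c_{2m})=(1,1)$; $\widetilde\Lambda_m$ if $(1,-1)$; $\widetilde\Lambda'_{m-1}$ if $(-1,1)$; $\widetilde\Lambda_{m-1}$ if $(-1,-1)$. (ii) Given a singular vector $v_0=v(1,c_2,1,c_4,\dots,1,c_{2m-2},c_{2m-1},c_{2m})$, the $\mathbf C$-linear span of all elements $v(b_1,c_2,b_3,c_4,\dots,b_{2m-3},c_{2m-2},b_{2m-1},b_{2m})$ satisfying (a) $b_j\in\{\pm1\}$ for all $j$, (b) $b_{2m-1}b_{2m}=c_{2m-1}c_{2m}$, (c) $\prod_{1\le j\le 2m-1,\ j\ \mathrm{odd}}b_j=c_{2m-1}$, tensored with $\mathbf C[x^{(j)}_r;1\le j\le2m,\ r\in\mathbf N_{\rm odd}]$, is the irreducible $D^{(1)}_{2m}$-module with the highest weight vector $v_0$. 2) Let $n=2m+1$. (i) $v$ is a singular vector if and only if $c_{2j-1}=1$ for $j=1,2,\dots,m$. In this case the weight of $v$ is determined by $(c_{2m},c_{2m+1})$, for any choice of $c_2,c_4,\dots,c_{2m-2}\in\{\pm1\}$: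 it is $\widetilde\Lambda'_m$ if $(c_{2m},c_{2m+1})=(\pm1,\pm1)$ (equal signs), and $\widetilde\Lambda_m$ if $(c_{2m},c_{2m+1})=(\pm1,\mp1)$ (opposite signs). (ii) Given a singular vector $v_0=v(1,c_2,1,c_4,\dots,1,c_{2m-2},1,c_{2m},c_{2m+1})$, the $\mathbf C$-linear span of all elements $v(b_1,c_2,b_3,c_4,\dots,b_{2m-3},c_{2m-2},b_{2m-1},c_{2m},c_{2m+1})$, where $b_j\in\{\pm1\}$ for all $j$, tensored with $\mathbf C[x^{(j)}_r;1\le j\le2m+1,\ r\in\mathbf N_{\rm odd}]$, is the irreducible $D^{(2)}_{2m+1}$-module with the highest weight vector $v_0$.
   Context: $m\ge2$. $\mathbf N_{\rm odd}$: positive odd integers; $\mathbf Z_{\rm odd}$: odd integers; $i=\sqrt{-1}$. **Lie algebra.** $\mathfrak g$ is the complex simple Lie algebra of type $D_n$ with Cartan subalgebra $\mathfrak h$, roots $\Delta$, root lattice $Q$, invariant form normalized by $(\alpha|\alpha)=2$ ($\alpha\in\Delta$); $\mathfrak h\cong\mathfrak h^*$ via the form, $H_\alpha\leftrightarrow\alpha$. Simple roots $\alpha_1,\dots,\alpha_n$: chain $\alpha_1-\alpha_2-\cdots-\alpha_{n-2}$, with $\alpha_{n-1}$ and $\alpha_n$ both joined to $\alpha_{n-2}$. $\nu:Q\times Q\to\{\pm1\}$ is the bimultiplicative function with: $\nu(\alpha_j,\alpha_k)=-1$ if $j=k$, or if $\alpha_j,\alpha_k$ are joined and $j\in S$; $\nu(\alpha_j,\alpha_k)=1$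 otherwise; where $S=\{2,4,\dots,2m-2\}$ if $n=2m$ and $S=\{2,4,\dots,2m,2m+1\}$ if $n=2m+1$. Root vectors $X_\alpha$ satisfy $[X_\alpha,X_\beta]=\nu(\alpha,\beta)X_{\alpha+\beta}$ if $\alpha+\beta\in\Delta$, $[X_\alpha,X_{-\alpha}]=-H_\alpha$. $\sigma$ is the automorphism with $\sigma|_{\mathfrak h}=-1$, $\sigma(X_\alpha)=X_{-\alpha}$; $\mathfrak g_{\bar0},\mathfrak g_{\bar1}$ are its $+1$ and $-1$ eigenspaces. $\widehat{\mathfrak g}(\sigma)=\big(\bigoplus_{j\in\mathbf Z}\mathfrak g_{\bar j\bmod2}\otimes t^j\big)\oplus\mathbf CK\oplus\mathbf Cd$ with $[X\otimes t^j,Y\otimes t^k]=[X,Y]\otimes t^{j+k}+\frac j2(X|Y)\delta_{j+k,0}K$, $[d,X\otimes t^j]=jX\otimes t^j$, $K$ central. It is the affine algebra of type $D^{(1)}_{2m}$ if $n=2m$ and $D^{(2)}_{2m+1}$ if $n=2m+1$. **Representation.** $\mathbf C\{Q/2Q\}$ is the commutative group algebra of $Q/2Q$ (basis $e^\gamma$, $e^\alpha e^\beta=e^{\alpha+\beta}$), $V=\mathbf C\{Q/2Q\}\otimes\mathbf C[x^{(j)}_r;1\le j\le n,r\in\mathbf N_{\rm odd}]$. With an orthonormal basis $S_1,\dots,S_n$ of $\mathfrak h$, $\widehat{\mathfrak g}(\sigma)$ acts on $V$ by (coefficientwise in $z$) $$\sum_{j\in\mathbf Z}(X_\alpha+(-1)^jX_{-\alpha})\otimes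 t^j\,z^{-j}\mapsto\Gamma_\alpha(z),\quad \sum_{j\in\mathbf Z_{\rm odd}}H\otimes t^j\,z^{-j-1}\mapsto\tfrac1{\sqrt2}\sum_{j}(H|S_j)a^{(j)}(z),$$ $K\mapsto1$, $d\mapsto-\sum_{j,r}r\,x^{(j)}_r\partial/\partial x^{(j)}_r$, where $a^{(j)}(z)=\sum_{r\in\mathbf N_{\rm odd}}\big(z^{-r-1}\partial/\partial x^{(j)}_r+r\,x^{(j)}_rz^{r-1}\big)$ and, with $\lambda_j=\sqrt2(\alpha|S_j)$, $$\Gamma_\alpha(z)(e^\gamma\otimes f)=\tfrac12\nu(\alpha,\gamma)e^{\alpha+\gamma}\otimes\exp\Big(\sum_{j,\,r\in\mathbf N_{\rm odd}}\lambda_jx^{(j)}_rz^r\Big)\exp\Big(-\sum_{j,\,r\in\mathbf N_{\rm odd}}\lambda_j\frac{z^{-r}}r\frac\partial{\partial x^{(j)}_r}\Big)f.$$ Set $v(c_1,\dots,c_n)=\prod_{j=1}^n(1+ic_je^{\alpha_j})\in\mathbf C\{Q/2Q\}$. **Generators.** $Y_\alpha=X_\alpha+X_{-\alpha}\in\mathfrak g_{\bar0}=\mathfrak g_{\bar 0}\otimes t^0$. For $1\le j\le k\le n-1$ define $Z_{j,k}$ (upper signs) and $Z'_{j,k}$ (lower signs): $k\le n-3$: $Y_{\alpha_j+\cdots+\alpha_k}\pm Y_{\alpha_j+\cdots+\alpha_k+2(\alpha_{k+1}+\cdots+\alpha_{n-2})+\alpha_{n-1}+\alpha_n}$; $k=n-2$: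 $Y_{\alpha_j+\cdots+\alpha_{n-2}}\pm Y_{\alpha_j+\cdots+\alpha_{n-2}+\alpha_{n-1}+\alpha_n}$; $j<k=n-1$: $Y_{\alpha_j+\cdots+\alpha_{n-2}+\alpha_{n-1}}\mp Y_{\alpha_j+\cdots+\alpha_{n-2}+\alpha_n}$; $j=k=n-1$: $Y_{\alpha_{n-1}}\mp Y_{\alpha_n}$. $Z_j=Z_{j,j}$, $Z'_j=Z'_{j,j}$. Chevalley generators: for $1\le j\le m-1$ (both parities of $n$) $\widetilde e_j=\frac12\{Z_{2j-1,2j}-Z_{2j,2j+1}-iZ_{2j-1,2j+1}-iZ_{2j}\}$, $\widetilde f_j=\frac12\{-Z_{2j-1,2j}+Z_{2j,2j+1}-iZ_{2j-1,2j+1}-iZ_{2j}\}$, $\widetilde h_j=\frac i2\{Z_{2j-1}-Z_{2j+1}\}$. For $n=2m$: $\widetilde e_m=\frac12\{Z_{2m-3,2m-2}+Z_{2m-2,2m-1}+iZ_{2m-3,2m-1}-iZ_{2m-2}\}$, $\widetilde f_m=\frac12\{-Z_{2m-3,2m-2}-Z_{2m-2,2m-1}+iZ_{2m-3,2m-1}-iZ_{2m-2}\}$, $\widetilde h_m=\frac i2\{Z_{2m-3}+Z_{2m-1}\}$. For $n=2m+1$: $\widetilde e_m=\frac12\{Z_{2m-2,2m-1}-iZ_{2m-2}\}$, $\widetilde f_m=\frac12\{-Z_{2m-2,2m-1}-iZ_{2m-2}\}$, $\widetilde h_m=iZ_{2m-1}$. $\widetilde e'_j,\widetilde f'_j,\widetilde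 h'_j$ ($1\le j\le m$) are given by the same formulas with $Z$ replaced by $Z'$. Finally $\widetilde e_0=\frac12\{i(X_{\alpha_1}-X_{-\alpha_1})+H_{\alpha_1}\}\otimes t$, $\widetilde f_0=\frac12\{-i(X_{\alpha_1}-X_{-\alpha_1})+H_{\alpha_1}\}\otimes t^{-1}$, $\widetilde h_0=-iY_{\alpha_1}+\frac K2$. A singular vector is a nonzero weight vector annihilated by all $\widetilde e_j$ ($0\le j\le m$) and $\widetilde e'_j$ ($1\le j\le m$). $\widetilde\Lambda_j$, $\widetilde\Lambda'_j$ are the fundamental weights corresponding to the simple coroot system $\widetilde h_j$, $\widetilde h'_j$: e.g. a vector has weight $\widetilde\Lambda_j$ if $\widetilde h_j$ acts on it by $1$ and all other $\widetilde h_k,\widetilde h'_k$ by $0$.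
   Formalization: In 1(i) two printed weights are interchanged, since as printed they are false: the weight of v is Λ̃_{m-1} if (c_{2m-1},c_{2m})=(-1,1) and Λ̃'_{m-1} if it is (-1,-1). *)

theory Defs
  imports Complex_Main "HOL-Library.Poly_Mapping" "HOL-Library.Z2"
begin

section \<open>Spaces with a chosen basis\<close>

text \<open>
  The finitely supported functions \<^typ>\<open>'b \<Rightarrow>\<^sub>0 complex\<close> are the complex vector space with basis
  \<^typ>\<open>'b\<close>. They are used for \<open>\<gg>\<close>, for its affinization and for the polynomial algebra.
  If the index type is an additive monoid, the multiplication of the library is the
  one of the monoid algebra.
\<close>

definition cscale :: "complex \<Rightarrow> ('b \<Rightarrow>\<^sub>0 complex) \<Rightarrow> ('b \<Rightarrow>\<^sub>0 complex)" where
  "cscale c x = Poly_Mapping.map (\<lambda>y. c * y) x"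

lemma lookup_cscale [simp]: "Poly_Mapping.lookup (cscale c x) b = c * Poly_Mapping.lookup x b"
  unfolding cscale_def by (transfer) (simp add: when_def)

interpretation cvec: vector_space cscale
  by unfold_locales (auto intro!: poly_mapping_eqI simp: lookup_add algebra_simps)

definition linear_ext ::
    "('b \<Rightarrow> ('c \<Rightarrow>\<^sub>0 complex)) \<Rightarrow> ('b \<Rightarrow>\<^sub>0 complex) \<Rightarrow> ('c \<Rightarrow>\<^sub>0 complex)" where
  "linear_ext F x = (\<Sum>b\<in>Poly_Mapping.keys x. cscale (Poly_Mapping.lookup x b) (F b))"

definition bilinear_ext ::
    "('a \<Rightarrow> 'b \<Rightarrow> ('c \<Rightarrow>\<^sub>0 complex)) \<Rightarrow> ('a \<Rightarrow>\<^sub>0 complex) \<Rightarrow> ('b \<Rightarrow>\<^sub>0 complex) \<Rightarrow> ('c \<Rightarrow>\<^sub>0 complex)" where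
  "bilinear_ext F x y =
     (\<Sum>a\<in>Poly_Mapping.keys x. \<Sum>b\<in>Poly_Mapping.keys y.
        cscale (Poly_Mapping.lookup x a * Poly_Mapping.lookup y b) (F a b))"

section \<open>Root lattice of type \<open>D\<^sub>n\<close>\<close>

text \<open>Elements of the root lattice are given by their coordinates with respect to the
  simple roots \<open>\<alpha>\<^sub>1, \<dots>, \<alpha>\<^sub>n\<close>.\<close>

type_synonym lattice = "nat \<Rightarrow>\<^sub>0 int"

definition root_lattice :: "nat \<Rightarrow> lattice set" where
  "root_lattice n = {\<beta>. Poly_Mapping.keys \<beta> \<subseteq> {1..n}}"

definition simple_root :: "nat \<Rightarrow> lattice" where
  "simple_root j = Poly_Mapping.single j 1"

text \<open>\<open>\<alpha>\<^sub>j + \<dots> + \<alpha>\<^sub>k\<close>\<close>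

definition root_sum :: "nat \<Rightarrow> nat \<Rightarrow> lattice" where
  "root_sum j k = (\<Sum>i=j..k. simple_root i)"

definition joined :: "nat \<Rightarrow> nat \<Rightarrow> nat \<Rightarrow> bool" where
  "joined n j k \<longleftrightarrow> (k = j + 1 \<and> k \<le> n - 1) \<or> (j = k + 1 \<and> j \<le> n - 1) \<or> {j, k} = {n - 2, n}"

definition cartan :: "nat \<Rightarrow> nat \<Rightarrow> nat \<Rightarrow> int" where
  "cartan n j k = (if j = k then 2 else if joined n j k then -1 else 0)"

definition lform :: "nat \<Rightarrow> lattice \<Rightarrow> lattice \<Rightarrow> int" where
  "lform n \<alpha> \<beta> = (\<Sum>j=1..n. \<Sum>k=1..n. Poly_Mapping.lookup \<alpha> j * Poly_Mapping.lookup \<beta> k * cartan n j k)"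

text \<open>In the simply laced case the roots are the lattice vectors of square length 2.\<close>

definition roots :: "nat \<Rightarrow> lattice set" where
  "roots n = {\<alpha> \<in> root_lattice n. lform n \<alpha> \<alpha> = 2}"

definition nu_set :: "nat \<Rightarrow> nat set" where
  "nu_set n = (if even n then {j. even j \<and> 2 \<le> j \<and> j \<le> n - 2}
               else {j. even j \<and> 2 \<le> j \<and> j \<le> n - 1} \<union> {n})"

definition nu_simple :: "nat \<Rightarrow> nat \<Rightarrow> nat \<Rightarrow> complex" where
  "nu_simple n j k = (if j = k \<or> (joined n j k \<and> j \<in> nu_set n) then -1 else 1)"

definition nu :: "nat \<Rightarrow> lattice \<Rightarrow> lattice \<Rightarrow> complex" where
  "nu n \<alpha> \<beta> = (\<Prod>j=1..n. \<Prod>k=1..n. nu_simple n j k powi (Poly_Mapping.lookup \<alpha> j * Poly_Mapping.lookup \<beta> k))"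

section \<open>The simple Lie algebra and its twisted affinization\<close>

text \<open>\<open>HB j\<close> stands for \<open>H\<^bsub>\<alpha>\<^sub>j\<^esub>\<close> and \<open>XB \<alpha>\<close> for \<open>X\<^sub>\<alpha>\<close>.\<close>

datatype gbasis = HB nat | XB lattice

type_synonym galg = "gbasis \<Rightarrow>\<^sub>0 complex"

definition Xvec :: "lattice \<Rightarrow> galg" where
  "Xvec \<alpha> = Poly_Mapping.single (XB \<alpha>) 1"

definition Hvec :: "nat \<Rightarrow> lattice \<Rightarrow> galg" where
  "Hvec n \<alpha> = (\<Sum>j=1..n. Poly_Mapping.single (HB j) (of_int (Poly_Mapping.lookup \<alpha> j)))"

definition Yvec :: "lattice \<Rightarrow> galg" where
  "Yvec \<alpha> = Xvec \<alpha> + Xvec (- \<alpha>)"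

definition h_space :: "nat \<Rightarrow> galg set" where
  "h_space n = {x. Poly_Mapping.keys x \<subseteq> HB ` {1..n}}"

definition g_space :: "nat \<Rightarrow> galg set" where
  "g_space n = {x. Poly_Mapping.keys x \<subseteq> HB ` {1..n} \<union> XB ` roots n}"

fun gbracket_basis :: "nat \<Rightarrow> gbasis \<Rightarrow> gbasis \<Rightarrow> galg" where
  "gbracket_basis n (HB j) (HB k) = 0"
| "gbracket_basis n (HB j) (XB \<beta>) = cscale (of_int (lform n (simple_root j) \<beta>)) (Xvec \<beta>)"
| "gbracket_basis n (XB \<alpha>) (HB k) = cscale (- of_int (lform n (simple_root k) \<alpha>)) (Xvec \<alpha>)"
| "gbracket_basis n (XB \<alpha>) (XB \<beta>) =
     (if \<alpha> + \<beta> = 0 then - Hvec n \<alpha>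
      else if \<alpha> + \<beta> \<in> roots n then cscale (nu n \<alpha> \<beta>) (Xvec (\<alpha> + \<beta>)) else 0)"

definition gbracket :: "nat \<Rightarrow> galg \<Rightarrow> galg \<Rightarrow> galg" where
  "gbracket n = bilinear_ext (gbracket_basis n)"

text \<open>The value \<open>(X\<^sub>\<alpha>|X\<^bsub>-\<alpha>\<^esub>) = -1\<close> is forced by invariance and \<open>[X\<^sub>\<alpha>, X\<^bsub>-\<alpha>\<^esub>] = - H\<^sub>\<alpha>\<close>.\<close>

fun gform_basis :: "nat \<Rightarrow> gbasis \<Rightarrow> gbasis \<Rightarrow> complex" where
  "gform_basis n (HB j) (HB k) = of_int (cartan n j k)"
| "gform_basis n (XB \<alpha>) (XB \<beta>) = (if \<alpha> + \<beta> = 0 then -1 else 0)"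
| "gform_basis n _ _ = 0"

definition gform :: "nat \<Rightarrow> galg \<Rightarrow> galg \<Rightarrow> complex" where
  "gform n x y =
     (\<Sum>a\<in>Poly_Mapping.keys x. \<Sum>b\<in>Poly_Mapping.keys y.
        Poly_Mapping.lookup x a * Poly_Mapping.lookup y b * gform_basis n a b)"

fun sigma_basis :: "gbasis \<Rightarrow> galg" where
  "sigma_basis (HB j) = - Poly_Mapping.single (HB j) 1"
| "sigma_basis (XB \<alpha>) = Xvec (- \<alpha>)"

definition sigma :: "galg \<Rightarrow> galg" where
  "sigma = linear_ext sigma_basis"

definition g_even :: "nat \<Rightarrow> galg set" where
  "g_even n = {x \<in> g_space n. sigma x = x}"

definition g_odd :: "nat \<Rightarrow> galg set" where
  "g_odd n = {x \<in> g_space n. sigma x = - x}"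

text \<open>\<open>LoopB b j\<close> stands for \<open>b \<otimes> t\<^sup>j\<close>, and \<open>KB\<close>, \<open>DB\<close> for \<open>K\<close>, \<open>d\<close>.\<close>

datatype abasis = LoopB gbasis int | KB | DB

type_synonym aff = "abasis \<Rightarrow>\<^sub>0 complex"

definition loop :: "galg \<Rightarrow> int \<Rightarrow> aff" where
  "loop x j = linear_ext (\<lambda>b. Poly_Mapping.single (LoopB b j) 1) x"

definition K_elt :: aff where
  "K_elt = Poly_Mapping.single KB 1"

definition d_elt :: aff where
  "d_elt = Poly_Mapping.single DB 1"

fun abracket_basis :: "nat \<Rightarrow> abasis \<Rightarrow> abasis \<Rightarrow> aff" where
  "abracket_basis n (LoopB a j) (LoopB b k) =
     loop (gbracket_basis n a b) (j + k)
     + (if j + k = 0 then cscale (of_int j / 2 * gform_basis n a b) K_elt else 0)"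
| "abracket_basis n DB (LoopB b k) = cscale (of_int k) (Poly_Mapping.single (LoopB b k) 1)"
| "abracket_basis n (LoopB a j) DB = cscale (- of_int j) (Poly_Mapping.single (LoopB a j) 1)"
| "abracket_basis n _ _ = 0"

definition abracket :: "nat \<Rightarrow> aff \<Rightarrow> aff \<Rightarrow> aff" where
  "abracket n = bilinear_ext (abracket_basis n)"

definition ghat :: "nat \<Rightarrow> aff set" where
  "ghat n = cvec.span
     ({loop x j | x j. even j \<and> x \<in> g_even n} \<union> {loop x j | x j. odd j \<and> x \<in> g_odd n}
      \<union> {K_elt, d_elt})"

section \<open>The space \<open>V\<close>\<close>

type_synonym modlattice = "nat \<Rightarrow>\<^sub>0 bit"

type_synonym galgebra = "modlattice \<Rightarrow>\<^sub>0 complex"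

text \<open>Polynomials in the variables \<open>x\<^sup>(\<^sup>j\<^sup>)\<^sub>r\<close>, which are indexed by the pairs \<open>(j, r)\<close>.\<close>

type_synonym fpoly = "((nat \<times> nat) \<Rightarrow>\<^sub>0 nat) \<Rightarrow>\<^sub>0 complex"

text \<open>The tensor product of the group algebra with the polynomial ring is the
  space of finitely supported families of polynomials indexed by \<open>Q/2Q\<close>.\<close>

type_synonym vspace = "modlattice \<Rightarrow>\<^sub>0 fpoly"

definition mod2 :: "lattice \<Rightarrow> modlattice" where
  "mod2 \<gamma> = Poly_Mapping.map of_int \<gamma>"

definition expo :: "lattice \<Rightarrow> galgebra" where
  "expo \<gamma> = Poly_Mapping.single (mod2 \<gamma>) 1"

definition tensor :: "galgebra \<Rightarrow> fpoly \<Rightarrow> vspace" where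
  "tensor a f = Poly_Mapping.map (\<lambda>c. cscale c f) a"

definition vscale :: "complex \<Rightarrow> vspace \<Rightarrow> vspace" where
  "vscale c v = Poly_Mapping.map (cscale c) v"

lemma lookup_vscale [simp]: "Poly_Mapping.lookup (vscale c v) b = cscale c (Poly_Mapping.lookup v b)"
  unfolding vscale_def by (transfer) (auto simp add: when_def)

interpretation vvec: vector_space vscale
  by unfold_locales
     (auto intro!: poly_mapping_eqI simp: lookup_add cvec.scale_right_distrib cvec.scale_left_distrib)

definition poly_space :: "nat \<Rightarrow> fpoly set" where
  "poly_space n = {f. \<forall>\<mu>\<in>Poly_Mapping.keys f. Poly_Mapping.keys \<mu> \<subseteq> {1..n} \<times> {r. odd r}}"

definition V_space :: "nat \<Rightarrow> vspace set" where
  "V_space n = vvec.span {tensor (expo \<gamma>) f | \<gamma> f. \<gamma> \<in> root_lattice n \<and> f \<in> poly_space n}"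

definition tensor_poly :: "nat \<Rightarrow> galgebra set \<Rightarrow> vspace set" where
  "tensor_poly n A = vvec.span {tensor a f | a f. a \<in> A \<and> f \<in> poly_space n}"

definition var :: "nat \<times> nat \<Rightarrow> fpoly" where
  "var p = Poly_Mapping.single (Poly_Mapping.single p 1) 1"

definition pdiff :: "nat \<times> nat \<Rightarrow> fpoly \<Rightarrow> fpoly" where
  "pdiff p = linear_ext (\<lambda>\<mu>. Poly_Mapping.single (\<mu> - Poly_Mapping.single p 1) (of_nat (Poly_Mapping.lookup \<mu> p)))"

section \<open>Vertex operators\<close>

text \<open>\<open>op_pow T s k\<close> is the coefficient of \<open>w\<^sup>k\<close> in the \<open>s\<close>-th power of the
  operator-valued series \<open>\<Sum>\<^bsub>r\<ge>1\<^esub> T r w\<^sup>r\<close>, and \<open>op_exp T k\<close> is the coefficient of \<open>w\<^sup>k\<close> in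
  its exponential; the powers with \<open>s > k\<close> do not contribute to the latter.\<close>

fun op_pow :: "(nat \<Rightarrow> fpoly \<Rightarrow> fpoly) \<Rightarrow> nat \<Rightarrow> nat \<Rightarrow> fpoly \<Rightarrow> fpoly" where
  "op_pow T 0 k f = (if k = 0 then f else 0)"
| "op_pow T (Suc s) k f = (\<Sum>r=1..k. T r (op_pow T s (k - r) f))"

definition op_exp :: "(nat \<Rightarrow> fpoly \<Rightarrow> fpoly) \<Rightarrow> nat \<Rightarrow> fpoly \<Rightarrow> fpoly" where
  "op_exp T k f = (\<Sum>s=0..k. cscale (1 / fact s) (op_pow T s k f))"

text \<open>A family \<open>S\<close> with \<open>(S\<^sub>j|S\<^sub>k) = \<delta>\<^bsub>jk\<^esub>\<close> (\<open>1 \<le> j, k \<le> n\<close>) is automatically a basis of the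
  \<open>n\<close>-dimensional space \<open>\<hh>\<close>.\<close>

definition orthonormal_basis :: "nat \<Rightarrow> (nat \<Rightarrow> galg) \<Rightarrow> bool" where
  "orthonormal_basis n S \<longleftrightarrow>
     (\<forall>j\<in>{1..n}. S j \<in> h_space n) \<and>
     (\<forall>j\<in>{1..n}. \<forall>k\<in>{1..n}. gform n (S j) (S k) = (if j = k then 1 else 0))"

definition lam :: "nat \<Rightarrow> (nat \<Rightarrow> galg) \<Rightarrow> lattice \<Rightarrow> nat \<Rightarrow> complex" where
  "lam n S \<alpha> j = complex_of_real (sqrt 2) * gform n (Hvec n \<alpha>) (S j)"

text \<open>Coefficient of \<open>z\<^sup>k\<close> in \<open>exp(\<Sum> \<lambda>\<^sub>j x\<^sup>(\<^sup>j\<^sup>)\<^sub>r z\<^sup>r)\<close>, and of \<open>z\<^bsup>-l\<^esup>\<close> in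
  \<open>exp(- \<Sum> \<lambda>\<^sub>j z\<^bsup>-r\<^esup>/r \<partial>/\<partial>x\<^sup>(\<^sup>j\<^sup>)\<^sub>r)\<close>.\<close>

definition E_plus :: "nat \<Rightarrow> (nat \<Rightarrow> galg) \<Rightarrow> lattice \<Rightarrow> nat \<Rightarrow> fpoly \<Rightarrow> fpoly" where
  "E_plus n S \<alpha> =
     op_exp (\<lambda>r f. if odd r then \<Sum>j=1..n. cscale (lam n S \<alpha> j) (var (j, r) * f) else 0)"

definition E_minus :: "nat \<Rightarrow> (nat \<Rightarrow> galg) \<Rightarrow> lattice \<Rightarrow> nat \<Rightarrow> fpoly \<Rightarrow> fpoly" where
  "E_minus n S \<alpha> =
     op_exp (\<lambda>r f. if odd r then \<Sum>j=1..n. cscale (- lam n S \<alpha> j / of_nat r) (pdiff (j, r) f) else 0)"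

text \<open>Coefficient of \<open>z\<^bsup>-p\<^esup>\<close> in the product of the two exponentials applied to \<open>f\<close>.
  Only finitely many \<open>E_minus n S \<alpha> l f\<close> are nonzero for a given polynomial \<open>f\<close>.\<close>

definition E_coeff :: "nat \<Rightarrow> (nat \<Rightarrow> galg) \<Rightarrow> lattice \<Rightarrow> int \<Rightarrow> fpoly \<Rightarrow> fpoly" where
  "E_coeff n S \<alpha> p f =
     (\<Sum>l | p \<le> int l \<and> E_minus n S \<alpha> l f \<noteq> 0. E_plus n S \<alpha> (nat (int l - p)) (E_minus n S \<alpha> l f))"

text \<open>Coefficient of \<open>z\<^bsup>-p-1\<^esup>\<close> in \<open>a\<^sup>(\<^sup>j\<^sup>)(z)\<close>, for odd \<open>p\<close>.\<close>

definition a_coeff :: "nat \<Rightarrow> int \<Rightarrow> fpoly \<Rightarrow> fpoly" where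
  "a_coeff j p f = (if 0 < p then pdiff (j, nat p) f
                    else cscale (of_int (- p)) (var (j, nat (- p)) * f))"

text \<open>The variables not occurring in \<open>f\<close> do not contribute to the Euler operator.\<close>

definition d_poly :: "fpoly \<Rightarrow> fpoly" where
  "d_poly f =
     - (\<Sum>(j, r) \<in> (\<Union>\<mu>\<in>Poly_Mapping.keys f. Poly_Mapping.keys \<mu>).
          cscale (of_nat r) (var (j, r) * pdiff (j, r) f))"

section \<open>Modules\<close>

definition ghat_module :: "nat \<Rightarrow> (aff \<Rightarrow> vspace \<Rightarrow> vspace) \<Rightarrow> vspace set \<Rightarrow> bool" where
  "ghat_module n \<rho> W \<longleftrightarrow>
     vvec.subspace W \<and>
     (\<forall>x\<in>ghat n. \<forall>v\<in>W. \<rho> x v \<in> W) \<and>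
     (\<forall>x\<in>ghat n. \<forall>v\<in>W. \<forall>w\<in>W. \<rho> x (v + w) = \<rho> x v + \<rho> x w) \<and>
     (\<forall>x\<in>ghat n. \<forall>c. \<forall>v\<in>W. \<rho> x (vscale c v) = vscale c (\<rho> x v)) \<and>
     (\<forall>x\<in>ghat n. \<forall>y\<in>ghat n. \<forall>v\<in>W. \<rho> (x + y) v = \<rho> x v + \<rho> y v) \<and>
     (\<forall>x\<in>ghat n. \<forall>c. \<forall>v\<in>W. \<rho> (cscale c x) v = vscale c (\<rho> x v)) \<and>
     (\<forall>x\<in>ghat n. \<forall>y\<in>ghat n. \<forall>v\<in>W. \<rho> (abracket n x y) v = \<rho> x (\<rho> y v) - \<rho> y (\<rho> x v))"

definition irreducible_module :: "nat \<Rightarrow> (aff \<Rightarrow> vspace \<Rightarrow> vspace) \<Rightarrow> vspace set \<Rightarrow> bool" where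
  "irreducible_module n \<rho> W \<longleftrightarrow>
     ghat_module n \<rho> W \<and> W \<noteq> {0} \<and>
     (\<forall>U. ghat_module n \<rho> U \<and> U \<subseteq> W \<longrightarrow> U = {0} \<or> U = W)"

text \<open>\<open>\<rho>\<close> is the action of the twisted affine algebra on \<open>V\<close> by vertex operators.\<close>

definition vertex_representation ::
    "nat \<Rightarrow> (nat \<Rightarrow> galg) \<Rightarrow> (aff \<Rightarrow> vspace \<Rightarrow> vspace) \<Rightarrow> bool" where
  "vertex_representation n S \<rho> \<longleftrightarrow>
     ghat_module n \<rho> (V_space n) \<and>
     (\<forall>\<alpha>\<in>roots n. \<forall>p. \<forall>\<gamma>\<in>root_lattice n. \<forall>f\<in>poly_space n.
        \<rho> (loop (Xvec \<alpha> + cscale ((-1) powi p) (Xvec (- \<alpha>))) p) (tensor (expo \<gamma>) f) =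
          vscale (1 / 2 * nu n \<alpha> \<gamma>) (tensor (expo (\<alpha> + \<gamma>)) (E_coeff n S \<alpha> p f))) \<and>
     (\<forall>H\<in>h_space n. \<forall>p. odd p \<longrightarrow> (\<forall>\<gamma>\<in>root_lattice n. \<forall>f\<in>poly_space n.
        \<rho> (loop H p) (tensor (expo \<gamma>) f) =
          tensor (expo \<gamma>)
            (cscale (1 / complex_of_real (sqrt 2))
               (\<Sum>j=1..n. cscale (gform n H (S j)) (a_coeff j p f))))) \<and>
     (\<forall>v\<in>V_space n. \<rho> K_elt v = v) \<and>
     (\<forall>\<gamma>\<in>root_lattice n. \<forall>f\<in>poly_space n.
        \<rho> d_elt (tensor (expo \<gamma>) f) = tensor (expo \<gamma>) (d_poly f))"

section \<open>Chevalley generators, singular vectors and weights\<close>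

text \<open>\<open>Zvec n 1 j k\<close> is \<open>Z\<^bsub>j,k\<^esub>\<close> and \<open>Zvec n (-1) j k\<close> is \<open>Z'\<^bsub>j,k\<^esub>\<close>; likewise for
  \<open>e_fin\<close> and \<open>h_fin\<close>.\<close>

definition Zvec :: "nat \<Rightarrow> complex \<Rightarrow> nat \<Rightarrow> nat \<Rightarrow> galg" where
  "Zvec n s j k =
     (if k \<le> n - 3 then
        Yvec (root_sum j k)
        + cscale s (Yvec (root_sum j k + (root_sum (k + 1) (n - 2) + root_sum (k + 1) (n - 2))
                          + simple_root (n - 1) + simple_root n))
      else if k = n - 2 then
        Yvec (root_sum j (n - 2))
        + cscale s (Yvec (root_sum j (n - 2) + simple_root (n - 1) + simple_root n))
      else if j < k then
        Yvec (root_sum j (n - 2) + simple_root (n - 1))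
        - cscale s (Yvec (root_sum j (n - 2) + simple_root n))
      else
        Yvec (simple_root (n - 1)) - cscale s (Yvec (simple_root n)))"

definition e_fin :: "nat \<Rightarrow> complex \<Rightarrow> nat \<Rightarrow> galg" where
  "e_fin n s j = (let m = n div 2; Z = Zvec n s in
     cscale (1 / 2)
      (if j < m then
         Z (2*j-1) (2*j) - Z (2*j) (2*j+1) - cscale \<i> (Z (2*j-1) (2*j+1)) - cscale \<i> (Z (2*j) (2*j))
       else if even n then
         Z (2*m-3) (2*m-2) + Z (2*m-2) (2*m-1) + cscale \<i> (Z (2*m-3) (2*m-1))
           - cscale \<i> (Z (2*m-2) (2*m-2))
       else
         Z (2*m-2) (2*m-1) - cscale \<i> (Z (2*m-2) (2*m-2))))"

definition h_fin :: "nat \<Rightarrow> complex \<Rightarrow> nat \<Rightarrow> galg" where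
  "h_fin n s j = (let m = n div 2; Z = (\<lambda>k. Zvec n s k k) in
      (if j < m then cscale (\<i> / 2) (Z (2*j-1) - Z (2*j+1))
       else if even n then cscale (\<i> / 2) (Z (2*m-3) + Z (2*m-1))
       else cscale \<i> (Z (2*m-1))))"

definition e_zero :: "nat \<Rightarrow> aff" where
  "e_zero n = loop (cscale (1 / 2) (cscale \<i> (Xvec (simple_root 1) - Xvec (- simple_root 1))
                      + Hvec n (simple_root 1))) 1"

definition h_zero :: aff where
  "h_zero = cscale (- \<i>) (loop (Yvec (simple_root 1)) 0) + cscale (1 / 2) K_elt"

text \<open>The nodes of the Dynkin diagram: \<open>Plain j\<close> (\<open>0 \<le> j \<le> m\<close>) belongs to the
  generators without a prime and \<open>Primed j\<close> (\<open>1 \<le> j \<le> m\<close>) to those with a prime.\<close>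

datatype node = Plain nat | Primed nat

definition nodes :: "nat \<Rightarrow> node set" where
  "nodes n = Plain ` {0..n div 2} \<union> Primed ` {1..n div 2}"

fun e_gen :: "nat \<Rightarrow> node \<Rightarrow> aff" where
  "e_gen n (Plain j) = (if j = 0 then e_zero n else loop (e_fin n 1 j) 0)"
| "e_gen n (Primed j) = loop (e_fin n (-1) j) 0"

fun h_gen :: "nat \<Rightarrow> node \<Rightarrow> aff" where
  "h_gen n (Plain j) = (if j = 0 then h_zero else loop (h_fin n 1 j) 0)"
| "h_gen n (Primed j) = loop (h_fin n (-1) j) 0"

text \<open>Weights are recorded by their values on the simple coroots.\<close>

definition has_weight ::
    "nat \<Rightarrow> (aff \<Rightarrow> vspace \<Rightarrow> vspace) \<Rightarrow> vspace \<Rightarrow> (node \<Rightarrow> complex) \<Rightarrow> bool" where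
  "has_weight n \<rho> v \<mu> \<longleftrightarrow> (\<forall>a\<in>nodes n. \<rho> (h_gen n a) v = vscale (\<mu> a) v)"

definition fund_weight :: "node \<Rightarrow> node \<Rightarrow> complex" where
  "fund_weight a = (\<lambda>b. if b = a then 1 else 0)"

text \<open>The Cartan subalgebra is spanned by the simple coroots (\<open>K\<close> being a combination of
  them) and \<open>d\<close>.\<close>

definition weight_vector :: "nat \<Rightarrow> (aff \<Rightarrow> vspace \<Rightarrow> vspace) \<Rightarrow> vspace \<Rightarrow> bool" where
  "weight_vector n \<rho> v \<longleftrightarrow>
     v \<in> V_space n \<and> v \<noteq> 0 \<and> (\<exists>\<mu>. has_weight n \<rho> v \<mu>) \<and> (\<exists>\<delta>. \<rho> d_elt v = vscale \<delta> v)"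

definition singular_vector :: "nat \<Rightarrow> (aff \<Rightarrow> vspace \<Rightarrow> vspace) \<Rightarrow> vspace \<Rightarrow> bool" where
  "singular_vector n \<rho> v \<longleftrightarrow> weight_vector n \<rho> v \<and> (\<forall>a\<in>nodes n. \<rho> (e_gen n a) v = 0)"

definition irreducible_highest_weight_module ::
    "nat \<Rightarrow> (aff \<Rightarrow> vspace \<Rightarrow> vspace) \<Rightarrow> vspace set \<Rightarrow> vspace \<Rightarrow> bool" where
  "irreducible_highest_weight_module n \<rho> W v\<^sub>0 \<longleftrightarrow>
     irreducible_module n \<rho> W \<and> v\<^sub>0 \<in> W \<and> singular_vector n \<rho> v\<^sub>0 \<and>
     (\<forall>U. ghat_module n \<rho> U \<and> v\<^sub>0 \<in> U \<longrightarrow> W \<subseteq> U)"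

definition vvect :: "nat \<Rightarrow> (nat \<Rightarrow> int) \<Rightarrow> galgebra" where
  "vvect n c = (\<Prod>j=1..n. 1 + cscale (\<i> * of_int (c j)) (expo (simple_root j)))"

end

theory Submission
  imports Defs
begin

text \<open>
  On vectors \<open>a \<otimes> 1\<close> the zero mode \<open>Y\<^sub>\<alpha>\<close> acts by \<open>E\<^sub>\<alpha> / 2\<close>, where \<open>E\<^sub>\<alpha>\<close> (\<open>twisted_mult\<close> below) sends \<open>e\<^sup>\<gamma>\<close> to
  \<open>\<nu>(\<alpha>, \<gamma>) e\<^bsup>\<alpha>+\<gamma>\<^esup>\<close>. It is multiplication by \<open>e\<^sup>\<alpha>\<close> after an automorphism of the group algebra, so it can be computed on
  the product \<open>v(c)\<close> factor by factor. The result (\<open>twisted_mult_vvect\<close>) is that \<open>E\<^sub>\<alpha>\<close> permutes the lines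
  spanned by the \<open>v(c)\<close>: the sign \<open>c\<^sub>k\<close> is flipped once for every neighbour \<open>l\<close> of \<open>k\<close> that belongs to the set \<open>S\<close> of the
  cocycle and occurs in \<open>\<alpha>\<close> with odd coefficient. The statement is the combinatorics of these flips.

  The two roots in \<open>Z\<^bsub>j,k\<^esub>\<close> agree modulo \<open>2Q\<close> up to \<open>\<alpha>\<^bsub>n-1\<^esub> + \<alpha>\<^sub>n\<close>. By the symmetry of the fork of the Dynkin diagram their
  operators differ on \<open>v(c)\<close> only by a sign, which depends on \<open>c\<^bsub>n-1\<^esub> c\<^sub>n\<close> (\<open>acts_Zvec\<close>). So either all primed or all
  unprimed generators of \<open>\<gg>\<^bsub>0\<^esub>\<close> kill \<open>v(c)\<close>. In each generator \<open>e\<close> of the other family all terms produce the same vector,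
  with a total coefficient such as \<open>(x - 1) (y + 1)\<close> for \<open>x = c\<^bsub>2j-1\<^esub>\<close> and \<open>y = c\<^bsub>2j+1\<^esub>\<close> (\<open>acts_e_fin\<close>). The coefficients
  vanish simultaneously exactly when the stated signs are \<open>1\<close>, and the weights are read off from the
  eigenvalues of the \<open>h\<close> (\<open>acts_h_fin\<close>).

  For the irreducible modules, the conditions on the signs \<open>b\<close> are exactly invariants of the flips, hence the span of the \<open>v(b)\<close>
  tensored with the polynomials is a submodule (\<open>tensor_poly_module\<close>). From a nonzero vector of a submodule the positive
  oscillators lead down to some \<open>a \<otimes> 1\<close> (\<open>lower_to_vacuum\<close>). The operators \<open>E\<^bsub>\<alpha>\<^sub>k\<^esub>\<close> with \<open>k \<notin> S\<close> are
  diagonal with eigenvalues \<open>- i b\<^sub>k\<close>, which distinguish the \<open>v(b)\<close>, so that one of them occurs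
  (\<open>separate_eigenvectors\<close>). The operators with \<open>k \<in> S\<close> connect it to all the others
  (\<open>flips_connect\<close>), and the negative oscillators create all polynomials
  (\<open>raise_to_polynomials\<close>).
\<close>

abbreviation coeff :: "('a \<Rightarrow>\<^sub>0 'b::zero) \<Rightarrow> 'a \<Rightarrow> 'b" where
  "coeff \<equiv> Poly_Mapping.lookup"

abbreviation supp :: "('a \<Rightarrow>\<^sub>0 'b::zero) \<Rightarrow> 'a set" where
  "supp \<equiv> Poly_Mapping.keys"

abbreviation delta :: "'a \<Rightarrow> 'b \<Rightarrow> ('a \<Rightarrow>\<^sub>0 'b::zero)" where
  "delta \<equiv> Poly_Mapping.single"

section \<open>Linear algebra over finitely supported functions\<close>

lemma finsupp_expansion: "x = (\<Sum>b\<in>supp x. delta b (coeff x b))"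
proof (rule poly_mapping_eqI)
  fix k
  have "(\<Sum>b\<in>supp x. coeff (delta b (coeff x b)) k) = (\<Sum>b\<in>supp x. if b = k then coeff x k else 0)"
    by (intro sum.cong) (auto simp: lookup_single)
  also have "\<dots> = coeff x k"
    by (simp add: in_keys_iff)
  finally show "coeff x k = coeff (\<Sum>b\<in>supp x. delta b (coeff x b)) k"
    by (simp add: lookup_sum)
qed

lemma cscale_delta [simp]: "cscale c (delta b d) = delta b (c * d)"
  by (rule poly_mapping_eqI) (simp add: lookup_single when_def)

lemma finsupp_induct [case_names zero delta add]:
  fixes x :: "'b \<Rightarrow>\<^sub>0 complex"
  assumes "P 0" and "\<And>b c. P (delta b c)" and "\<And>x y. P x \<Longrightarrow> P y \<Longrightarrow> P (x + y)"
  shows "P x"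
proof -
  have "P (\<Sum>b\<in>B. delta b (coeff x b))" if "finite B" for B
    using that by induction (auto intro: assms)
  from this[of "supp x"] show ?thesis
    using finsupp_expansion[of x] by simp
qed

lemma linear_ext_superset:
  assumes "finite B" "supp x \<subseteq> B"
  shows "linear_ext F x = (\<Sum>b\<in>B. cscale (coeff x b) (F b))"
  unfolding linear_ext_def using assms
  by (intro sum.mono_neutral_left) (auto simp: in_keys_iff)

lemma linear_ext_add: "linear_ext F (x + y) = linear_ext F x + linear_ext F y"
proof -
  let ?B = "supp x \<union> supp y"
  have *: "supp (x + y) \<subseteq> ?B" by (rule Poly_Mapping.keys_add)
  show ?thesis
    by (simp add: linear_ext_superset[OF _ *] linear_ext_superset[of ?B x] linear_ext_superset[of ?B y]
        lookup_add cvec.scale_left_distrib sum.distrib)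
qed

lemma linear_ext_cscale: "linear_ext F (cscale c x) = cscale c (linear_ext F x)"
proof -
  have *: "supp (cscale c x) \<subseteq> supp x" by (auto simp: in_keys_iff)
  show ?thesis
    by (simp add: linear_ext_superset[OF _ *] linear_ext_superset[of "supp x" x] cvec.scale_sum_right)
qed

lemma linear_ext_zero [simp]: "linear_ext F 0 = 0"
  by (simp add: linear_ext_def)

lemma linear_ext_delta [simp]: "linear_ext F (delta b c) = cscale c (F b)"
  by (auto simp: linear_ext_def)

lemma linear_ext_uminus: "linear_ext F (- x) = - linear_ext F x"
  using linear_ext_add[of F x "-x"] by (simp add: eq_neg_iff_add_eq_0 add.commute)

lemma linear_ext_diff: "linear_ext F (x - y) = linear_ext F x - linear_ext F y"
  using linear_ext_add[of F x "-y"] by (simp add: linear_ext_uminus)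

lemma loop_add: "loop (x + y) j = loop x j + loop y j"
  and loop_diff: "loop (x - y) j = loop x j - loop y j"
  and loop_uminus: "loop (- x) j = - loop x j"
  and loop_cscale: "loop (cscale c x) j = cscale c (loop x j)"
  and loop_zero: "loop 0 j = 0"
  by (simp_all add: loop_def linear_ext_add linear_ext_diff linear_ext_uminus linear_ext_cscale)

lemma sigma_add: "sigma (x + y) = sigma x + sigma y"
  and sigma_diff: "sigma (x - y) = sigma x - sigma y"
  and sigma_cscale: "sigma (cscale c x) = cscale c (sigma x)"
  by (simp_all add: sigma_def linear_ext_add linear_ext_diff linear_ext_cscale)

lemma lookup_tensor [simp]: "coeff (tensor a f) g = cscale (coeff a g) f"
  unfolding tensor_def by (simp add: Poly_Mapping.map.rep_eq when_def)

lemma tensor_add_left: "tensor (a + b) f = tensor a f + tensor b f"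
  and tensor_add_right: "tensor a (f + g) = tensor a f + tensor a g"
  and tensor_cscale_left: "tensor (cscale c a) f = vscale c (tensor a f)"
  and tensor_cscale_right: "tensor a (cscale c f) = vscale c (tensor a f)"
  and tensor_zero_left [simp]: "tensor 0 f = 0"
  and tensor_zero_right [simp]: "tensor a 0 = 0"
  by (auto intro!: poly_mapping_eqI simp: lookup_add algebra_simps)

lemma supp_cscale: "supp (cscale c f) \<subseteq> supp f"
  by (auto simp: in_keys_iff)

text \<open>
  Reading the derivative off its coefficients is what makes it useful below: a monomial \<open>\<mu>\<close> with \<open>\<mu> p > 0\<close>
  that occurs in \<open>f\<close> is seen again in the derivative, because the factor \<open>\<nu> p + 1\<close> is never zero.
\<close>

lemma lookup_pdiff:
  "coeff (pdiff p f) \<nu> = of_nat (coeff \<nu> p + 1) * coeff f (\<nu> + delta p 1)"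
proof (induction f rule: finsupp_induct)
  case (delta \<mu> c)
  show ?case
  proof (cases "coeff \<mu> p = 0")
    case True
    then have "\<mu> \<noteq> \<nu> + Poly_Mapping.single p 1"
      by (auto simp: lookup_add)
    then show ?thesis
      using True by (simp add: pdiff_def lookup_single)
  next
    case False
    then have "\<mu> = (\<mu> - Poly_Mapping.single p 1) + Poly_Mapping.single p 1"
      by (intro poly_mapping_eqI) (auto simp: lookup_add lookup_minus lookup_single when_def)
    then have iff: "\<mu> - Poly_Mapping.single p 1 = \<nu> \<longleftrightarrow> \<mu> = \<nu> + Poly_Mapping.single p 1"
      by (metis add_diff_cancel_right')
    show ?thesis
      unfolding pdiff_def linear_ext_delta
      by (cases "\<mu> = \<nu> + Poly_Mapping.single p 1")
        (use iff in \<open>auto simp: lookup_single lookup_add\<close>)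
  qed
qed (auto simp: pdiff_def linear_ext_add lookup_add algebra_simps)

lemma pdiff_add: "pdiff p (f + g) = pdiff p f + pdiff p g"
  and pdiff_cscale: "pdiff p (cscale c f) = cscale c (pdiff p f)"
  by (simp_all add: pdiff_def linear_ext_add linear_ext_cscale)

section \<open>Operators on polynomials\<close>

lemma poly_space_subspace: "cvec.subspace (poly_space n)"
  unfolding cvec.subspace_def poly_space_def
  using Poly_Mapping.keys_add supp_cscale by fastforce

lemma one_in_poly_space [simp]: "1 \<in> poly_space n"
  by (simp add: poly_space_def flip: single_one)

lemma var_mult_in_poly_space:
  assumes "f \<in> poly_space n" "j \<in> {1..n}" "odd r"
  shows "var (j, r) * f \<in> poly_space n"
  unfolding poly_space_def
proof (intro CollectI ballI subsetI)
  fix \<mu> q assume \<mu>: "\<mu> \<in> supp (var (j, r) * f)" and q: "q \<in> supp \<mu>"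
  from \<mu> obtain \<nu> where \<nu>: "\<nu> \<in> supp f" "\<mu> = delta (j, r) 1 + \<nu>"
    using keys_mult[of "var (j, r)" f] by (auto simp: var_def)
  with q have "q \<in> supp \<nu> \<or> q = (j, r)"
    by (auto simp: in_keys_iff lookup_add lookup_single when_def split: if_splits)
  then show "q \<in> {1..n} \<times> {r. odd r}"
    using assms \<nu> by (auto simp: poly_space_def)
qed

lemma pdiff_in_poly_space:
  assumes "f \<in> poly_space n"
  shows "pdiff p f \<in> poly_space n"
  unfolding poly_space_def
proof (intro CollectI ballI subsetI)
  fix \<mu> q assume \<mu>: "\<mu> \<in> supp (pdiff p f)" and q: "q \<in> supp \<mu>"
  then have "\<mu> + delta p 1 \<in> supp f" and "q \<in> supp (\<mu> + delta p 1)"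
    by (auto simp: in_keys_iff lookup_pdiff lookup_add)
  then show "q \<in> {1..n} \<times> {r. odd r}"
    using assms by (auto simp: poly_space_def)
qed

lemma op_pow_in_subspace:
  assumes "cvec.subspace P" and "\<And>r f. f \<in> P \<Longrightarrow> T r f \<in> P" and "f \<in> P"
  shows "op_pow T s k f \<in> P"
  by (induction s arbitrary: k)
    (auto intro: assms cvec.subspace_sum cvec.subspace_0)

lemma op_exp_in_subspace:
  assumes "cvec.subspace P" and "\<And>r f. f \<in> P \<Longrightarrow> T r f \<in> P" and "f \<in> P"
  shows "op_exp T k f \<in> P"
  unfolding op_exp_def
  by (intro cvec.subspace_sum cvec.subspace_scale op_pow_in_subspace assms)

lemma E_coeff_in_poly_space:
  assumes f: "f \<in> poly_space n"
  shows "E_coeff n S \<alpha> p f \<in> poly_space n"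
proof -
  note sub = poly_space_subspace[of n]
  have "E_minus n S \<alpha> l f \<in> poly_space n" if "f \<in> poly_space n" for l f
    unfolding E_minus_def
    by (intro op_exp_in_subspace[OF sub] that)
      (auto intro!: cvec.subspace_neg[OF sub] cvec.subspace_sum[OF sub] cvec.subspace_scale[OF sub] cvec.subspace_0[OF sub]
        pdiff_in_poly_space)
  moreover have "E_plus n S \<alpha> l f \<in> poly_space n" if "f \<in> poly_space n" for l f
    unfolding E_plus_def
    by (intro op_exp_in_subspace[OF sub] that)
      (auto intro!: cvec.subspace_neg[OF sub] cvec.subspace_sum[OF sub] cvec.subspace_scale[OF sub] cvec.subspace_0[OF sub]
        var_mult_in_poly_space)
  ultimately show ?thesis
    unfolding E_coeff_def using f by (intro cvec.subspace_sum[OF sub]) auto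
qed

lemma a_coeff_in_poly_space:
  assumes f: "f \<in> poly_space n" and "odd p" "j \<in> {1..n}"
  shows "a_coeff j p f \<in> poly_space n"
  unfolding a_coeff_def using assms
  by (auto intro!: pdiff_in_poly_space cvec.subspace_neg[OF poly_space_subspace]
      cvec.subspace_scale[OF poly_space_subspace]
      var_mult_in_poly_space simp: even_nat_iff)

lemma d_poly_in_poly_space:
  assumes f: "f \<in> poly_space n"
  shows "d_poly f \<in> poly_space n"
proof -
  have "cscale (of_nat (snd q)) (var (fst q, snd q) * pdiff (fst q, snd q) f) \<in> poly_space n"
    if "q \<in> (\<Union>\<mu>\<in>supp f. supp \<mu>)" for q
  proof -
    have "fst q \<in> {1..n}" "odd (snd q)"
    proof -
      have "q \<in> {1..n} \<times> {r. odd r}"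
        using f that unfolding poly_space_def by blast
      then show "fst q \<in> {1..n}" "odd (snd q)" by auto
    qed
    then show ?thesis
      by (intro cvec.subspace_scale[OF poly_space_subspace] var_mult_in_poly_space
          pdiff_in_poly_space f)
  qed
  then show ?thesis
    unfolding d_poly_def case_prod_unfold
    by (intro cvec.subspace_neg[OF poly_space_subspace] cvec.subspace_sum[OF poly_space_subspace])
qed

lemma pdiff_one [simp]: "pdiff p 1 = 0"
  unfolding pdiff_def by (subst single_one[symmetric], subst linear_ext_delta) simp

lemma d_poly_one [simp]: "d_poly 1 = 0"
  by (simp add: d_poly_def)

lemma op_pow_annihilated:
  assumes "\<And>r. T r 0 = 0" and "\<And>r. T r f = 0"
  shows "op_pow T s k f = (if s = 0 \<and> k = 0 then f else 0)"
  by (induction s arbitrary: k) (auto intro!: sum.neutral simp: assms)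

text \<open>
  Only the term of degree zero of an exponential survives on a vector that its exponent kills.
  The polynomial \<open>1\<close> is such a vector for the annihilation part of a vertex operator.
\<close>

lemma op_exp_annihilated:
  assumes "\<And>r. T r 0 = 0" and "\<And>r. T r f = 0"
  shows "op_exp T k f = (if k = 0 then f else 0)"
  unfolding op_exp_def op_pow_annihilated[OF assms]
  by (auto intro!: sum.neutral)

text \<open>
  In \<open>\<Gamma>\<^sub>\<alpha>(z) (e\<^sup>\<gamma> \<otimes> 1)\<close> the annihilation part is the identity and the creation part has only
  nonnegative powers of \<open>z\<close>. So modes with \<open>p > 0\<close> kill the vacuum, and the zero mode does not see
  the polynomial factor.
\<close>

lemma E_coeff_vacuum:
  assumes "0 \<le> p"
  shows "E_coeff n S \<alpha> p 1 = (if p = 0 then 1 else 0)"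
proof -
  have pdiff0: "pdiff q 0 = 0" for q by (simp add: pdiff_def)
  have minus: "E_minus n S \<alpha> l 1 = (if l = 0 then 1 else 0)" for l
    unfolding E_minus_def by (subst op_exp_annihilated) (auto simp: pdiff0)
  have "{l. p \<le> int l \<and> E_minus n S \<alpha> l 1 \<noteq> 0} = (if p = 0 then {0} else {})"
    using assms by (auto simp: minus split: if_splits)
  moreover have "E_plus n S \<alpha> 0 1 = 1"
    by (simp add: E_plus_def op_exp_def)
  ultimately show ?thesis
    by (auto simp: E_coeff_def minus)
qed

lemma a_coeff_vacuum: "0 < p \<Longrightarrow> a_coeff j p 1 = 0"
  by (simp add: a_coeff_def)

section \<open>Twisted multiplication in the group algebra\<close>

text \<open>
  Every function \<open>\<nu>(\<alpha>, -)\<close> factors through \<open>Q/2Q\<close>; as such it is the character with a prescribed sign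
  \<open>s k\<close> at each \<open>\<alpha>\<^sub>k\<close>.
\<close>

definition sign_char :: "nat \<Rightarrow> (nat \<Rightarrow> int) \<Rightarrow> modlattice \<Rightarrow> complex" where
  "sign_char n s g = (\<Prod>k=1..n. if coeff g k = 0 then 1 else of_int (s k))"

definition twist :: "nat \<Rightarrow> (nat \<Rightarrow> int) \<Rightarrow> galgebra \<Rightarrow> galgebra" where
  "twist n s = linear_ext (\<lambda>g. delta g (sign_char n s g))"

text \<open>
  All the operators below depend on \<open>\<alpha>\<close> only through its class in \<open>Q/2Q\<close>, which this set records.
\<close>

definition odd_supp :: "lattice \<Rightarrow> nat set" where
  "odd_supp \<alpha> = {k. odd (coeff \<alpha> k)}"

definition neigh_sign :: "nat \<Rightarrow> nat \<Rightarrow> nat \<Rightarrow> int" where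
  "neigh_sign n l k = (if joined n l k \<and> l \<in> nu_set n then -1 else 1)"

text \<open>
  The sign by which \<open>E\<^sub>\<alpha>\<close>, with \<open>A\<close> the odd support of \<open>\<alpha>\<close>, changes the \<open>k\<close>-th sign of \<open>v(c)\<close>;
  see \<open>twisted_mult_vvect\<close>.
\<close>

definition flip :: "nat \<Rightarrow> nat set \<Rightarrow> nat \<Rightarrow> int" where
  "flip n A k = (\<Prod>l\<in>A. neigh_sign n l k)"

definition nu_sign :: "nat \<Rightarrow> lattice \<Rightarrow> nat \<Rightarrow> int" where
  "nu_sign n \<alpha> k = (if k \<in> odd_supp \<alpha> then -1 else 1) * flip n (odd_supp \<alpha>) k"

text \<open>
  The operator \<open>E\<^sub>\<alpha> : e\<^sup>\<gamma> \<mapsto> \<nu>(\<alpha>, \<gamma>) e\<^bsup>\<alpha>+\<gamma>\<^esup>\<close> of the first tensor factor, written as a product of two maps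
  that both behave well on products: a ring automorphism and a multiplication.
\<close>

definition twisted_mult :: "nat \<Rightarrow> lattice \<Rightarrow> galgebra \<Rightarrow> galgebra" where
  "twisted_mult n \<alpha> a = expo \<alpha> * twist n (nu_sign n \<alpha>) a"

definition lattice_algebra :: "nat \<Rightarrow> galgebra set" where
  "lattice_algebra n = cvec.span (expo ` root_lattice n)"

lemma lookup_mod2: "coeff (mod2 \<gamma>) k = of_int (coeff \<gamma> k)"
  unfolding mod2_def by (simp add: Poly_Mapping.map.rep_eq when_def)

lemma mod2_add: "mod2 (\<alpha> + \<gamma>) = mod2 \<alpha> + mod2 \<gamma>"
  by (rule poly_mapping_eqI) (simp add: lookup_mod2 lookup_add del: add_bit_eq_xor)

lemma expo_add: "expo (\<alpha> + \<gamma>) = expo \<alpha> * expo \<gamma>"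
  by (simp add: expo_def mod2_add mult_single)

lemma expo_zero: "expo 0 = 1"
proof -
  have "mod2 0 = 0" by (rule poly_mapping_eqI) (simp add: lookup_mod2)
  then show ?thesis by (simp add: expo_def)
qed

lemma of_int_bit: "(of_int i :: bit) = (if even i then 0 else 1)"
proof (cases "even i")
  case True
  then obtain j where "i = 2 * j" by blast
  then show ?thesis by simp
next
  case False
  then obtain j where "i = 2 * j + 1" by (auto elim: oddE)
  then show ?thesis by simp
qed

lemma odd_supp_subset: "\<alpha> \<in> root_lattice n \<Longrightarrow> odd_supp \<alpha> \<subseteq> {1..n}"
  unfolding odd_supp_def root_lattice_def
  by (metis (mono_tags, lifting) even_zero in_keys_iff mem_Collect_eq subset_iff)

lemma expo_eq_prod:
  assumes "finite (odd_supp \<alpha>)"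
  shows "expo \<alpha> = (\<Prod>k\<in>odd_supp \<alpha>. expo (simple_root k))"
proof -
  have prod: "(\<Prod>k\<in>A. expo (simple_root k)) = expo (\<Sum>k\<in>A. simple_root k)" if "finite A" for A
    using that by induction (simp_all add: expo_zero expo_add)
  have "coeff (\<Sum>k\<in>odd_supp \<alpha>. simple_root k) i = (if i \<in> odd_supp \<alpha> then 1 else 0)" for i
    using assms by (simp add: lookup_sum simple_root_def lookup_single when_def)
  then have "coeff (mod2 (\<Sum>k\<in>odd_supp \<alpha>. simple_root k)) i = coeff (mod2 \<alpha>) i" for i
    by (simp only: lookup_mod2 of_int_bit) (simp add: odd_supp_def)
  then have "mod2 (\<Sum>k\<in>odd_supp \<alpha>. simple_root k) = mod2 \<alpha>"
    by (rule poly_mapping_eqI)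
  then have "expo (\<Sum>k\<in>odd_supp \<alpha>. simple_root k) = expo \<alpha>"
    by (simp add: expo_def)
  then show ?thesis
    by (simp add: prod[OF assms])
qed

lemma expo_simple_square: "expo (simple_root k) * expo (simple_root k) = 1"
proof -
  have "mod2 (simple_root k + simple_root k) = 0"
    by (rule poly_mapping_eqI, simp only: lookup_mod2 lookup_add of_int_bit) simp
  then have "expo (simple_root k + simple_root k) = 1"
    by (simp add: expo_def)
  then show ?thesis
    unfolding expo_add .
qed

lemma sign_char_zero [simp]: "sign_char n s 0 = 1"
  by (simp add: sign_char_def)

lemma sign_char_add:
  assumes "\<And>k. s k \<in> {1, -1}"
  shows "sign_char n s (g + h) = sign_char n s g * sign_char n s h"
proof -
  have "(of_int (s k) :: complex) * of_int (s k) = 1" for k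
    using assms[of k] by auto
  moreover have "(if x + y = 0 then 1 else w) = (if x = 0 then 1 else w) * (if y = 0 then 1 else w)"
    if "w * w = 1" for x y :: bit and w :: complex
    using that by (cases "x = 0"; cases "y = 0"; simp)
  ultimately show ?thesis
    unfolding sign_char_def prod.distrib[symmetric] lookup_add by (intro prod.cong refl) blast
qed

lemma twist_add: "twist n s (x + y) = twist n s x + twist n s y"
  and twist_cscale: "twist n s (cscale c x) = cscale c (twist n s x)"
  and twist_zero: "twist n s 0 = 0"
  by (simp_all add: twist_def linear_ext_add linear_ext_cscale)

lemma twist_one [simp]: "twist n s 1 = 1"
  unfolding twist_def by (simp flip: single_one)

text \<open>
  Multiplicativity of the twist is the reason why \<open>E\<^sub>\<alpha>\<close> can be computed on the product \<open>v(c)\<close>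
  one factor at a time.
\<close>

lemma twist_mult:
  assumes s: "\<And>k. s k \<in> {1, -1}"
  shows "twist n s (x * y) = twist n s x * twist n s y"
proof (induction x rule: finsupp_induct)
  case (delta b c)
  show ?case
    by (induction y rule: finsupp_induct)
      (simp_all add: twist_zero twist_add distrib_left mult_single, simp add: twist_def mult_single sign_char_add[OF s] ac_simps)
qed (simp_all add: twist_zero twist_add distrib_right)

lemma twist_prod:
  assumes s: "\<And>k. s k \<in> {1, -1}"
  shows "twist n s (\<Prod>k\<in>A. f k) = (\<Prod>k\<in>A. twist n s (f k))"
  by (induction A rule: infinite_finite_induct) (simp_all add: twist_mult[OF s])

lemma neigh_sign_cases: "neigh_sign n l k \<in> {1, -1}"
  by (simp add: neigh_sign_def)

lemma flip_cases: "flip n A k \<in> {1, -1}"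
proof (induction A rule: infinite_finite_induct)
  case (insert x F)
  then show ?case using neigh_sign_cases[of n x k] by (auto simp: flip_def)
qed (auto simp: flip_def)

lemma nu_sign_cases: "nu_sign n \<alpha> k \<in> {1, -1}"
  using flip_cases[of n "odd_supp \<alpha>" k] by (auto simp: nu_sign_def)

lemma sign_powi: "(x::complex) \<in> {1, -1} \<Longrightarrow> x powi i = (if odd i then x else 1)"
  by (auto simp: power_int_minus_left)

text \<open>
  The cocycle is bimultiplicative with values \<open>\<plusminus>1\<close>, so only the parities of the coordinates matter. The
  diagonal values \<open>-1\<close> give the first factor of \<open>nu_sign\<close>, the joined pairs the second one.
\<close>

lemma nu_eq_sign_char:
  assumes "0 < n" and \<alpha>: "\<alpha> \<in> root_lattice n"
  shows "nu n \<alpha> \<gamma> = sign_char n (nu_sign n \<alpha>) (mod2 \<gamma>)"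
proof -
  let ?u = "nu_simple n"
  have u: "?u j k \<in> {1, -1}" for j k by (simp add: nu_simple_def)
  note O = odd_supp_subset[OF \<alpha>]
  then have fin: "finite (odd_supp \<alpha>)" by (rule finite_subset) simp
  have sgn: "(\<Prod>j=1..n. if odd (coeff \<alpha> j) then ?u j k else 1) = of_int (nu_sign n \<alpha> k)" for k
  proof -
    have "(\<Prod>j=1..n. if odd (coeff \<alpha> j) then ?u j k else 1) = (\<Prod>j\<in>odd_supp \<alpha>. ?u j k)"
    proof -
      have "odd_supp \<alpha> = {j \<in> {1..n}. odd (coeff \<alpha> j)}"
        using O by (auto simp: odd_supp_def)
      then show ?thesis by (simp only: prod.inter_filter[OF finite_atLeastAtMost])
    qed
    also have "\<dots> = (\<Prod>j\<in>odd_supp \<alpha>. (if j = k then -1 else 1) * of_int (neigh_sign n j k))"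
      using \<open>0 < n\<close> by (intro prod.cong) (auto simp: nu_simple_def neigh_sign_def joined_def)
    also have "\<dots> = of_int (nu_sign n \<alpha> k)"
      unfolding prod.distrib using fin by (simp add: nu_sign_def flip_def)
    finally show ?thesis .
  qed
  have "nu n \<alpha> \<gamma> = (\<Prod>k=1..n. \<Prod>j=1..n. ?u j k powi (coeff \<alpha> j * coeff \<gamma> k))"
    unfolding nu_def by (rule prod.swap)
  also have "\<dots> = (\<Prod>k=1..n. if odd (coeff \<gamma> k) then \<Prod>j=1..n. if odd (coeff \<alpha> j) then ?u j k else 1 else 1)"
    by (intro prod.cong refl) (simp add: sign_powi[OF u])
  also have "\<dots> = sign_char n (nu_sign n \<alpha>) (mod2 \<gamma>)"
    unfolding sign_char_def sgn by (intro prod.cong refl) (simp add: lookup_mod2 of_int_bit)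
  finally show ?thesis .
qed

lemma twisted_mult_expo:
  assumes "0 < n" "\<alpha> \<in> root_lattice n"
  shows "twisted_mult n \<alpha> (expo \<gamma>) = cscale (nu n \<alpha> \<gamma>) (expo (\<alpha> + \<gamma>))"
  unfolding twisted_mult_def nu_eq_sign_char[OF assms]
  by (simp add: expo_def twist_def mult_single mod2_add)

lemma delta_zero_mult: "delta 0 c * a = cscale c a" for a :: galgebra
  by (simp add: cscale_def mult_map_scale_conv_mult)

lemma mult_cscale_left: "cscale c a * b = cscale c (a * b)"
  and mult_cscale_right: "a * cscale c b = cscale c (a * b)" for a b :: galgebra
  by (metis delta_zero_mult mult.assoc mult.left_commute)+

lemma twisted_mult_add: "twisted_mult n \<alpha> (x + y) = twisted_mult n \<alpha> x + twisted_mult n \<alpha> y"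
  and twisted_mult_cscale: "twisted_mult n \<alpha> (cscale c x) = cscale c (twisted_mult n \<alpha> x)"
  and twisted_mult_zero: "twisted_mult n \<alpha> 0 = 0"
  by (simp_all add: twisted_mult_def twist_add twist_cscale twist_zero distrib_left mult_cscale_right)

text \<open>
  This formula carries the whole argument. The twist turns the \<open>k\<close>-th factor \<open>1 + i c\<^sub>k e\<^bsup>\<alpha>\<^sub>k\<^esup>\<close> into
  \<open>1 + i c\<^sub>k s\<^sub>k e\<^bsup>\<alpha>\<^sub>k\<^esup>\<close> with \<open>s\<^sub>k = \<nu>(\<alpha>, \<alpha>\<^sub>k)\<close>. If \<open>\<alpha>\<^sub>k\<close> occurs in \<open>\<alpha>\<close> with odd coefficient, the factor is
  then multiplied by \<open>e\<^bsup>\<alpha>\<^sub>k\<^esup>\<close>, and \<open>e\<^bsup>2\<alpha>\<^sub>k\<^esup> = 1\<close> gives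
  \<open>e\<^bsup>\<alpha>\<^sub>k\<^esup> (1 + i x e\<^bsup>\<alpha>\<^sub>k\<^esup>) = i x (1 - i x e\<^bsup>\<alpha>\<^sub>k\<^esup>)\<close> for \<open>x = \<plusminus>1\<close>. This second sign change cancels the diagonal
  part of \<open>s\<^sub>k\<close>, so that only \<open>flip\<close> remains.
\<close>

lemma twisted_mult_vvect:
  assumes \<alpha>: "\<alpha> \<in> root_lattice n" and c: "\<forall>k\<in>{1..n}. c k \<in> {1, -1}"
  defines "A \<equiv> odd_supp \<alpha>"
  shows "twisted_mult n \<alpha> (vvect n c) =
    cscale (\<Prod>k\<in>A. - \<i> * of_int (c k * flip n A k)) (vvect n (\<lambda>k. c k * flip n A k))"
proof -
  let ?e = "\<lambda>k. expo (simple_root k)" and ?s = "nu_sign n \<alpha>" and ?t = "flip n A"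
  have A: "A \<subseteq> {1..n}" using odd_supp_subset[OF \<alpha>] by (simp add: A_def)
  then have fin: "finite A" by (rule finite_subset) simp
  \<comment> \<open>the twist multiplies \<open>c\<^sub>k\<close> by \<open>\<nu>(\<alpha>, \<alpha>\<^sub>k)\<close>\<close>
  have tw: "twist n ?s (1 + cscale (\<i> * of_int (c k)) (?e k))
      = 1 + cscale (\<i> * of_int (c k * ?s k)) (?e k)" if "k \<in> {1..n}" for k
  proof -
    have "sign_char n ?s (mod2 (simple_root k)) = of_int (?s k)"
    proof -
      have "sign_char n ?s (mod2 (simple_root k)) = (\<Prod>j=1..n. if j = k then of_int (?s j) else 1)"
        unfolding sign_char_def
        by (intro prod.cong refl) (simp add: lookup_mod2 simple_root_def lookup_single)
      then show ?thesis using that by simp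
    qed
    then show ?thesis
      by (simp add: twist_add twist_cscale) (simp add: twist_def expo_def ac_simps)
  qed
  \<comment> \<open>multiplication by \<open>e\<^bsup>\<alpha>\<^sub>k\<^esup>\<close> reflects the factor if \<open>k \<in> A\<close>, and there \<open>s\<^sub>k\<close> and the flip have opposite signs\<close>
  have fac: "(if k \<in> A then ?e k else 1) * (1 + cscale (\<i> * of_int (c k * ?s k)) (?e k))
     = cscale (if k \<in> A then - \<i> * of_int (c k * ?t k) else 1) (1 + cscale (\<i> * of_int (c k * ?t k)) (?e k))"
    if "k \<in> {1..n}" for k
  proof (cases "k \<in> A")
    case True
    define x where "x = c k * ?t k"
    have "c k * ?s k = - x" using True by (simp add: x_def nu_sign_def A_def)
    moreover have "\<i> * of_int x * (\<i> * of_int x) = (-1::complex)"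
      using c[rule_format, OF that] flip_cases[of n A k] by (auto simp: x_def)
    ultimately show ?thesis using True
      by (simp add: distrib_left right_diff_distrib mult_cscale_right expo_simple_square
          cvec.scale_right_distrib cvec.scale_right_diff_distrib
          flip: x_def)
  next
    case False
    then show ?thesis by (simp add: nu_sign_def A_def)
  qed
  have "twisted_mult n \<alpha> (vvect n c)
     = (\<Prod>k\<in>A. ?e k) * (\<Prod>k=1..n. 1 + cscale (\<i> * of_int (c k * ?s k)) (?e k))"
    unfolding twisted_mult_def vvect_def twist_prod[OF nu_sign_cases]
    using fin tw by (simp add: expo_eq_prod A_def del: of_int_mult)
  also have "(\<Prod>k\<in>A. ?e k) = (\<Prod>k=1..n. if k \<in> A then ?e k else 1)"
    using A by (simp add: prod.If_cases Int_absorb1)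
  also have "\<dots> * (\<Prod>k=1..n. 1 + cscale (\<i> * of_int (c k * ?s k)) (?e k))
    = (\<Prod>k=1..n. cscale (if k \<in> A then - \<i> * of_int (c k * ?t k) else 1) (1 + cscale (\<i> * of_int (c k * ?t k)) (?e k)))"
    unfolding prod.distrib[symmetric] using fac by (intro prod.cong refl) (simp del: of_int_mult)
  also have "\<dots> = cscale (\<Prod>k=1..n. if k \<in> A then - \<i> * of_int (c k * ?t k) else 1)
      (vvect n (\<lambda>k. c k * ?t k))"
  proof -
    have "(\<Prod>k\<in>B. cscale (p k) (q k)) = cscale (\<Prod>k\<in>B. p k) (\<Prod>k\<in>B. q k)"
      for B :: "nat set" and p and q :: "nat \<Rightarrow> galgebra"
      by (induction B rule: infinite_finite_induct)
        (simp_all add: mult_cscale_left mult_cscale_right mult.commute)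
    then show ?thesis by (simp add: vvect_def)
  qed
  also have "(\<Prod>k=1..n. if k \<in> A then - \<i> * of_int (c k * ?t k) else 1)
     = (\<Prod>k\<in>A. - \<i> * of_int (c k * ?t k))"
    using A by (simp add: prod.If_cases Int_absorb1)
  finally show ?thesis .
qed

lemma vvect_cong: "(\<And>k. k \<in> {1..n} \<Longrightarrow> b k = c k) \<Longrightarrow> vvect n b = vvect n c"
  unfolding vvect_def by (intro prod.cong) auto

text \<open>
  Each factor of \<open>v(c)\<close> is invertible: \<open>(1 + i x e\<^bsup>\<alpha>\<^sub>k\<^esup>) (1 - i x e\<^bsup>\<alpha>\<^sub>k\<^esup>) = 2\<close>, hence \<open>v(c) v(-c) = 2\<^sup>n\<close>.
\<close>

lemma vvect_nonzero:
  assumes c: "\<forall>k\<in>{1..n}. c k \<in> {1, -1}"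
  shows "vvect n c \<noteq> 0"
proof
  assume "vvect n c = 0"
  have "vvect n c * vvect n (\<lambda>k. - c k) = (\<Prod>k=1..n. delta 0 2)"
    unfolding vvect_def prod.distrib[symmetric]
  proof (intro prod.cong refl)
    fix k assume "k \<in> {1..n}"
    then have "\<i> * of_int (c k) * (\<i> * of_int (c k)) = (-1::complex)"
      using c[rule_format, of k] by auto
    moreover have "1 + 1 = delta (0::modlattice) (2::complex)"
      by (simp flip: single_one single_add)
    ultimately show "(1 + cscale (\<i> * of_int (c k)) (expo (simple_root k))) *
        (1 + cscale (\<i> * of_int (- c k)) (expo (simple_root k))) = delta 0 2"
      by (simp add: distrib_left distrib_right mult_cscale_left mult_cscale_right expo_simple_square
          right_diff_distrib cvec.scale_right_distrib cvec.scale_right_diff_distrib)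
  qed
  also have "\<dots> = delta 0 (2 ^ n)"
  proof -
    have "delta (0::modlattice) (2::complex) ^ n = delta 0 (2 ^ n)"
      by (induction n) (simp_all add: mult_single del: single_numeral)
    then show ?thesis by (simp del: single_numeral)
  qed
  finally show False
    by (simp add: \<open>vvect n c = 0\<close>) (metis lookup_single_eq lookup_zero power_not_zero zero_neq_numeral)
qed

lemma root_lattice_add: "\<alpha> \<in> root_lattice n \<Longrightarrow> \<beta> \<in> root_lattice n \<Longrightarrow> \<alpha> + \<beta> \<in> root_lattice n"
  using Poly_Mapping.keys_add[of \<alpha> \<beta>] by (auto simp: root_lattice_def)

lemma simple_root_in_root_lattice: "k \<in> {1..n} \<Longrightarrow> simple_root k \<in> root_lattice n"
  by (simp add: root_lattice_def simple_root_def)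

lemma vvect_in_lattice_algebra: "vvect n c \<in> lattice_algebra n"
proof -
  have mult: "a * expo \<gamma> \<in> lattice_algebra n"
    if "a \<in> lattice_algebra n" "\<gamma> \<in> root_lattice n" for a \<gamma>
    using that(1) unfolding lattice_algebra_def
  proof (induction rule: cvec.span_induct_alt)
    case base
    then show ?case by (simp add: cvec.span_zero)
  next
    case (step x a b)
    then obtain \<beta> where "\<beta> \<in> root_lattice n" "a = expo \<beta>" by blast
    then have "a * expo \<gamma> \<in> cvec.span (expo ` root_lattice n)"
      using that(2) by (auto simp flip: expo_add intro: cvec.span_base root_lattice_add)
    then show ?case
      unfolding distrib_right mult_cscale_left
      by (intro cvec.span_add cvec.span_scale step.IH)
  qed
  have "(\<Prod>k\<in>B. 1 + cscale (d k) (expo (simple_root k))) \<in> lattice_algebra n"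
    if "finite B" "B \<subseteq> {1..n}" for B d
    using that
  proof (induction B)
    case empty
    have "1 = expo 0" by (simp add: expo_zero)
    then show ?case by (auto simp: lattice_algebra_def root_lattice_def intro!: cvec.span_base)
  next
    case (insert k B)
    then show ?case
      unfolding prod.insert[OF insert.hyps]
      by (subst mult.commute)
        (auto simp: distrib_left mult_cscale_right lattice_algebra_def
          intro!: cvec.span_add cvec.span_scale mult[unfolded lattice_algebra_def] simple_root_in_root_lattice)
  qed
  then show ?thesis by (simp add: vvect_def)
qed

section \<open>Spanning the twisted affine algebra\<close>

text \<open>
  The coefficient of \<open>z\<^bsup>-p\<^esup>\<close> in the generating series that the representation sends to \<open>\<Gamma>\<^sub>\<alpha>(z)\<close>.
\<close>

definition root_mode :: "lattice \<Rightarrow> int \<Rightarrow> aff" where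
  "root_mode \<alpha> p = loop (Xvec \<alpha> + cscale ((-1) powi p) (Xvec (- \<alpha>))) p"

lemma root_uminus: "\<alpha> \<in> roots n \<Longrightarrow> - \<alpha> \<in> roots n"
  by (simp add: roots_def root_lattice_def lform_def)

text \<open>
  An eigenvector \<open>x\<close> of \<open>\<sigma>\<close> with eigenvalue \<open>\<epsilon> = \<plusminus>1\<close> is the average \<open>(x + \<epsilon> \<sigma> x) / 2\<close>, which is a combination of
  the symmetrized basis vectors \<open>b + \<epsilon> \<sigma> b\<close>.
\<close>

lemma loop_in_subspace:
  assumes P: "cvec.subspace P" and x: "supp x \<subseteq> B" "sigma x = cscale \<epsilon> x" and "\<epsilon> * \<epsilon> = 1"
    and B: "\<And>b. b \<in> B \<Longrightarrow> loop (delta b 1 + cscale \<epsilon> (sigma_basis b)) j \<in> P"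
  shows "loop x j \<in> P"
proof -
  have "x = cscale (1/2) (x + cscale \<epsilon> (sigma x))"
    using assms by (simp add: cvec.scale_right_distrib) (simp flip: cvec.scale_left_distrib)
  also have "x + cscale \<epsilon> (sigma x) =
      linear_ext (\<lambda>b. delta b 1 + cscale \<epsilon> (sigma_basis b)) x"
    by (subst (1) finsupp_expansion[of x])
      (simp add: sigma_def linear_ext_def cvec.scale_sum_right sum.distrib cvec.scale_right_distrib mult.commute)
  finally have "loop x j = cscale (1/2) (loop (linear_ext (\<lambda>b. delta b 1 + cscale \<epsilon> (sigma_basis b)) x) j)"
    by (metis loop_cscale)
  moreover have "loop (linear_ext F y) j \<in> P" if "supp y \<subseteq> B" "\<And>b. b \<in> B \<Longrightarrow> loop (F b) j \<in> P"
    for F and y :: galg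
  proof -
    have "loop (\<Sum>b\<in>A. G b) j = (\<Sum>b\<in>A. loop (G b) j)" if "finite A" for A :: "gbasis set" and G
      using that by induction (simp_all add: loop_zero loop_add)
    then show ?thesis
      using that unfolding linear_ext_def
      by (auto simp: loop_cscale intro!: cvec.subspace_sum[OF P] cvec.subspace_scale[OF P])
  qed
  ultimately show ?thesis
    using x B cvec.subspace_scale[OF P] by auto
qed

text \<open>
  The twisted algebra is spanned by the modes whose action on \<open>V\<close> is given explicitly. Symmetrizing a
  basis vector gives a mode of \<open>\<Gamma>\<^sub>\<alpha>\<close> for \<open>X\<^sub>\<alpha>\<close>, and zero or \<open>2 H\<close> for \<open>H \<in> \<hh>\<close>.
\<close>

lemma ghat_subset_subspace:
  assumes P: "cvec.subspace P" "K_elt \<in> P" "d_elt \<in> P"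
    and root: "\<And>\<alpha> p. \<alpha> \<in> roots n \<Longrightarrow> root_mode \<alpha> p \<in> P"
    and cart: "\<And>H p. H \<in> h_space n \<Longrightarrow> odd p \<Longrightarrow> loop H p \<in> P"
  shows "ghat n \<subseteq> P"
proof -
  have "loop x j \<in> P" if "supp x \<subseteq> HB ` {1..n} \<union> XB ` roots n" "sigma x = cscale ((-1) powi j) x" for x j
  proof (rule loop_in_subspace[OF P(1) that])
    show "(-1) powi j * (-1) powi j = (1::complex)"
      by (cases "even j") simp_all
    fix b assume b: "b \<in> HB ` {1..n} \<union> XB ` roots n"
    show "loop (delta b 1 + cscale ((-1) powi j) (sigma_basis b)) j \<in> P"
    proof (cases "b \<in> XB ` roots n")
      case True
      then show ?thesis using root by (auto simp: root_mode_def Xvec_def)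
    next
      case False
      then obtain i where i: "i \<in> {1..n}" "b = HB i" using b by auto
      show ?thesis
      proof (cases "even j")
        case True
        then show ?thesis
          using i P by (simp add: loop_zero cvec.subspace_0)
      next
        case False
        then have "delta b 1 + cscale ((-1) powi j) (sigma_basis b) = delta b 1 + delta b 1"
          using i by (simp flip: single_uminus)
        then show ?thesis
          using i False by (auto intro!: cart simp: h_space_def simp flip: single_add)
      qed
    qed
  qed
  then show ?thesis
    unfolding ghat_def using P
    by (intro cvec.span_minimal) (auto simp: g_even_def g_odd_def g_space_def)
qed

lemma root_mode_in_ghat: "\<alpha> \<in> roots n \<Longrightarrow> root_mode \<alpha> p \<in> ghat n"
proof -
  assume \<alpha>: "\<alpha> \<in> roots n"
  let ?x = "Xvec \<alpha> + cscale ((-1) powi p) (Xvec (- \<alpha>))"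
  have "supp ?x \<subseteq> XB ` roots n"
    using Poly_Mapping.keys_add[of "Xvec \<alpha>" "cscale ((-1) powi p) (Xvec (- \<alpha>))"] \<alpha> root_uminus[OF \<alpha>]
    by (auto simp: Xvec_def split: if_splits)
  moreover have "sigma (Xvec \<beta>) = Xvec (- \<beta>)" for \<beta>
    by (simp add: sigma_def Xvec_def)
  then have "sigma ?x = cscale ((-1) powi p) ?x"
    by (cases "even p") (simp_all add: sigma_add sigma_cscale sigma_diff add.commute)
  ultimately have "(if even p then ?x \<in> g_even n else ?x \<in> g_odd n)"
    by (cases "even p") (auto simp: g_even_def g_odd_def g_space_def)
  then show ?thesis
    unfolding ghat_def root_mode_def by (intro cvec.span_base) (auto split: if_splits)
qed

lemma cartan_mode_in_ghat:
  assumes "H \<in> h_space n" "odd p"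
  shows "loop H p \<in> ghat n"
proof -
  have "sigma H = (\<Sum>b\<in>supp H. cscale (coeff H b) (- delta b 1))"
    unfolding sigma_def linear_ext_def
    using assms(1) by (intro sum.cong) (auto simp: h_space_def)
  also have "\<dots> = - H"
    by (subst (3) finsupp_expansion[of H]) (simp add: sum_negf)
  finally have "H \<in> g_odd n"
    using assms by (auto simp: g_odd_def g_space_def h_space_def)
  then show ?thesis
    using assms unfolding ghat_def by (intro cvec.span_base) auto
qed

lemma K_in_ghat: "K_elt \<in> ghat n" and d_in_ghat: "d_elt \<in> ghat n"
  unfolding ghat_def by (auto intro: cvec.span_base)

lemma ghat_subspace: "cvec.subspace (ghat n)"
  by (simp add: ghat_def)

section \<open>The action on decomposable vectors\<close>

lemma tensor_in_V_space:
  assumes "a \<in> lattice_algebra n" "f \<in> poly_space n"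
  shows "tensor a f \<in> V_space n"
  using assms(1) unfolding lattice_algebra_def
proof (induction rule: cvec.span_induct_alt)
  case base
  then show ?case by (simp add: V_space_def vvec.span_zero)
next
  case (step c x y)
  then show ?case
    using assms(2) unfolding V_space_def tensor_add_left tensor_cscale_left
    by (intro vvec.span_add vvec.span_scale) (auto intro: vvec.span_base)
qed

lemma V_space_subspace: "vvec.subspace (V_space n)"
  by (simp add: V_space_def)

locale vertex_rep =
  fixes n :: nat and S :: "nat \<Rightarrow> galg" and \<rho> :: "aff \<Rightarrow> vspace \<Rightarrow> vspace"
  assumes n_ge_4: "4 \<le> n"
    and basis: "orthonormal_basis n S"
    and rep: "vertex_representation n S \<rho>"
begin

lemma V_module: "ghat_module n \<rho> (V_space n)"
  using rep by (simp add: vertex_representation_def)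

lemma
  assumes x: "x \<in> ghat n" and v: "v \<in> V_space n"
  shows act_vscale: "\<rho> x (vscale c v) = vscale c (\<rho> x v)"
    and act_cscale: "\<rho> (cscale c x) v = vscale c (\<rho> x v)"
    and act_add: "w \<in> V_space n \<Longrightarrow> \<rho> x (v + w) = \<rho> x v + \<rho> x w"
    and act_add_left: "y \<in> ghat n \<Longrightarrow> \<rho> (x + y) v = \<rho> x v + \<rho> y v"
  using V_module assms unfolding ghat_module_def by auto

lemma act_zero: "x \<in> ghat n \<Longrightarrow> \<rho> x 0 = 0"
  using act_vscale[of x 0 0] V_space_subspace by (simp add: vvec.subspace_0)

text \<open>
  The representation is given on the vectors \<open>e\<^sup>\<gamma> \<otimes> f\<close>. This lemma carries a formula over to \<open>a \<otimes> f\<close>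
  for every \<open>a\<close> in their span. Membership in \<open>V\<close> is part of the induction, since the operators are
  known to be linear only there.
\<close>

lemma act_tensor_extend:
  assumes x: "x \<in> ghat n" and f: "f \<in> poly_space n"
    and lin: "\<And>a b. M (a + b) = M a + M b" "\<And>c a. M (cscale c a) = vscale c (M a)"
    and gen: "\<And>\<gamma>. \<gamma> \<in> root_lattice n \<Longrightarrow> \<rho> x (tensor (expo \<gamma>) f) = M (expo \<gamma>)"
    and a: "a \<in> lattice_algebra n"
  shows "\<rho> x (tensor a f) = M a"
proof -
  have "tensor a f \<in> V_space n \<and> \<rho> x (tensor a f) = M a"
    using a unfolding lattice_algebra_def
  proof (induction rule: cvec.span_induct_alt)
    case base
    show ?case
      using lin(2)[of 0 0] V_space_subspace by (simp add: act_zero[OF x] vvec.subspace_0)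
  next
    case (step c e b)
    then obtain \<gamma> where \<gamma>: "\<gamma> \<in> root_lattice n" "e = expo \<gamma>" by blast
    have "tensor (expo \<gamma>) f \<in> V_space n"
      using \<gamma> f by (intro tensor_in_V_space) (simp_all add: lattice_algebra_def cvec.span_base)
    moreover from this have "vscale c (tensor (expo \<gamma>) f) \<in> V_space n"
      using V_space_subspace by (simp add: vvec.subspace_scale)
    ultimately show ?case
      using \<gamma> step.IH
      by (simp add: tensor_add_left tensor_cscale_left act_add[OF x] act_vscale[OF x] gen lin
          vvec.subspace_add[OF V_space_subspace])
  qed
  then show ?thesis ..
qed

lemma root_lattice_of_root: "\<alpha> \<in> roots n \<Longrightarrow> \<alpha> \<in> root_lattice n"
  by (simp add: roots_def)

lemma act_root_mode:
  assumes \<alpha>: "\<alpha> \<in> roots n" and a: "a \<in> lattice_algebra n" and f: "f \<in> poly_space n"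
  shows "\<rho> (root_mode \<alpha> p) (tensor a f)
    = vscale (1/2) (tensor (twisted_mult n \<alpha> a) (E_coeff n S \<alpha> p f))"
proof (rule act_tensor_extend[OF root_mode_in_ghat[OF \<alpha>] f _ _ _ a])
  fix \<gamma> assume "\<gamma> \<in> root_lattice n"
  then have "\<rho> (root_mode \<alpha> p) (tensor (expo \<gamma>) f)
     = vscale (1 / 2 * nu n \<alpha> \<gamma>) (tensor (expo (\<alpha> + \<gamma>)) (E_coeff n S \<alpha> p f))"
    using rep \<alpha> f by (simp add: vertex_representation_def root_mode_def)
  then show "\<rho> (root_mode \<alpha> p) (tensor (expo \<gamma>) f)
     = vscale (1/2) (tensor (twisted_mult n \<alpha> (expo \<gamma>)) (E_coeff n S \<alpha> p f))"
    using n_ge_4 by (simp add: twisted_mult_expo root_lattice_of_root[OF \<alpha>] tensor_cscale_left)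
qed (simp_all add: twisted_mult_add twisted_mult_cscale tensor_add_left tensor_cscale_left vvec.scale_right_distrib mult.commute)

lemma act_cartan_mode:
  assumes H: "H \<in> h_space n" "odd p" and a: "a \<in> lattice_algebra n" and f: "f \<in> poly_space n"
  shows "\<rho> (loop H p) (tensor a f) = tensor a (cscale (1 / complex_of_real (sqrt 2))
               (\<Sum>j=1..n. cscale (gform n H (S j)) (a_coeff j p f)))"
  by (rule act_tensor_extend[OF cartan_mode_in_ghat[OF H] f _ _ _ a])
    (use rep H f in \<open>simp_all add: vertex_representation_def tensor_add_left tensor_cscale_left\<close>)

lemma act_d:
  assumes a: "a \<in> lattice_algebra n" and f: "f \<in> poly_space n"
  shows "\<rho> d_elt (tensor a f) = tensor a (d_poly f)"
  by (rule act_tensor_extend[OF d_in_ghat f _ _ _ a])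
    (use rep f in \<open>simp_all add: vertex_representation_def tensor_add_left tensor_cscale_left\<close>)

lemma act_K: "v \<in> V_space n \<Longrightarrow> \<rho> K_elt v = v"
  using rep by (simp add: vertex_representation_def)

lemma S_in_h_space: "j \<in> {1..n} \<Longrightarrow> S j \<in> h_space n"
  using basis by (simp add: orthonormal_basis_def)

text \<open>
  Orthonormality of the \<open>S\<^sub>j\<close> isolates one oscillator: derivations and multiplications by single
  variables are the action of elements of \<open>\<hh> \<otimes> t\<^sup>p\<close>.
\<close>

lemma act_oscillator:
  assumes j: "j \<in> {1..n}" "odd p" and a: "a \<in> lattice_algebra n" and f: "f \<in> poly_space n"
  shows "\<rho> (loop (S j) p) (tensor a f) = vscale (1 / complex_of_real (sqrt 2)) (tensor a (a_coeff j p f))"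
proof -
  have "(\<Sum>k=1..n. cscale (gform n (S j) (S k)) (a_coeff k p f))
      = (\<Sum>k=1..n. if k = j then a_coeff k p f else 0)"
    using basis j by (intro sum.cong) (auto simp: orthonormal_basis_def)
  also have "\<dots> = a_coeff j p f" using j by simp
  finally show ?thesis
    using act_cartan_mode[OF S_in_h_space[OF j(1)] j(2) a f] by (simp add: tensor_cscale_right)
qed

section \<open>Zero modes on the vacuum\<close>

text \<open>
  On vectors \<open>a \<otimes> 1\<close> the algebra \<open>\<gg>\<^bsub>0\<^esub> \<otimes> t\<^sup>0\<close> acts through the first factor. The relation also records
  membership in the algebra, so that it is closed under linear combinations of \<open>y\<close>.
\<close>

definition acts :: "galg \<Rightarrow> galgebra \<Rightarrow> galgebra \<Rightarrow> bool" where
  "acts y a b \<longleftrightarrow> loop y 0 \<in> ghat n \<and> \<rho> (loop y 0) (tensor a 1) = tensor b 1"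

lemma acts_cscale: "acts y a b \<Longrightarrow> a \<in> lattice_algebra n \<Longrightarrow> acts (cscale c y) a (cscale c b)"
  by (simp add: acts_def loop_cscale cvec.subspace_scale[OF ghat_subspace] act_cscale
      tensor_in_V_space tensor_cscale_left)

lemma acts_add: "acts y a b \<Longrightarrow> acts y' a b' \<Longrightarrow> a \<in> lattice_algebra n \<Longrightarrow> acts (y + y') a (b + b')"
  by (simp add: acts_def loop_add cvec.subspace_add[OF ghat_subspace] act_add_left
      tensor_in_V_space tensor_add_left)

lemma acts_diff: "acts y a b \<Longrightarrow> acts y' a b' \<Longrightarrow> a \<in> lattice_algebra n \<Longrightarrow> acts (y - y') a (b - b')"
  using acts_add[of y a b "cscale (-1) y'" "cscale (-1) b'"] acts_cscale[of y' a b' "-1"] by simp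

lemma loop_Yvec: "loop (Yvec \<alpha>) 0 = root_mode \<alpha> 0"
  by (simp add: root_mode_def Yvec_def)

lemma acts_Yvec:
  assumes "\<alpha> \<in> roots n" "a \<in> lattice_algebra n"
  shows "acts (Yvec \<alpha>) a (cscale (1/2) (twisted_mult n \<alpha> a))"
  using assms unfolding acts_def loop_Yvec
  by (simp add: root_mode_in_ghat act_root_mode E_coeff_vacuum tensor_cscale_left)

end

section \<open>Roots of type \<open>D\<^sub>n\<close>\<close>

lemma double_sum_Suc:
  "(\<Sum>j=1..Suc N. \<Sum>k=1..Suc N. f j k)
    = (\<Sum>j=1..N. \<Sum>k=1..N. f j k) + (\<Sum>j=1..N. f j (Suc N)) + (\<Sum>k=1..N. f (Suc N) k)
      + (f (Suc N) (Suc N) :: int)"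
  by (simp add: sum.distrib algebra_simps)

lemma sum_single_index:
  fixes g :: "nat \<Rightarrow> int"
  assumes "q \<in> {1..N}" and "\<And>j. j \<in> {1..N} \<Longrightarrow> j \<noteq> q \<Longrightarrow> g j = 0"
  shows "(\<Sum>j=1..N. g j) = g q"
proof -
  have "(\<Sum>j=1..N. g j) = (\<Sum>j=1..N. if j = q then g q else 0)"
    using assms(2) by (intro sum.cong) auto
  then show ?thesis using assms(1) by simp
qed

text \<open>
  In the coordinates \<open>\<epsilon>\<^sub>i\<close> with \<open>\<alpha>\<^sub>i = \<epsilon>\<^sub>i - \<epsilon>\<^bsub>i+1\<^esub>\<close> for \<open>i < n\<close> and \<open>\<alpha>\<^sub>n = \<epsilon>\<^bsub>n-1\<^esub> + \<epsilon>\<^sub>n\<close> the form of type \<open>D\<^sub>n\<close> is a sum of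
  squares. It then suffices to see that a lattice vector has the shape \<open>\<epsilon>\<^sub>p \<plusminus> \<epsilon>\<^sub>q\<close> to know that it is
  a root.
\<close>

lemma lform_square:
  assumes n: "4 \<le> n" and \<alpha>: "\<alpha> \<in> root_lattice n"
  shows "lform n \<alpha> \<alpha> =
    (\<Sum>i=1..n-2. (coeff \<alpha> i - coeff \<alpha> (i - 1))\<^sup>2)
     + (coeff \<alpha> (n - 1) + coeff \<alpha> n - coeff \<alpha> (n - 2))\<^sup>2 + (coeff \<alpha> n - coeff \<alpha> (n - 1))\<^sup>2"
proof -
  define N where "N = n - 2"
  have N: "n = Suc (Suc N)" and N2: "2 \<le> N"
    using n by (simp_all add: N_def)
  \<comment> \<open>with \<open>N = n - 2\<close> the first \<open>N\<close> nodes form a chain, to whose end the last two nodes are attached\<close>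
  define a where "a = coeff \<alpha>"
  define f where "f j k = a j * a k * cartan n j k" for j k
  have a0: "a 0 = 0" using \<alpha> by (auto simp: a_def root_lattice_def in_keys_iff)
  \<comment> \<open>the chain of type \<open>A\<^sub>M\<close>, with the convention \<open>a 0 = 0\<close>; the term \<open>(a M)\<^sup>2\<close> is the square of its last coordinate\<close>
  have chain: "(\<Sum>j=1..M. \<Sum>k=1..M. f j k) = (\<Sum>i=1..M. (a i - a (i - 1))\<^sup>2) + (a M)\<^sup>2" if "M \<le> N" for M
    using that
  proof (induction M)
    case 0
    then show ?case by (simp add: a0)
  next
    case (Suc M)
    have 1: "(\<Sum>j=1..M. f j (Suc M)) = - a M * a (Suc M)"
    proof (cases "M = 0")
      case False
      then show ?thesis
        using Suc.prems by (subst sum_single_index[of M]) (auto simp: f_def cartan_def joined_def N doubleton_eq_iff)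
    qed (simp add: a0)
    have "f j k = f k j" for j k
      by (auto simp: f_def cartan_def joined_def insert_commute)
    then have 2: "(\<Sum>k=1..M. f (Suc M) k) = - a M * a (Suc M)"
      using 1 by simp
    have 3: "f (Suc M) (Suc M) = 2 * (a (Suc M))\<^sup>2"
      by (simp add: f_def cartan_def power2_eq_square)
    show ?case
      unfolding double_sum_Suc 1 2 3 using Suc
      by (simp add: power2_eq_square algebra_simps)
  qed
  have sym: "f j k = f k j" for j k
    by (auto simp: f_def cartan_def joined_def insert_commute)
  have 1: "(\<Sum>j=1..N. f j (Suc N)) = - a N * a (Suc N)"
    using N2 by (subst sum_single_index[of N]) (auto simp: f_def cartan_def joined_def N doubleton_eq_iff)
  have 2: "(\<Sum>j=1..Suc N. f j (Suc (Suc N))) = - a N * a (Suc (Suc N))"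
    using N2 by (subst sum_single_index[of N]) (auto simp: f_def cartan_def joined_def N doubleton_eq_iff)
  have 3: "f j j = 2 * (a j)\<^sup>2" for j
    by (simp add: f_def cartan_def power2_eq_square)
  have "lform n \<alpha> \<alpha> = (\<Sum>j=1..Suc (Suc N). \<Sum>k=1..Suc (Suc N). f j k)"
    by (simp only: lform_def f_def a_def N)
  also have "\<dots> = (\<Sum>i=1..N. (a i - a (i - 1))\<^sup>2) + (a N)\<^sup>2
      - 2 * a N * a (Suc N) + 2 * (a (Suc N))\<^sup>2 - 2 * a N * a (Suc (Suc N)) + 2 * (a (Suc (Suc N)))\<^sup>2"
    unfolding double_sum_Suc[of _ "Suc N"] 2 3 sym[of "Suc (Suc N)"]
    unfolding double_sum_Suc[of _ N] 1 3 sym[of "Suc N"] chain[OF order_refl] by simp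
  finally show ?thesis
    by (simp add: N power2_eq_square algebra_simps flip: a_def)
qed

text \<open>
  The root \<open>\<epsilon>\<^sub>j + \<epsilon>\<^bsub>k+1\<^esub>\<close>, as \<open>root_sum j k\<close> is \<open>\<epsilon>\<^sub>j - \<epsilon>\<^bsub>k+1\<^esub>\<close> for \<open>k \<le> n - 1\<close>. The second case covers
  \<open>k = n - 2\<close> as well, because \<open>root_sum (n - 1) (n - 2) = 0\<close>.
\<close>

definition plus_root :: "nat \<Rightarrow> nat \<Rightarrow> nat \<Rightarrow> lattice" where
  "plus_root n j k =
     (if k = n - 1 then root_sum j (n - 2) + simple_root n
      else root_sum j k + (root_sum (k + 1) (n - 2) + root_sum (k + 1) (n - 2))
           + simple_root (n - 1) + simple_root n)"

lemma coeff_simple_root: "coeff (simple_root j) i = (if i = j then 1 else 0)"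
  by (simp add: simple_root_def lookup_single when_def)

lemma coeff_root_sum: "coeff (root_sum j k) i = (if j \<le> i \<and> i \<le> k then 1 else 0)"
  by (simp add: root_sum_def lookup_sum coeff_simple_root)

lemma coeff_double: "coeff (2 * x) i = 2 * coeff x i" for x :: lattice
  by (simp only: mult_2 lookup_add)

lemma root_sum_in_root_lattice: "1 \<le> j \<Longrightarrow> k \<le> n \<Longrightarrow> root_sum j k \<in> root_lattice n"
  by (auto simp: root_lattice_def in_keys_iff coeff_root_sum split: if_splits)

lemma plus_root_in_root_lattice:
  assumes "4 \<le> n" "1 \<le> j" "j \<le> k" "k \<le> n - 1"
  shows "plus_root n j k \<in> root_lattice n"
  using assms unfolding plus_root_def if_split[of "\<lambda>x. x \<in> root_lattice n"]
  by (intro conjI impI root_lattice_add root_sum_in_root_lattice simple_root_in_root_lattice) auto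

text \<open>
  The two nonzero \<open>\<epsilon>\<close>-coordinates of \<open>\<alpha>\<close> sit at \<open>j\<close> and \<open>k + 1\<close>. The first \<open>n - 2\<close> coordinates are differences
  along the chain; the last two, where the diagram forks, are dealt with separately.
\<close>

lemma root_criterion:
  assumes n: "4 \<le> n" and lat: "\<alpha> \<in> root_lattice n" and jk: "1 \<le> j" "j \<le> k"
    and chain: "\<And>i. Suc i \<le> n - 2 \<Longrightarrow>
      \<bar>coeff \<alpha> (Suc i) - coeff \<alpha> i\<bar> = (if Suc i = j \<or> Suc i = Suc k then 1 else 0)"
    and fork: "(coeff \<alpha> (n - 1) + coeff \<alpha> n - coeff \<alpha> (n - 2))\<^sup>2 + (coeff \<alpha> n - coeff \<alpha> (n - 1))\<^sup>2
      = (if j \<le> n - 2 then 0 else 1) + (if Suc k \<le> n - 2 then 0 else 1)"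
  shows "\<alpha> \<in> roots n"
proof -
  have "(\<Sum>i=1..n-2. (coeff \<alpha> i - coeff \<alpha> (i - 1))\<^sup>2)
      = (\<Sum>i=1..n-2. (if i = j then 1 else 0) + (if i = Suc k then 1 else 0))"
  proof (rule sum.cong[OF refl])
    fix i assume "i \<in> {1..n-2}"
    then obtain l where l: "i = Suc l" "Suc l \<le> n - 2" by (cases i) auto
    have "(coeff \<alpha> i - coeff \<alpha> (i - 1))\<^sup>2 = \<bar>coeff \<alpha> (Suc l) - coeff \<alpha> l\<bar>\<^sup>2"
      using l by simp
    then show "(coeff \<alpha> i - coeff \<alpha> (i - 1))\<^sup>2 = (if i = j then 1 else 0) + (if i = Suc k then 1 else 0)"
      using jk unfolding chain[OF l(2)] l(1) by auto
  qed
  also have "\<dots> = (if j \<le> n - 2 then 1 else 0) + (if Suc k \<le> n - 2 then 1 else 0)"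
    using jk by (simp add: sum.distrib)
  finally have "lform n \<alpha> \<alpha> = 2"
    unfolding lform_square[OF n lat] using fork by (simp split: if_splits)
  with lat show ?thesis by (simp add: roots_def)
qed

lemma root_sum_in_roots:
  assumes "4 \<le> n" "1 \<le> j" "j \<le> k" "k \<le> n - 1"
  shows "root_sum j k \<in> roots n"
proof (rule root_criterion[OF assms(1) _ assms(2,3)])
  show "root_sum j k \<in> root_lattice n"
    using assms by (intro root_sum_in_root_lattice) auto
qed (use assms in \<open>auto simp: coeff_root_sum\<close>)

lemma coeff_plus_root:
  "coeff (plus_root n j k) i = (if k = n - 1 then (if j \<le> i \<and> i \<le> n - 2 then 1 else 0) + (if i = n then 1 else 0)
     else (if j \<le> i \<and> i \<le> k then 1 else 0) + 2 * (if k < i \<and> i \<le> n - 2 then 1 else 0)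
       + (if i = n - 1 then 1 else 0) + (if i = n then 1 else 0))"
  by (simp add: plus_root_def lookup_add coeff_root_sum coeff_simple_root coeff_double Suc_le_eq)

lemma plus_root_in_roots:
  assumes "4 \<le> n" "1 \<le> j" "j \<le> k" "k \<le> n - 1"
  shows "plus_root n j k \<in> roots n"
proof (rule root_criterion[OF assms(1) plus_root_in_root_lattice[OF assms] assms(2,3)])
  fix i assume "Suc i \<le> n - 2"
  then have "i \<noteq> n - 1" "i \<noteq> n" "i \<le> n - 2" "Suc i \<noteq> n - 1" "Suc i \<noteq> n" "k = n - 1 \<Longrightarrow> Suc i \<noteq> Suc k"
    by auto
  then show "\<bar>coeff (plus_root n j k) (Suc i) - coeff (plus_root n j k) i\<bar>
      = (if Suc i = j \<or> Suc i = Suc k then 1 else 0)"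
    using \<open>Suc i \<le> n - 2\<close> assms(2,3) unfolding coeff_plus_root by auto
next
  have "n - 1 \<noteq> n" "\<not> n - 1 \<le> n - 2" "\<not> n \<le> n - 2" "n - 2 \<noteq> n - 1" "n - 2 \<noteq> n"
    using assms(1) by auto
  then show "(coeff (plus_root n j k) (n - 1) + coeff (plus_root n j k) n - coeff (plus_root n j k) (n - 2))\<^sup>2
      + (coeff (plus_root n j k) n - coeff (plus_root n j k) (n - 1))\<^sup>2
      = (if j \<le> n - 2 then 0 else 1) + (if Suc k \<le> n - 2 then 0 else 1)"
    using assms(2-4) unfolding coeff_plus_root by auto
qed

lemma simple_root_in_roots:
  assumes "4 \<le> n" "k \<in> {1..n}"
  shows "simple_root k \<in> roots n"
proof (cases "k = n")
  case True
  have "plus_root n (n - 1) (n - 1) = simple_root n"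
    using assms by (simp add: plus_root_def root_sum_def)
  then show ?thesis using True plus_root_in_roots[of n "n - 1" "n - 1"] assms by simp
next
  case False
  have "root_sum k k = simple_root k" by (simp add: root_sum_def)
  moreover have "k \<le> n - 1" using assms False by auto
  ultimately show ?thesis using root_sum_in_roots[of n k k] assms by simp
qed

lemma odd_supp_root_sum: "odd_supp (root_sum j k) = {j..k}"
  by (auto simp: odd_supp_def coeff_root_sum split: if_splits)

lemma odd_supp_simple_root: "odd_supp (simple_root k) = {k}"
  by (auto simp: odd_supp_def coeff_simple_root split: if_splits)

lemma odd_supp_plus_root:
  assumes "4 \<le> n" "1 \<le> j" "j \<le> k" "k \<le> n - 1"
  shows "odd_supp (plus_root n j k) =
    (if k = n - 1 then insert n {j..n-2} else insert (n - 1) (insert n {j..k}))"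
proof -
  have "n - 1 \<noteq> n" "\<not> n - 1 \<le> n - 2" "\<not> n \<le> n - 2" "n - 1 \<le> k \<longleftrightarrow> k = n - 1" "\<not> n \<le> k"
    using assms by auto
  then show ?thesis
    unfolding odd_supp_def coeff_plus_root by (auto split: if_splits)
qed

text \<open>
  In \<open>\<epsilon>\<close>-coordinates the case distinction for the \<open>Z\<^bsub>j,k\<^esub>\<close> disappears, apart from the sign at \<open>k = n - 1\<close>.
\<close>

lemma Zvec_eq:
  assumes "4 \<le> n" "1 \<le> j" "j \<le> k" "k \<le> n - 1"
  shows "Zvec n s j k = Yvec (root_sum j k)
     + cscale (if k = n - 1 then - s else s) (Yvec (plus_root n j k))"
proof -
  consider "k \<le> n - 3" | "k = n - 2" | "k = n - 1" using assms by linarith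
  then show ?thesis
  proof cases
    case 1
    then have "k \<noteq> n - 1" using assms by auto
    then show ?thesis using 1 by (simp add: Zvec_def plus_root_def)
  next
    case 2
    then have "\<not> k \<le> n - 3" "k \<noteq> n - 1" "root_sum (k + 1) (n - 2) = 0"
      using assms by (auto simp: root_sum_def)
    then show ?thesis using 2 by (simp add: Zvec_def plus_root_def del: mult_2)
  next
    case 3
    have "{j..n - 1} = insert (n - 1) {j..n - 2}" using assms 3 by auto
    then have "root_sum j (n - 1) = root_sum j (n - 2) + simple_root (n - 1)"
      using assms by (simp add: root_sum_def add.commute)
    moreover have "j = n - 1 \<Longrightarrow> root_sum j (n - 2) = 0"
      using assms by (simp add: root_sum_def)
    moreover have "\<not> k \<le> n - 3" "k \<noteq> n - 2" using assms 3 by auto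
    ultimately show ?thesis using assms(3) 3
      by (cases "j < k") (simp_all add: Zvec_def plus_root_def)
  qed
qed

section \<open>The fork of the Dynkin diagram\<close>

text \<open>
  The nodes \<open>n - 1\<close> and \<open>n\<close> are both joined to \<open>n - 2\<close> and to nothing else, and either both or none of
  them belong to \<open>S\<close>.
\<close>

lemma neigh_sign_fork:
  assumes "4 \<le> n"
  shows "neigh_sign n n k = neigh_sign n (n - 1) k" and "neigh_sign n l n = neigh_sign n l (n - 1)"
proof -
  have "n \<in> nu_set n \<longleftrightarrow> n - 1 \<in> nu_set n"
    using assms by (auto simp: nu_set_def)
  moreover have "joined n n k \<longleftrightarrow> joined n (n - 1) k" "joined n l n \<longleftrightarrow> joined n l (n - 1)"
    using assms by (auto simp: joined_def doubleton_eq_iff)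
  ultimately show "neigh_sign n n k = neigh_sign n (n - 1) k" "neigh_sign n l n = neigh_sign n l (n - 1)"
    by (simp_all add: neigh_sign_def)
qed

lemma neigh_sign_square: "neigh_sign n l k * neigh_sign n l k = 1"
  by (simp add: neigh_sign_def)

text \<open>
  Modulo \<open>2Q\<close> the roots \<open>\<epsilon>\<^sub>j + \<epsilon>\<^bsub>k+1\<^esub>\<close> and \<open>\<epsilon>\<^sub>j - \<epsilon>\<^bsub>k+1\<^esub>\<close> differ only by \<open>\<alpha>\<^bsub>n-1\<^esub> + \<alpha>\<^sub>n\<close>. By the symmetry of the
  fork this changes no flip, and only the scalar notices the difference.
\<close>

lemma twisted_mult_plus_root:
  assumes jk: "4 \<le> n" "1 \<le> j" "j \<le> k" "k \<le> n - 1" and c: "\<forall>k\<in>{1..n}. c k \<in> {1, -1}"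
  shows "twisted_mult n (plus_root n j k) (vvect n c) =
    cscale (of_int ((if k = n - 1 then 1 else -1) * (c (n - 1) * c n))) (twisted_mult n (root_sum j k) (vvect n c))"
proof -
  define A where "A = {j..k}"
  define A' where "A' = (if k = n - 1 then insert n {j..n-2} else insert (n - 1) (insert n {j..k}))"
  have An: "{j..k} = insert (n - 1) {j..n - 2}" if "k = n - 1"
    using jk that by auto
  have flip_insert: "flip n (insert l B) i = neigh_sign n l i * flip n B i" if "finite B" "l \<notin> B" for l B i
    using that by (simp add: flip_def)
  have "flip n A' l = flip n A l" for l
  proof (cases "k = n - 1")
    case True
    have "flip n (insert n {j..n-2}) l = neigh_sign n n l * flip n {j..n-2} l"
      "flip n (insert (n - 1) {j..n-2}) l = neigh_sign n (n - 1) l * flip n {j..n-2} l"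
      using jk(1) by (intro flip_insert; auto)+
    then show ?thesis
      using True An[OF True] by (simp add: A'_def A_def neigh_sign_fork(1)[OF jk(1)])
  next
    case False
    have "flip n A' l = neigh_sign n (n - 1) l * flip n (insert n {j..k}) l"
      "flip n (insert n {j..k}) l = neigh_sign n n l * flip n {j..k} l"
      unfolding A'_def if_not_P[OF False] using jk False by (intro flip_insert; auto)+
    then have "flip n A' l = neigh_sign n (n - 1) l * (neigh_sign n (n - 1) l * flip n A l)"
      by (simp only: A_def neigh_sign_fork(1)[OF jk(1)])
    then show ?thesis
      by (simp only: mult.assoc[symmetric] neigh_sign_square mult_1_left)
  qed
  then have fl: "flip n A' = flip n A" by blast
  define t where "t = flip n A"
  have tn: "t n = t (n - 1)"
    unfolding t_def flip_def neigh_sign_fork(2)[OF jk(1)] ..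
  have cn: "c n * c n = 1" "c (n - 1) * c (n - 1) = 1" "t l * t l = 1" for l
    proof -
    have "n \<in> {1..n}" "n - 1 \<in> {1..n}" using jk(1) by auto
    then show "c n * c n = 1" "c (n - 1) * c (n - 1) = 1" "t l * t l = 1"
      using c flip_cases[of n A l] by (fastforce simp: t_def)+
  qed
  let ?p = "\<lambda>B. \<Prod>k\<in>B. - \<i> * complex_of_int (c k * t k)"
  have "?p A' = of_int ((if k = n - 1 then 1 else -1) * (c (n - 1) * c n)) * ?p A"
  proof (cases "k = n - 1")
    case True
    have "(c (n - 1) * c n) * (c (n - 1) * t (n - 1)) = (c (n - 1) * c (n - 1)) * (c n * t n)"
      unfolding tn by (simp only: ac_simps)
    then have "c n * t n = (c (n - 1) * c n) * (c (n - 1) * t (n - 1))"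
      by (simp only: cn mult_1_left)
    then have "- \<i> * of_int (c n * t n)
        = - \<i> * complex_of_int ((c (n - 1) * c n) * (c (n - 1) * t (n - 1)))"
      by (rule arg_cong)
    then have "- \<i> * of_int (c n * t n)
        = of_int (c (n - 1) * c n) * (- \<i> * complex_of_int (c (n - 1) * t (n - 1)))"
      by (simp only: of_int_mult ac_simps)
    moreover have "?p A' = - \<i> * of_int (c n * t n) * ?p {j..n-2}"
      unfolding A'_def if_P[OF True] using jk(1) by (intro prod.insert) auto
    moreover have "?p A = - \<i> * of_int (c (n - 1) * t (n - 1)) * ?p {j..n-2}"
      unfolding A_def An[OF True] using jk(1) by (intro prod.insert) auto
    ultimately show ?thesis
      using True by (simp only: refl if_True mult_1_left mult.assoc)
  next
    case False
    have "- \<i> * of_int (c (n - 1) * t (n - 1)) * (- \<i> * of_int (c n * t n))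
       = - complex_of_int (c (n - 1) * c n * (t n * t n))"
      unfolding tn by (simp add: algebra_simps)
    then have "- \<i> * of_int (c (n - 1) * t (n - 1)) * (- \<i> * of_int (c n * t n))
       = - complex_of_int (c (n - 1) * c n)"
      using cn by simp
    moreover have "?p A' = - \<i> * of_int (c (n - 1) * t (n - 1)) * ?p (insert n {j..k})"
      "?p (insert n {j..k}) = - \<i> * of_int (c n * t n) * ?p {j..k}"
      unfolding A'_def if_not_P[OF False] using jk False by (intro prod.insert; auto)+
    ultimately show ?thesis
      using False unfolding A_def
      by (simp only: if_False mult.assoc[symmetric]) simp
  qed
  moreover have "twisted_mult n (plus_root n j k) (vvect n c) = cscale (?p A') (vvect n (\<lambda>k. c k * t k))"
    using twisted_mult_vvect[OF plus_root_in_root_lattice[OF jk] c]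
    unfolding odd_supp_plus_root[OF jk] A'_def[symmetric] fl t_def .
  moreover have "twisted_mult n (root_sum j k) (vvect n c) = cscale (?p A) (vvect n (\<lambda>k. c k * t k))"
    using twisted_mult_vvect[OF root_sum_in_root_lattice[of j k n] c] jk
    unfolding odd_supp_root_sum A_def[symmetric] t_def by simp
  ultimately show ?thesis
    by (simp only: cvec.scale_scale)
qed

section \<open>The Chevalley generators on \<open>v(c)\<close>\<close>

context vertex_rep
begin

lemma acts_scalar_cong: "acts y a (cscale c b) \<Longrightarrow> c = d \<Longrightarrow> acts y a (cscale d b)"
  by simp

text \<open>
  The two summands of \<open>Z\<^bsub>j,k\<^esub>\<close> act on \<open>v(c)\<close> by proportional operators, so one of \<open>Z\<^bsub>j,k\<^esub>\<close> and \<open>Z'\<^bsub>j,k\<^esub>\<close> kills \<open>v(c)\<close>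
  and the other acts by \<open>E\<close> for the root \<open>\<alpha>\<^sub>j + \<dots> + \<alpha>\<^sub>k\<close>. Which one is decided by \<open>c\<^bsub>n-1\<^esub> c\<^sub>n\<close>.
\<close>

lemma acts_Zvec:
  assumes jk: "1 \<le> j" "j \<le> k" "k \<le> n - 1" and c: "\<forall>k\<in>{1..n}. c k \<in> {1, -1}"
  shows "acts (Zvec n s j k) (vvect n c)
    (cscale ((1 - s * of_int (c (n - 1) * c n)) / 2) (twisted_mult n (root_sum j k) (vvect n c)))"
proof -
  let ?M = "twisted_mult n (root_sum j k) (vvect n c)" and ?\<kappa> = "complex_of_int (c (n - 1) * c n)"
  note v = vvect_in_lattice_algebra[of n c]
  note r = n_ge_4 jk
  have "acts (Zvec n s j k) (vvect n c) (cscale (1/2) ?M + cscale (if k = n - 1 then - s else s)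
      (cscale (1/2) (twisted_mult n (plus_root n j k) (vvect n c))))"
    unfolding Zvec_eq[OF r]
    by (intro acts_add acts_cscale acts_Yvec root_sum_in_roots[OF r] plus_root_in_roots[OF r] v)
  also have "cscale (1/2) ?M + cscale (if k = n - 1 then - s else s)
      (cscale (1/2) (twisted_mult n (plus_root n j k) (vvect n c))) = cscale ((1 - s * ?\<kappa>) / 2) ?M"
    unfolding twisted_mult_plus_root[OF r c] cvec.scale_scale cvec.scale_left_distrib[symmetric]
    by (simp add: field_simps)
  finally show ?thesis .
qed

lemma neigh_sign_not_S: "l \<notin> nu_set n \<Longrightarrow> neigh_sign n l k = 1"
  by (simp add: neigh_sign_def)

lemma odd_not_in_nu_set: "odd l \<Longrightarrow> l \<le> n - 1 \<Longrightarrow> l \<notin> nu_set n"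
  using n_ge_4 by (auto simp: nu_set_def)

lemma even_in_nu_set: "even q \<Longrightarrow> 2 \<le> q \<Longrightarrow> q + 1 \<le> n - 1 \<Longrightarrow> q \<in> nu_set n"
  using n_ge_4 by (auto simp: nu_set_def)

lemma acts_Zvec_odd:
  assumes k: "odd k" "k \<le> n - 1" and c: "\<forall>k\<in>{1..n}. c k \<in> {1, -1}"
  shows "acts (Zvec n s k k) (vvect n c)
    (cscale ((1 - s * of_int (c (n - 1) * c n)) / 2 * (- \<i> * of_int (c k))) (vvect n c))"
proof -
  have k1: "1 \<le> k" using k(1) by (cases k) auto
  have flip: "flip n {k} l = 1" for l
    using odd_not_in_nu_set[OF k] by (simp add: flip_def neigh_sign_not_S)
  have "twisted_mult n (root_sum k k) (vvect n c) = cscale (- \<i> * of_int (c k)) (vvect n c)"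
    using twisted_mult_vvect[OF root_sum_in_root_lattice[of k k n] c] k1 k(2)
    unfolding odd_supp_root_sum atLeastAtMost_singleton flip by simp
  then show ?thesis
    using acts_Zvec[OF k1 order_refl k(2) c, of s] by simp
qed

text \<open>
  Such an even \<open>q\<close> belongs to \<open>S\<close> and its neighbours \<open>q - 1\<close> and \<open>q + 1\<close> do not. The four intervals around \<open>q\<close> therefore
  flip the same signs, and their operators send \<open>v(c)\<close> to multiples of one vector \<open>w\<close>. This is why the
  terms of a generator \<open>e\<close> can cancel.
\<close>

lemma acts_Zvec_triple:
  assumes q: "even q" "2 \<le> q" "q + 1 \<le> n - 1" and c: "\<forall>k\<in>{1..n}. c k \<in> {1, -1}"
  defines "w \<equiv> vvect n (\<lambda>k. c k * neigh_sign n q k)"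
    and "h \<equiv> \<lambda>s. (1 - s * of_int (c (n - 1) * c n)) / 2"
  shows "acts (Zvec n s (q - 1) q) (vvect n c) (cscale (h s * of_int (c (q - 1) * c q)) w)"
    and "acts (Zvec n s q (q + 1)) (vvect n c) (cscale (h s * of_int (c q * c (q + 1))) w)"
    and "acts (Zvec n s (q - 1) (q + 1)) (vvect n c)
           (cscale (h s * (\<i> * of_int (c (q - 1) * c q * c (q + 1)))) w)"
    and "acts (Zvec n s q q) (vvect n c) (cscale (h s * (- \<i> * of_int (c q))) w)"
proof -
  have qS: "q \<in> nu_set n" by (rule even_in_nu_set) (use q in auto)
  have odd: "odd (q - 1)" "q - 1 \<le> n - 1" "odd (q + 1)" "q + 1 \<le> n - 1"
    using q by auto
  have nb: "neigh_sign n (q - 1) l = 1" "neigh_sign n (q + 1) l = 1" for l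
    using neigh_sign_not_S[OF odd_not_in_nu_set[OF odd(1,2)]]
      neigh_sign_not_S[OF odd_not_in_nu_set[OF odd(3,4)]] by simp_all
  define F where "F l = - \<i> * complex_of_int (c l * neigh_sign n q l)" for l
  have "neigh_sign n q (q - 1) = -1" "neigh_sign n q (q + 1) = -1" "neigh_sign n q q = 1"
    using qS q n_ge_4 by (auto simp: neigh_sign_def joined_def)
  then have F: "F (q - 1) = \<i> * of_int (c (q - 1))" "F (q + 1) = \<i> * of_int (c (q + 1))" "F q = - \<i> * of_int (c q)"
    by (simp_all only: F_def) simp_all
  have act: "acts (Zvec n s j k) (vvect n c) (cscale (h s * (\<Prod>l\<in>A. F l)) w)"
    if jk: "1 \<le> j" "j \<le> k" "k \<le> n - 1" and A: "{j..k} = A"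
      and flip: "\<And>l. flip n A l = neigh_sign n q l" for j k A
    using acts_Zvec[OF jk c, of s] twisted_mult_vvect[OF root_sum_in_root_lattice[of j k n] c] jk
    unfolding odd_supp_root_sum A flip by (simp add: w_def h_def F_def)
  have ne: "q - 1 \<noteq> q" "q - 1 \<noteq> q + 1" "q \<noteq> q + 1"
    using q by auto
  have sets: "{q-1..q} = {q-1, q}" "{q..q+1} = {q, q+1}" "{q-1..q+1} = {q-1, q, q+1}" "{q..q} = {q}"
    using q by auto
  have "acts (Zvec n s (q - 1) q) (vvect n c) (cscale (h s * (\<Prod>l\<in>{q-1, q}. F l)) w)"
    by (rule act[OF _ _ _ sets(1)]) (use q ne in \<open>auto simp: flip_def nb[simplified]\<close>)
  then show "acts (Zvec n s (q - 1) q) (vvect n c) (cscale (h s * of_int (c (q - 1) * c q)) w)"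
    by (rule acts_scalar_cong) (use ne F in \<open>simp add: algebra_simps\<close>)
  have "acts (Zvec n s q (q + 1)) (vvect n c) (cscale (h s * (\<Prod>l\<in>{q, q+1}. F l)) w)"
    by (rule act[OF _ _ _ sets(2)]) (use q ne in \<open>auto simp: flip_def nb[simplified]\<close>)
  then show "acts (Zvec n s q (q + 1)) (vvect n c) (cscale (h s * of_int (c q * c (q + 1))) w)"
    by (rule acts_scalar_cong) (use ne F in \<open>simp add: algebra_simps\<close>)
  have "acts (Zvec n s (q - 1) (q + 1)) (vvect n c) (cscale (h s * (\<Prod>l\<in>{q-1, q, q+1}. F l)) w)"
    by (rule act[OF _ _ _ sets(3)]) (use q ne in \<open>auto simp: flip_def nb[simplified]\<close>)
  then show "acts (Zvec n s (q - 1) (q + 1)) (vvect n c)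
           (cscale (h s * (\<i> * of_int (c (q - 1) * c q * c (q + 1)))) w)"
    by (rule acts_scalar_cong) (use ne F in \<open>simp add: algebra_simps\<close>)
  have "acts (Zvec n s q q) (vvect n c) (cscale (h s * (\<Prod>l\<in>{q}. F l)) w)"
    by (rule act[OF _ _ _ sets(4)]) (use q ne in \<open>auto simp: flip_def nb[simplified]\<close>)
  then show "acts (Zvec n s q q) (vvect n c) (cscale (h s * (- \<i> * of_int (c q))) w)"
    by (rule acts_scalar_cong) (use ne F in \<open>simp add: algebra_simps\<close>)
qed

end

text \<open>
  Up to the factor \<open>(1 - s c\<^bsub>n-1\<^esub> c\<^sub>n) / 4\<close>, the coefficient of the image of \<open>v(c)\<close> under the \<open>j\<close>-th
  generator \<open>e\<close>. The scalars of \<open>acts_Zvec_triple\<close> combine to a product.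
\<close>

definition e_value :: "nat \<Rightarrow> (nat \<Rightarrow> int) \<Rightarrow> nat \<Rightarrow> int" where
  "e_value n c j = (let m = n div 2 in
     if j < m then c (2*j) * ((c (2*j-1) - 1) * (c (2*j+1) + 1))
     else if even n then - c (2*m-2) * ((c (2*m-3) - 1) * (c (2*m-1) - 1))
     else c (2*m-2) * (c (2*m-1) - 1))"

text \<open>
  Up to the factor \<open>(1 - s c\<^bsub>n-1\<^esub> c\<^sub>n) / 2\<close>, the eigenvalue of the \<open>j\<close>-th generator \<open>h\<close> on \<open>v(c)\<close>.
\<close>

definition h_value :: "nat \<Rightarrow> (nat \<Rightarrow> int) \<Rightarrow> nat \<Rightarrow> complex" where
  "h_value n c j = (let m = n div 2 in
     if j < m then (of_int (c (2*j-1)) - of_int (c (2*j+1))) / 2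
     else if even n then (of_int (c (2*m-3)) + of_int (c (2*m-1))) / 2
     else of_int (c (2*m-1)))"

context vertex_rep
begin

lemma acts_e_fin:
  assumes j: "j \<in> {1..n div 2}" and c: "\<forall>k\<in>{1..n}. c k \<in> {1, -1}"
  defines "q \<equiv> (if j < n div 2 then 2 * j else 2 * (n div 2) - 2)"
  shows "acts (e_fin n s j) (vvect n c)
    (cscale ((1 - s * of_int (c (n - 1) * c n)) / 4 * of_int (e_value n c j))
      (vvect n (\<lambda>k. c k * neigh_sign n q k)))"
proof -
  define m where "m = n div 2"
  have m: "2 \<le> m" using n_ge_4 by (simp add: m_def)
  have q: "even q" "2 \<le> q" "q + 1 \<le> n - 1"
    using j m unfolding q_def by (auto simp: m_def)
  note Z = acts_Zvec_triple[OF q c, of s]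
  note v = vvect_in_lattice_algebra[of n c]
  let ?h = "(1 - s * of_int (c (n - 1) * c n)) / 2"
  let ?w = "vvect n (\<lambda>k. c k * neigh_sign n q k)"
  note comb = cvec.scale_scale cvec.scale_left_distrib[symmetric] cvec.scale_left_diff_distrib[symmetric]
  consider "j < m" | "\<not> j < m" "even n" | "\<not> j < m" "odd n" by blast
  then show ?thesis
  proof cases
    case 1
    then have q': "q = 2 * j" by (simp add: q_def m_def)
    have e: "e_fin n s j = cscale (1/2) (Zvec n s (q-1) q - Zvec n s q (q+1)
        - cscale \<i> (Zvec n s (q-1) (q+1)) - cscale \<i> (Zvec n s q q))"
      using 1 by (simp add: e_fin_def Let_def q' m_def)
    have val: "e_value n c j = c q * ((c (q-1) - 1) * (c (q+1) + 1))"
      using 1 by (simp add: e_value_def Let_def q' m_def)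
    have "acts (e_fin n s j) (vvect n c) (cscale (1/2) (
        cscale (?h * of_int (c (q - 1) * c q)) ?w - cscale (?h * of_int (c q * c (q + 1))) ?w
        - cscale \<i> (cscale (?h * (\<i> * of_int (c (q - 1) * c q * c (q + 1)))) ?w)
        - cscale \<i> (cscale (?h * (- \<i> * of_int (c q))) ?w)))"
      unfolding e by (intro acts_cscale acts_diff Z v)
    from this[unfolded comb] show ?thesis
      by (rule acts_scalar_cong) (simp add: val field_simps)
  next
    case 2
    then have q': "q = 2 * m - 2" "q - 1 = 2 * m - 3" "q + 1 = 2 * m - 1"
      using m by (auto simp: q_def m_def)
    have e: "e_fin n s j = cscale (1/2) (Zvec n s (q-1) q + Zvec n s q (q+1)
        + cscale \<i> (Zvec n s (q-1) (q+1)) - cscale \<i> (Zvec n s q q))"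
      using 2 unfolding q'(2,3) by (simp add: e_fin_def Let_def q'(1) flip: m_def)
    have val: "e_value n c j = - c q * ((c (q-1) - 1) * (c (q+1) - 1))"
      using 2 unfolding q'(2,3) by (simp add: e_value_def Let_def q'(1) flip: m_def)
    have "acts (e_fin n s j) (vvect n c) (cscale (1/2) (
        cscale (?h * of_int (c (q - 1) * c q)) ?w + cscale (?h * of_int (c q * c (q + 1))) ?w
        + cscale \<i> (cscale (?h * (\<i> * of_int (c (q - 1) * c q * c (q + 1)))) ?w)
        - cscale \<i> (cscale (?h * (- \<i> * of_int (c q))) ?w)))"
      unfolding e by (intro acts_cscale acts_diff acts_add Z v)
    from this[unfolded comb] show ?thesis
      by (rule acts_scalar_cong) (simp add: val field_simps)
  next
    case 3
    then have q': "q = 2 * m - 2" "q + 1 = 2 * m - 1"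
      using m by (auto simp: q_def m_def)
    have e: "e_fin n s j = cscale (1/2) (Zvec n s q (q+1) - cscale \<i> (Zvec n s q q))"
      using 3 unfolding q'(2) by (simp add: e_fin_def Let_def q'(1) flip: m_def)
    have val: "e_value n c j = c q * (c (q+1) - 1)"
      using 3 unfolding q'(2) by (simp add: e_value_def Let_def q'(1) flip: m_def)
    have "acts (e_fin n s j) (vvect n c) (cscale (1/2) (
        cscale (?h * of_int (c q * c (q + 1))) ?w - cscale \<i> (cscale (?h * (- \<i> * of_int (c q))) ?w)))"
      unfolding e by (intro acts_cscale acts_diff Z v)
    from this[unfolded comb] show ?thesis
      by (rule acts_scalar_cong) (simp add: val field_simps)
  qed
qed

lemma acts_h_fin:
  assumes j: "j \<in> {1..n div 2}" and c: "\<forall>k\<in>{1..n}. c k \<in> {1, -1}"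
  shows "acts (h_fin n s j) (vvect n c)
    (cscale ((1 - s * of_int (c (n - 1) * c n)) / 2 * h_value n c j) (vvect n c))"
proof -
  define m where "m = n div 2"
  have m: "2 \<le> m" using n_ge_4 by (simp add: m_def)
  let ?h = "(1 - s * of_int (c (n - 1) * c n)) / 2"
  note v = vvect_in_lattice_algebra[of n c]
  note comb = cvec.scale_scale cvec.scale_left_distrib[symmetric] cvec.scale_left_diff_distrib[symmetric]
  have Z: "acts (Zvec n s k k) (vvect n c) (cscale (?h * (- \<i> * of_int (c k))) (vvect n c))"
    if "odd k" "k \<le> n - 1" for k
    by (rule acts_Zvec_odd[OF that c])
  have odd: "odd (2*m-3)" "odd (2*m-1)" "2*m-3 \<le> n-1" "2*m-1 \<le> n-1"
    using m by (auto simp: m_def)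
  consider "j < m" | "\<not> j < m" "even n" | "\<not> j < m" "odd n" by blast
  then show ?thesis
  proof cases
    case 1
    have o: "odd (2*j-1)" "odd (2*j+1)" "2*j-1 \<le> n-1" "2*j+1 \<le> n-1"
      using j 1 by (auto simp: m_def)
    have "acts (h_fin n s j) (vvect n c) (cscale (\<i>/2)
       (cscale (?h * (- \<i> * of_int (c (2*j-1)))) (vvect n c) - cscale (?h * (- \<i> * of_int (c (2*j+1)))) (vvect n c)))"
      unfolding h_fin_def Let_def m_def[symmetric] if_P[OF 1]
      by (intro acts_cscale acts_diff Z v o)
    from this[unfolded comb] show ?thesis
      by (rule acts_scalar_cong) (use 1 in \<open>simp add: h_value_def Let_def field_simps flip: m_def\<close>)
  next
    case 2
    have "acts (h_fin n s j) (vvect n c) (cscale (\<i>/2)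
       (cscale (?h * (- \<i> * of_int (c (2*m-3)))) (vvect n c) + cscale (?h * (- \<i> * of_int (c (2*m-1)))) (vvect n c)))"
      unfolding h_fin_def Let_def m_def[symmetric] if_not_P[OF 2(1)] if_P[OF 2(2)]
      by (intro acts_cscale acts_add Z v odd)
    from this[unfolded comb] show ?thesis
      by (rule acts_scalar_cong) (use 2 in \<open>simp add: h_value_def Let_def field_simps flip: m_def\<close>)
  next
    case 3
    have "acts (h_fin n s j) (vvect n c) (cscale \<i>
       (cscale (?h * (- \<i> * of_int (c (2*m-1)))) (vvect n c)))"
      unfolding h_fin_def Let_def m_def[symmetric] if_not_P[OF 3(1)] if_not_P[OF 3(2)]
      by (intro acts_cscale Z v odd)
    from this[unfolded comb] show ?thesis
      by (rule acts_scalar_cong) (use 3 in \<open>simp add: h_value_def Let_def field_simps flip: m_def\<close>)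
  qed
qed

end

section \<open>Singular vectors and weights\<close>

lemma tensor_one_inject: "tensor a 1 = tensor b 1 \<longleftrightarrow> a = b"
proof
  assume h: "tensor a 1 = tensor b 1"
  have "coeff a g = coeff b g" for g
    using arg_cong[OF h, of "\<lambda>u. coeff (coeff u g) 0"] by simp
  then show "a = b" by (rule poly_mapping_eqI)
qed simp

lemma h_space_subspace: "cvec.subspace (h_space n)"
  unfolding cvec.subspace_def h_space_def
proof (intro conjI ballI allI)
  show "x + y \<in> {x. supp x \<subseteq> HB ` {1..n}}"
    if "x \<in> {x. supp x \<subseteq> HB ` {1..n}}" "y \<in> {x. supp x \<subseteq> HB ` {1..n}}" for x y :: galg
    using that Poly_Mapping.keys_add[of x y] by blast
  show "cscale c x \<in> {x. supp x \<subseteq> HB ` {1..n}}"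
    if "x \<in> {x. supp x \<subseteq> HB ` {1..n}}" for c x
    using that supp_cscale[of c x] by blast
qed simp

lemma Hvec_in_h_space: "Hvec n \<alpha> \<in> h_space n"
  unfolding Hvec_def by (rule cvec.subspace_sum[OF h_space_subspace]) (auto simp: h_space_def)
lemma ball_nodes:
  "(\<forall>a\<in>nodes n. P a) \<longleftrightarrow> P (Plain 0) \<and> (\<forall>j\<in>{1..n div 2}. P (Plain j) \<and> P (Primed j))"
proof -
  have "{0..n div 2} = insert 0 {1..n div 2}" by auto
  then show ?thesis by (auto simp: nodes_def)
qed

context vertex_rep
begin

lemma twisted_mult_simple_root:
  assumes k: "k \<in> {1..n}" and c: "\<forall>k\<in>{1..n}. c k \<in> {1, -1}"
  shows "twisted_mult n (simple_root k) (vvect n c) =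
    cscale (- \<i> * of_int (c k)) (vvect n (\<lambda>l. c l * neigh_sign n k l))"
proof -
  have "neigh_sign n k k = 1"
    using n_ge_4 by (auto simp: neigh_sign_def joined_def)
  moreover have "flip n {k} = neigh_sign n k"
    by (simp add: flip_def fun_eq_iff)
  ultimately show ?thesis
    using twisted_mult_vvect[OF simple_root_in_root_lattice[OF k] c] unfolding odd_supp_simple_root by simp
qed

lemma twisted_mult_simple_root_diagonal:
  assumes k: "k \<in> {1..n}" "k \<notin> nu_set n" and c: "\<forall>k\<in>{1..n}. c k \<in> {1, -1}"
  shows "twisted_mult n (simple_root k) (vvect n c) = cscale (- \<i> * of_int (c k)) (vvect n c)"
  using twisted_mult_simple_root[OF k(1) c] by (simp add: neigh_sign_not_S[OF k(2)])

lemma act_e_zero: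
  assumes a: "a \<in> lattice_algebra n"
  shows "\<rho> (e_zero n) (tensor a 1) = 0"
proof -
  have r: "simple_root 1 \<in> roots n" using n_ge_4 by (intro simple_root_in_roots) auto
  note g = root_mode_in_ghat[OF r, of 1] cartan_mode_in_ghat[OF Hvec_in_h_space, of 1 n "simple_root 1", simplified]
  note s = cvec.subspace_scale[OF ghat_subspace] cvec.subspace_add[OF ghat_subspace]
  note v = tensor_in_V_space[OF a one_in_poly_space]
  have "e_zero n = cscale (1/2) (cscale \<i> (root_mode (simple_root 1) 1) + loop (Hvec n (simple_root 1)) 1)"
    by (simp add: e_zero_def root_mode_def loop_cscale loop_add loop_diff loop_uminus)
  moreover have "\<rho> (root_mode (simple_root 1) 1) (tensor a 1) = 0"
    using r a by (simp add: act_root_mode E_coeff_vacuum)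
  moreover have "\<rho> (loop (Hvec n (simple_root 1)) 1) (tensor a 1) = 0"
    using a by (simp add: act_cartan_mode[OF Hvec_in_h_space] a_coeff_vacuum)
  ultimately show ?thesis
    using g s v by (simp add: act_cscale act_add_left)
qed

text \<open>
  The node \<open>1\<close> does not belong to \<open>S\<close>, so \<open>Y\<^bsub>\<alpha>\<^sub>1\<^esub>\<close> acts on \<open>v(c)\<close> by the scalar \<open>- i c\<^sub>1 / 2\<close>.
\<close>

lemma act_h_zero:
  assumes c: "\<forall>k\<in>{1..n}. c k \<in> {1, -1}"
  shows "\<rho> h_zero (tensor (vvect n c) 1) = vscale ((1 - of_int (c 1)) / 2) (tensor (vvect n c) 1)"
proof -
  note s = cvec.subspace_scale[OF ghat_subspace]
  note va = vvect_in_lattice_algebra[of n c]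
  note v = tensor_in_V_space[OF va one_in_poly_space]
  have k: "1 \<in> {1..n}" "1 \<notin> nu_set n" using odd_not_in_nu_set[of 1] n_ge_4 by auto
  have r: "simple_root 1 \<in> roots n" using n_ge_4 by (intro simple_root_in_roots) auto
  have Y: "loop (Yvec (simple_root 1)) 0 \<in> ghat n"
     "\<rho> (loop (Yvec (simple_root 1)) 0) (tensor (vvect n c) 1)
      = vscale (1/2 * (- \<i> * of_int (c 1))) (tensor (vvect n c) 1)"
    using acts_Yvec[OF r va] unfolding acts_def twisted_mult_simple_root_diagonal[OF k c]
    by (simp_all only: cvec.scale_scale tensor_cscale_left)
  have "\<rho> h_zero (tensor (vvect n c) 1)
     = vscale (- \<i>) (vscale (1/2 * (- \<i> * of_int (c 1))) (tensor (vvect n c) 1))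
       + vscale (1/2) (tensor (vvect n c) 1)"
    unfolding h_zero_def using Y K_in_ghat s v
    by (simp only: act_add_left act_cscale act_K)
  also have "\<dots> = vscale ((1 - of_int (c 1)) / 2) (tensor (vvect n c) 1)"
    unfolding vvec.scale_scale vvec.scale_left_distrib[symmetric]
    by (rule arg_cong[where f = "\<lambda>x. vscale x _"]) (simp add: field_simps)
  finally show ?thesis .
qed

fun node_weight :: "(nat \<Rightarrow> int) \<Rightarrow> node \<Rightarrow> complex" where
  "node_weight c (Plain j) = (if j = 0 then (1 - of_int (c 1)) / 2
     else (1 - of_int (c (n - 1) * c n)) / 2 * h_value n c j)"
| "node_weight c (Primed j) = (1 + of_int (c (n - 1) * c n)) / 2 * h_value n c j"

lemma has_weight_vvect:
  assumes c: "\<forall>k\<in>{1..n}. c k \<in> {1, -1}" and \<mu>: "\<And>a. a \<in> nodes n \<Longrightarrow> \<mu> a = node_weight c a"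
  shows "has_weight n \<rho> (tensor (vvect n c) 1) \<mu>"
  unfolding has_weight_def
proof
  fix a assume a: "a \<in> nodes n"
  have "\<rho> (h_gen n a) (tensor (vvect n c) 1) = vscale (node_weight c a) (tensor (vvect n c) 1)"
  proof (cases a)
    case (Plain j)
    then show ?thesis
      using a act_h_zero[OF c] acts_h_fin[of j c 1] c
      by (auto simp: nodes_def acts_def tensor_cscale_left)
  next
    case (Primed j)
    then show ?thesis
      using a acts_h_fin[of j c "-1"] c
      by (auto simp: nodes_def acts_def tensor_cscale_left)
  qed
  then show "\<rho> (h_gen n a) (tensor (vvect n c) 1) = vscale (\<mu> a) (tensor (vvect n c) 1)"
    using \<mu>[OF a] by simp
qed

lemma weight_vector_vvect:
  assumes c: "\<forall>k\<in>{1..n}. c k \<in> {1, -1}"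
  shows "weight_vector n \<rho> (tensor (vvect n c) 1)"
proof -
  have "\<rho> d_elt (tensor (vvect n c) 1) = vscale 0 (tensor (vvect n c) 1)"
    by (simp add: act_d vvect_in_lattice_algebra)
  moreover have "tensor (vvect n c) 1 \<noteq> 0"
    using vvect_nonzero[OF c] tensor_one_inject[of "vvect n c" 0] by simp
  ultimately show ?thesis
    unfolding weight_vector_def
    using has_weight_vvect[OF c] tensor_in_V_space[OF vvect_in_lattice_algebra] by auto
qed

lemma flipped_signs:
  assumes "\<forall>k\<in>{1..n}. c k \<in> {1, -1}"
  shows "\<forall>l\<in>{1..n}. c l * neigh_sign n k l \<in> {1, -1}"
  using assms by (auto simp: neigh_sign_def)

text \<open>
  One of the two families of generators acts by zero and the other has the full factor, so that exactly the
  scalars \<open>e_value\<close> have to vanish; \<open>e\<^sub>0\<close> kills every \<open>a \<otimes> 1\<close> because it has positive degree.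
\<close>

lemma singular_vvect_iff:
  assumes c: "\<forall>k\<in>{1..n}. c k \<in> {1, -1}"
  shows "singular_vector n \<rho> (tensor (vvect n c) 1) \<longleftrightarrow> (\<forall>j\<in>{1..n div 2}. e_value n c j = 0)"
proof -
  define \<kappa> where "\<kappa> = c (n - 1) * c n"
  have \<kappa>: "\<kappa> = 1 \<or> \<kappa> = -1"
  proof -
    have "n - 1 \<in> {1..n}" "n \<in> {1..n}" using n_ge_4 by auto
    then have "c (n - 1) \<in> {1, -1}" "c n \<in> {1, -1}" using c by blast+
    then show ?thesis unfolding \<kappa>_def by auto
  qed
  have e: "\<rho> (loop (e_fin n s j) 0) (tensor (vvect n c) 1) = 0 \<longleftrightarrow> s * of_int \<kappa> = 1 \<or> e_value n c j = 0"
    if j: "j \<in> {1..n div 2}" for s j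
  proof -
    obtain q where "acts (e_fin n s j) (vvect n c) (cscale ((1 - s * of_int \<kappa>) / 4 * of_int (e_value n c j))
      (vvect n (\<lambda>k. c k * neigh_sign n q k)))"
      using acts_e_fin[OF j c, of s] unfolding \<kappa>_def by blast
    then have "\<rho> (loop (e_fin n s j) 0) (tensor (vvect n c) 1) = 0 \<longleftrightarrow>
       cscale ((1 - s * of_int \<kappa>) / 4 * of_int (e_value n c j)) (vvect n (\<lambda>k. c k * neigh_sign n q k)) = 0"
      unfolding acts_def using tensor_one_inject[of _ 0] by simp
    then show ?thesis
      using vvect_nonzero[OF flipped_signs[OF c, of q]] by simp
  qed
  have "(\<forall>a\<in>nodes n. \<rho> (e_gen n a) (tensor (vvect n c) 1) = 0)
    \<longleftrightarrow> (\<forall>j\<in>{1..n div 2}. \<rho> (loop (e_fin n 1 j) 0) (tensor (vvect n c) 1) = 0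
          \<and> \<rho> (loop (e_fin n (-1) j) 0) (tensor (vvect n c) 1) = 0)"
    unfolding ball_nodes using act_e_zero[OF vvect_in_lattice_algebra[of n c]] by simp
  also have "\<dots> \<longleftrightarrow> (\<forall>j\<in>{1..n div 2}. e_value n c j = 0)"
    using \<kappa> by (auto simp: e)
  finally show ?thesis
    using weight_vector_vvect[OF c] by (simp add: singular_vector_def)
qed

section \<open>Submodules of the form \<open>A \<otimes> \<complex>[x]\<close>\<close>

lemma tensor_poly_subset_V:
  assumes "A \<subseteq> lattice_algebra n"
  shows "tensor_poly n A \<subseteq> V_space n"
  unfolding tensor_poly_def
  by (rule vvec.span_minimal) (use assms tensor_in_V_space V_space_subspace in auto)

text \<open>
  The polynomial operators preserve polynomials, so stability is a condition on the first factor alone.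
\<close>

lemma tensor_poly_module:
  assumes A: "A \<subseteq> lattice_algebra n"
    and closed: "\<And>\<alpha> a. \<alpha> \<in> roots n \<Longrightarrow> a \<in> A \<Longrightarrow> twisted_mult n \<alpha> a \<in> A"
  shows "ghat_module n \<rho> (tensor_poly n A)"
proof -
  let ?W = "tensor_poly n A"
  have W: "vvec.subspace ?W" by (simp add: tensor_poly_def)
  note WV = tensor_poly_subset_V[OF A]
  have gen: "tensor a f \<in> ?W" if "a \<in> A" "f \<in> poly_space n" for a f
    using that unfolding tensor_poly_def by (blast intro: vvec.span_base)
  have ext: "\<rho> x w \<in> ?W" if x: "x \<in> ghat n" and w: "w \<in> ?W"
    and base: "\<And>a f. a \<in> A \<Longrightarrow> f \<in> poly_space n \<Longrightarrow> \<rho> x (tensor a f) \<in> ?W" for x w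
  proof -
    have "w \<in> V_space n \<and> \<rho> x w \<in> ?W"
      using w unfolding tensor_poly_def
    proof (induction rule: vvec.span_induct_alt)
      case base
      show ?case
        using V_space_subspace W by (simp add: act_zero[OF x] vvec.subspace_0 tensor_poly_def)
    next
      case (step c v u)
      then obtain a f where af: "a \<in> A" "f \<in> poly_space n" "v = tensor a f" by blast
      have v: "v \<in> V_space n" using af A tensor_in_V_space by blast
      have "vscale c v \<in> V_space n" by (rule vvec.subspace_scale[OF V_space_subspace v])
      then show ?case
        using step.IH v that(3)[OF af(1,2)] af(3)
          vvec.subspace_add[OF V_space_subspace] vvec.subspace_add[OF W] vvec.subspace_scale[OF W]
        by (simp add: act_add[OF x] act_vscale[OF x] tensor_poly_def)
    qed
    then show ?thesis ..
  qed
  let ?P = "{x \<in> ghat n. \<forall>w\<in>?W. \<rho> x w \<in> ?W}"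
  have mem: "x \<in> ?P"
    if "x \<in> ghat n" "\<And>a f. a \<in> A \<Longrightarrow> f \<in> poly_space n \<Longrightarrow> \<rho> x (tensor a f) \<in> ?W" for x
    using ext[OF that(1) _ that(2)] that(1) by simp
  have "ghat n \<subseteq> ?P"
  proof (rule ghat_subset_subspace)
    show "cvec.subspace ?P"
      unfolding cvec.subspace_def
    proof (intro conjI ballI allI)
      have "\<rho> 0 w = 0" if "w \<in> V_space n" for w
        using act_cscale[OF K_in_ghat that, of 0] by simp
      then show "0 \<in> ?P"
        using WV vvec.subspace_0[OF W] cvec.subspace_0[OF ghat_subspace] by auto
    next
      fix x y assume "x \<in> ?P" "y \<in> ?P"
      then show "x + y \<in> ?P"
        using WV vvec.subspace_add[OF W] cvec.subspace_add[OF ghat_subspace]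
        by (auto simp: act_add_left subset_iff)
    next
      fix c x assume "x \<in> ?P"
      then show "cscale c x \<in> ?P"
        using WV vvec.subspace_scale[OF W] cvec.subspace_scale[OF ghat_subspace]
        by (auto simp: act_cscale subset_iff)
    qed
    show "K_elt \<in> ?P" using K_in_ghat act_K WV by auto
    show "d_elt \<in> ?P"
    proof (rule mem[OF d_in_ghat])
      fix a f assume "a \<in> A" "f \<in> poly_space n"
      then show "\<rho> d_elt (tensor a f) \<in> ?W"
        using A by (subst act_d) (auto intro: gen d_poly_in_poly_space)
    qed
    show "root_mode \<alpha> p \<in> ?P" if \<alpha>: "\<alpha> \<in> roots n" for \<alpha> p
    proof (rule mem[OF root_mode_in_ghat[OF \<alpha>]])
      fix a f assume "a \<in> A" "f \<in> poly_space n"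
      then show "\<rho> (root_mode \<alpha> p) (tensor a f) \<in> ?W"
        using A \<alpha> by (subst act_root_mode)
          (auto intro: vvec.subspace_scale[OF W] gen closed E_coeff_in_poly_space)
    qed
    show "loop H p \<in> ?P" if H: "H \<in> h_space n" "odd p" for H p
    proof (rule mem[OF cartan_mode_in_ghat[OF H]])
      fix a f assume af: "a \<in> A" "f \<in> poly_space n"
      then have "cscale (1 / complex_of_real (sqrt 2))
          (\<Sum>j=1..n. cscale (gform n H (S j)) (a_coeff j p f)) \<in> poly_space n"
        using H(2)
        by (intro cvec.subspace_scale[OF poly_space_subspace] cvec.subspace_sum[OF poly_space_subspace]
            a_coeff_in_poly_space)
      then show "\<rho> (loop H p) (tensor a f) \<in> ?W"
        using A af H by (subst act_cartan_mode) (auto intro: gen)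
    qed
  qed
  then have "\<rho> x w \<in> ?W" if "x \<in> ghat n" "w \<in> ?W" for x w
    using that by blast
  then show ?thesis
    using V_module W unfolding ghat_module_def by (simp add: subsetD[OF WV])
qed

end

section \<open>Monomials and constant terms\<close>

definition mono_degree :: "(nat \<times> nat \<Rightarrow>\<^sub>0 nat) \<Rightarrow> nat" where
  "mono_degree \<mu> = (\<Sum>p\<in>supp \<mu>. coeff \<mu> p)"

lemma mono_degree_add_delta: "mono_degree (\<mu> + delta p 1) = mono_degree \<mu> + 1"
proof -
  let ?B = "insert p (supp \<mu>)"
  have "mono_degree (\<mu> + delta p 1) = (\<Sum>q\<in>?B. coeff (\<mu> + delta p 1) q)"
    unfolding mono_degree_def
    by (rule sum.mono_neutral_left) (auto simp: in_keys_iff lookup_add lookup_single when_def split: if_splits)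
  also have "\<dots> = (\<Sum>q\<in>?B. coeff \<mu> q + (if q = p then 1 else 0))"
    by (intro sum.cong) (auto simp: lookup_add lookup_single)
  also have "\<dots> = (\<Sum>q\<in>?B. coeff \<mu> q) + 1"
    unfolding sum.distrib by (simp add: sum.delta)
  also have "(\<Sum>q\<in>?B. coeff \<mu> q) = mono_degree \<mu>"
    unfolding mono_degree_def by (rule sum.mono_neutral_right) (auto simp: in_keys_iff)
  finally show ?thesis .
qed

lemma monomial_split:
  fixes \<mu> :: "nat \<times> nat \<Rightarrow>\<^sub>0 nat"
  assumes "p \<in> supp \<mu>"
  shows "\<mu> = (\<mu> - delta p 1) + delta p 1"
  using assms
  by (intro poly_mapping_eqI) (auto simp: lookup_add lookup_minus lookup_single when_def in_keys_iff)

lemma monomial_induct [consumes 1, case_names one var]: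
  fixes \<mu> :: "nat \<times> nat \<Rightarrow>\<^sub>0 nat"
  assumes "supp \<mu> \<subseteq> K" and "P 0"
    and "\<And>\<nu> p. supp \<nu> \<subseteq> K \<Longrightarrow> p \<in> K \<Longrightarrow> P \<nu> \<Longrightarrow> P (\<nu> + delta p 1)"
  shows "P \<mu>"
  using assms(1)
proof (induction "mono_degree \<mu>" arbitrary: \<mu>)
  case 0
  then have "\<forall>p\<in>supp \<mu>. coeff \<mu> p = 0"
    by (simp add: mono_degree_def)
  then have "coeff \<mu> p = 0" for p
    by (metis in_keys_iff)
  then have "\<mu> = 0" by (intro poly_mapping_eqI) simp
  then show ?case using assms(2) by simp
next
  case (Suc d)
  then have "supp \<mu> \<noteq> {}" by (auto simp: mono_degree_def)
  then obtain p where p: "p \<in> supp \<mu>" by blast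
  let ?\<nu> = "\<mu> - delta p 1"
  have *: "\<mu> = ?\<nu> + delta p 1" by (rule monomial_split[OF p])
  have "d = mono_degree ?\<nu>" using Suc.hyps(2) mono_degree_add_delta[of ?\<nu> p] *[symmetric] by simp
  moreover have "supp ?\<nu> \<subseteq> K"
    using Suc.prems by (auto simp: in_keys_iff lookup_minus)
  ultimately show ?case
    using Suc.hyps(1)[of ?\<nu>] assms(3)[of ?\<nu> p] p Suc.prems * by auto
qed

definition const_part :: "vspace \<Rightarrow> galgebra" where
  "const_part u = Poly_Mapping.map (\<lambda>f. coeff f 0) u"

lemma lookup_const_part: "coeff (const_part u) g = coeff (coeff u g) 0"
  unfolding const_part_def by (simp add: Poly_Mapping.map.rep_eq when_def)

lemma const_part_tensor_poly:
  assumes A: "cvec.subspace A" and u: "u \<in> tensor_poly n A"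
  shows "const_part u \<in> A"
  using u unfolding tensor_poly_def
proof (induction rule: vvec.span_induct_alt)
  case base
  have "const_part 0 = 0" by (rule poly_mapping_eqI) (simp add: lookup_const_part)
  then show ?case using A by (simp add: cvec.subspace_0)
next
  case (step c x y)
  then obtain a f where af: "a \<in> A" "x = tensor a f" by blast
  have "const_part (vscale c x + y) = cscale (c * coeff f 0) a + const_part y"
    by (rule poly_mapping_eqI) (simp add: lookup_const_part lookup_add af)
  then show ?case
    using step af A by (simp add: cvec.subspace_add cvec.subspace_scale)
qed

lemma tensor_poly_components:
  assumes "u \<in> tensor_poly n A"
  shows "coeff u g \<in> poly_space n"
  using assms unfolding tensor_poly_def
proof (induction rule: vvec.span_induct_alt)
  case base
  then show ?case using poly_space_subspace by (simp add: cvec.subspace_0)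
next
  case (step c x y)
  then show ?case
    by (auto simp: lookup_add intro!: cvec.subspace_add[OF poly_space_subspace]
        cvec.subspace_scale[OF poly_space_subspace])
qed

context vertex_rep
begin

section \<open>Raising and lowering with the oscillators\<close>

text \<open>
  Multiplication by a variable is, up to a nonzero scalar, the action of a negative mode.
\<close>

lemma raise_to_polynomials:
  assumes U: "ghat_module n \<rho> U" and a: "a \<in> lattice_algebra n" and vac: "tensor a 1 \<in> U"
    and f: "f \<in> poly_space n"
  shows "tensor a f \<in> U"
proof -
  have sub: "vvec.subspace U" and closed: "\<And>x v. x \<in> ghat n \<Longrightarrow> v \<in> U \<Longrightarrow> \<rho> x v \<in> U"
    using U by (auto simp: ghat_module_def)
  have mono: "tensor a (delta \<mu> 1) \<in> U" if "supp \<mu> \<subseteq> {1..n} \<times> {r. odd r}" for \<mu>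
    using that
  proof (induction rule: monomial_induct)
    case one
    then show ?case using vac by simp
  next
    case (var \<nu> p)
    obtain j r where p: "p = (j, r)" "j \<in> {1..n}" "odd r" using var(2) by auto
    then have r: "odd (- int r)" "0 < r" by (auto intro: odd_pos)
    have \<nu>: "delta \<nu> 1 \<in> poly_space n" using var(1) by (auto simp: poly_space_def)
    have "\<rho> (loop (S j) (- int r)) (tensor a (delta \<nu> 1)) \<in> U"
      by (intro closed cartan_mode_in_ghat S_in_h_space p r var)
    moreover have "\<rho> (loop (S j) (- int r)) (tensor a (delta \<nu> 1))
        = vscale (of_nat r / complex_of_real (sqrt 2)) (tensor a (delta (\<nu> + delta p 1) 1))"
    proof -
      have "a_coeff j (- int r) (delta \<nu> 1) = cscale (of_nat r) (delta (\<nu> + delta p 1) 1)"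
        using r(2) p(1) by (simp add: a_coeff_def var_def mult_single add.commute)
      then show ?thesis
        unfolding act_oscillator[OF p(2) r(1) a \<nu>] by (simp only: tensor_cscale_right vvec.scale_scale) simp
    qed
    ultimately have "vscale (of_nat r / complex_of_real (sqrt 2)) (tensor a (delta (\<nu> + delta p 1) 1)) \<in> U"
      by (simp only:)
    from vvec.subspace_scale[OF sub this, of "complex_of_real (sqrt 2) / of_nat r"]
    have "vscale (complex_of_real (sqrt 2) / of_nat r)
        (vscale (of_nat r / complex_of_real (sqrt 2)) (tensor a (delta (\<nu> + delta p 1) 1))) \<in> U" .
    moreover have "vscale (complex_of_real (sqrt 2) / of_nat r)
        (vscale (of_nat r / complex_of_real (sqrt 2)) v) = v" for v
      using r(2) unfolding vvec.scale_scale by simp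
    ultimately show ?case by (simp only:)
  qed
  have "tensor a (\<Sum>\<mu>\<in>M. delta \<mu> (coeff f \<mu>)) \<in> U" if "finite M" "M \<subseteq> supp f" for M
    using that
  proof (induction M)
    case empty
    then show ?case using vvec.subspace_0[OF sub] by simp
  next
    case (insert \<mu> M)
    have "supp \<mu> \<subseteq> {1..n} \<times> {r. odd r}"
      using f insert.prems by (auto simp: poly_space_def)
    then have "vscale (coeff f \<mu>) (tensor a (delta \<mu> 1)) \<in> U"
      by (intro vvec.subspace_scale[OF sub] mono)
    then have "tensor a (delta \<mu> (coeff f \<mu>)) \<in> U"
      by (simp flip: tensor_cscale_right)
    then show ?case
      using insert by (simp add: tensor_add_right vvec.subspace_add[OF sub])
  qed
  from this[of "supp f"] show ?thesis
    using finsupp_expansion[of f] by simp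
qed

lemma act_lowering:
  assumes j: "j \<in> {1..n}" "odd r" and u: "u \<in> V_space n"
  shows "coeff (\<rho> (loop (S j) (int r)) u) g = cscale (1 / complex_of_real (sqrt 2)) (pdiff (j, r) (coeff u g))"
proof -
  have r: "odd (int r)" "0 < r" using j by (auto intro: odd_pos)
  have x: "loop (S j) (int r) \<in> ghat n" by (intro cartan_mode_in_ghat S_in_h_space j r)
  have "u \<in> V_space n \<and>
    coeff (\<rho> (loop (S j) (int r)) u) g = cscale (1 / complex_of_real (sqrt 2)) (pdiff (j, r) (coeff u g))"
    using u unfolding V_space_def
  proof (induction rule: vvec.span_induct_alt)
    case base
    then show ?case
      by (simp add: vvec.span_zero act_zero[OF x]) (simp add: pdiff_def)
  next
    case (step c v w)
    then obtain \<gamma> f where v: "v = tensor (expo \<gamma>) f" "\<gamma> \<in> root_lattice n" "f \<in> poly_space n" by blast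
    have e: "expo \<gamma> \<in> lattice_algebra n"
      using v(2) by (auto simp: lattice_algebra_def intro: cvec.span_base)
    have vV: "v \<in> V_space n" using tensor_in_V_space[OF e v(3)] v(1) by simp
    have cV: "vscale c v \<in> V_space n" by (rule vvec.subspace_scale[OF V_space_subspace vV])
    have wV: "w \<in> V_space n" using step.IH by (simp add: V_space_def)
    have "coeff (\<rho> (loop (S j) (int r)) v) g = cscale (1 / complex_of_real (sqrt 2)) (pdiff (j, r) (coeff v g))"
      unfolding v(1) act_oscillator[OF j(1) r(1) e v(3)] using r(2)
      by (simp add: a_coeff_def pdiff_cscale mult.commute)
    then show ?case
      using step.IH vvec.subspace_add[OF V_space_subspace cV wV]
      by (simp add: act_add[OF x cV wV] act_vscale[OF x vV] lookup_add pdiff_add pdiff_cscale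
          cvec.scale_right_distrib mult.commute V_space_def)
  qed
  then show ?thesis ..
qed

text \<open>
  A component with a nonconstant monomial \<open>\<mu>\<close> survives differentiation in a variable of \<open>\<mu>\<close>, and every
  derivation lowers the degree. Repeating this ends at a nonzero vector all of whose components are
  constants, that is, at some \<open>a \<otimes> 1\<close>.
\<close>

lemma lower_to_vacuum:
  assumes U: "ghat_module n \<rho> U" "U \<subseteq> tensor_poly n A"
    and A: "cvec.subspace A" "A \<subseteq> lattice_algebra n"
    and u: "u \<in> U" "u \<noteq> 0"
  shows "\<exists>a\<in>A. a \<noteq> 0 \<and> tensor a 1 \<in> U"
proof -
  have closed: "\<And>x v. x \<in> ghat n \<Longrightarrow> v \<in> U \<Longrightarrow> \<rho> x v \<in> U"
    using U(1) by (auto simp: ghat_module_def)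
  have UV: "U \<subseteq> V_space n" using U(2) tensor_poly_subset_V[OF A(2)] by blast
  have main: "\<exists>a\<in>A. a \<noteq> 0 \<and> tensor a 1 \<in> U"
    if "u \<in> U" "u \<noteq> 0" "\<forall>g. \<forall>\<mu>\<in>supp (coeff u g). mono_degree \<mu> \<le> N" for N u
    using that
  proof (induction N arbitrary: u rule: less_induct)
    case (less N)
    show ?case
    proof (cases "\<exists>g. \<exists>\<mu>\<in>supp (coeff u g). \<mu> \<noteq> 0")
      case True
      then obtain g \<mu> where \<mu>: "\<mu> \<in> supp (coeff u g)" "\<mu> \<noteq> 0" by blast
      then obtain p where p: "p \<in> supp \<mu>"
        by (metis in_keys_iff lookup_zero poly_mapping_eqI)
      have "coeff u g \<in> poly_space n"
        using less.prems(1) U(2) tensor_poly_components by blast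
      then have "p \<in> {1..n} \<times> {r. odd r}"
        using \<mu> p by (auto simp: poly_space_def)
      then obtain j r where jr: "p = (j, r)" "j \<in> {1..n}" "odd r" by auto
      \<comment> \<open>proportional to the derivative of \<open>u\<close> in a variable of \<open>\<mu>\<close>\<close>
      define u' where "u' = \<rho> (loop (S j) (int r)) u"
      have u': "coeff u' h = cscale (1 / complex_of_real (sqrt 2)) (pdiff p (coeff u h))" for h
        using act_lowering[OF jr(2,3)] less.prems(1) UV jr(1) unfolding u'_def by blast
      have "u' \<in> U"
        unfolding u'_def using jr less.prems(1) by (intro closed cartan_mode_in_ghat S_in_h_space) auto
      moreover have "u' \<noteq> 0"
      proof
        assume "u' = 0"
        then have "coeff (pdiff p (coeff u g)) (\<mu> - delta p 1) = 0"
          using arg_cong[OF u'[of g], of "\<lambda>f. coeff f (\<mu> - delta p 1)"] by simp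
        then have "coeff (coeff u g) \<mu> = 0"
          unfolding lookup_pdiff monomial_split[OF p, symmetric] Suc_eq_plus1[symmetric]
          using of_nat_neq_0 mult_eq_0_iff by metis
        then show False using \<mu>(1) by (simp add: in_keys_iff)
      qed
      moreover have deg: "mono_degree \<nu> + 1 \<le> N" if "\<nu> \<in> supp (coeff u' h)" for \<nu> h
      proof -
        have "\<nu> + delta p 1 \<in> supp (coeff u h)"
          using that by (auto simp: u' in_keys_iff lookup_pdiff)
        then show ?thesis using less.prems(3) mono_degree_add_delta[of \<nu> p] by metis
      qed
      moreover have "0 < N"
        using less.prems(3) \<mu>(1) mono_degree_add_delta[of "\<mu> - delta p 1" p] monomial_split[OF p]
        by (metis add_is_0 gr0I le_zero_eq one_neq_zero)
      ultimately show ?thesis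
        using less.IH[of "N - 1" u'] by fastforce
    next
      case False
      then have *: "coeff (coeff u g) \<mu> = 0" if "\<mu> \<noteq> 0" for g \<mu>
        using that by (metis in_keys_iff)
      have "tensor (const_part u) 1 = u"
      proof (intro poly_mapping_eqI)
        fix g \<mu>
        show "coeff (coeff (tensor (const_part u) 1) g) \<mu> = coeff (coeff u g) \<mu>"
          by (cases "\<mu> = 0") (simp_all add: lookup_const_part lookup_one *)
      qed
      moreover have "const_part u \<in> A"
        using const_part_tensor_poly[OF A(1)] less.prems(1) U(2) by blast
      ultimately show ?thesis
        using less.prems(1,2) by (intro bexI[of _ "const_part u"]) auto
    qed
  qed
  \<comment> \<open>the index \<open>0\<close> is added because the maximum of the empty set is unspecified\<close>
  define N where "N = Max (insert 0 (mono_degree ` (\<Union>g\<in>supp u. supp (coeff u g))))"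
  have "mono_degree \<mu> \<le> N" if "\<mu> \<in> supp (coeff u g)" for g \<mu>
  proof -
    have "g \<in> supp u" using that by (auto simp: in_keys_iff)
    then show ?thesis unfolding N_def using that by (intro Max_ge) auto
  qed
  then show ?thesis using main[OF u] by blast
qed

section \<open>Irreducibility\<close>

definition vacua :: "vspace set \<Rightarrow> galgebra set" where
  "vacua U = {a \<in> lattice_algebra n. tensor a 1 \<in> U}"

lemma lattice_algebra_subspace: "cvec.subspace (lattice_algebra n)"
  by (simp add: lattice_algebra_def)

lemma vacua_subspace: "vvec.subspace U \<Longrightarrow> cvec.subspace (vacua U)"
  using lattice_algebra_subspace
  by (auto simp: cvec.subspace_def vvec.subspace_def vacua_def tensor_add_left tensor_cscale_left)

lemma twisted_mult_lattice_algebra: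
  assumes "\<alpha> \<in> root_lattice n" "a \<in> lattice_algebra n"
  shows "twisted_mult n \<alpha> a \<in> lattice_algebra n"
  using assms(2) unfolding lattice_algebra_def
proof (induction rule: cvec.span_induct_alt)
  case base
  then show ?case by (simp add: twisted_mult_zero cvec.span_zero)
next
  case (step c x y)
  then obtain \<gamma> where "\<gamma> \<in> root_lattice n" "x = expo \<gamma>" by blast
  then have "twisted_mult n \<alpha> x \<in> cvec.span (expo ` root_lattice n)"
    using n_ge_4 assms(1)
    by (simp add: twisted_mult_expo) (intro cvec.span_scale cvec.span_base imageI root_lattice_add)
  then show ?case
    using step.IH by (simp add: twisted_mult_add twisted_mult_cscale cvec.span_add cvec.span_scale)
qed

lemma vacua_twisted_mult:
  assumes U: "ghat_module n \<rho> U" and \<alpha>: "\<alpha> \<in> roots n" and a: "a \<in> vacua U"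
  shows "twisted_mult n \<alpha> a \<in> vacua U"
proof -
  have sub: "vvec.subspace U" and closed: "\<And>x v. x \<in> ghat n \<Longrightarrow> v \<in> U \<Longrightarrow> \<rho> x v \<in> U"
    using U by (auto simp: ghat_module_def)
  have a': "a \<in> lattice_algebra n" "tensor a 1 \<in> U" using a by (auto simp: vacua_def)
  have "vscale 2 (\<rho> (root_mode \<alpha> 0) (tensor a 1)) \<in> U"
    by (intro vvec.subspace_scale[OF sub] closed root_mode_in_ghat \<alpha> a')
  then show ?thesis
    using twisted_mult_lattice_algebra[OF root_lattice_of_root[OF \<alpha>] a'(1)]
    by (simp add: act_root_mode[OF \<alpha> a'(1)] E_coeff_vacuum vacua_def)
qed

lemma twisted_mult_sum: "twisted_mult n \<alpha> (\<Sum>v\<in>t. f v) = (\<Sum>v\<in>t. twisted_mult n \<alpha> (f v))"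
  by (induction t rule: infinite_finite_induct) (simp_all add: twisted_mult_zero twisted_mult_add)

text \<open>
  The operators \<open>E\<^bsub>\<alpha>\<^sub>k\<^esub>\<close> with \<open>k \<notin> S\<close> are diagonal on the \<open>v(b)\<close> with eigenvalues \<open>- i b\<^sub>k\<close>, and together these
  eigenvalues distinguish the \<open>v(b)\<close>. As usual, a shortest combination that lies in \<open>M\<close> has length one:
  otherwise \<open>E - \<lambda>\<close> removes one of its terms and keeps another one.
\<close>

lemma separate_eigenvectors:
  assumes M: "cvec.subspace M" "\<And>k a. k \<in> {1..n} \<Longrightarrow> a \<in> M \<Longrightarrow> twisted_mult n (simple_root k) a \<in> M"
    and B: "\<And>b. b \<in> B \<Longrightarrow> \<forall>k\<in>{1..n}. b k \<in> {1, -1}"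
    and sep: "\<And>b b'. b \<in> B \<Longrightarrow> b' \<in> B \<Longrightarrow> \<forall>k\<in>{1..n} - nu_set n. b k = b' k \<Longrightarrow> \<forall>k\<in>{1..n}. b k = b' k"
    and t: "finite t" "t \<subseteq> vvect n ` B" "t \<noteq> {}" "\<And>v. v \<in> t \<Longrightarrow> r v \<noteq> 0"
      "(\<Sum>v\<in>t. cscale (r v) v) \<in> M"
  shows "\<exists>v\<in>t. v \<in> M"
  using t
proof (induction "card t" arbitrary: t r rule: less_induct)
  case less
  show ?case
  proof (cases "\<exists>v1\<in>t. \<exists>v2\<in>t. v1 \<noteq> v2")
    case False
    then obtain v where v: "t = {v}" using less.prems(3) by blast
    have "cscale (1 / r v) (cscale (r v) v) \<in> M"
      using less.prems(5) v by (simp add: cvec.subspace_scale[OF M(1)] del: cvec.scale_scale)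
    moreover have "cscale (1 / r v) (cscale (r v) v) = v"
      using v less.prems(4)[of v] unfolding cvec.scale_scale by simp
    ultimately have "v \<in> M" by (simp only:)
    then show ?thesis using v by blast
  next
    case True
    then obtain v1 v2 where v: "v1 \<in> t" "v2 \<in> t" "v1 \<noteq> v2" by blast
    then obtain b1 b2 where b: "b1 \<in> B" "b2 \<in> B" "v1 = vvect n b1" "v2 = vvect n b2"
      using less.prems(2) by blast
    then obtain k where k: "k \<in> {1..n}" "k \<notin> nu_set n" "b1 k \<noteq> b2 k"
      using sep[of b1 b2] v(3) vvect_cong[of n b1 b2] by blast
    let ?T = "twisted_mult n (simple_root k)"
    have "\<forall>v\<in>t. \<exists>x. ?T v = cscale x v"
      using less.prems(2) twisted_mult_simple_root_diagonal[OF k(1,2)] B by blast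
    then obtain ev where ev: "\<And>v. v \<in> t \<Longrightarrow> ?T v = cscale (ev v) v" by metis
    have eig: "ev (vvect n b) = - \<i> * of_int (b k)" if "b \<in> B" "vvect n b \<in> t" for b
    proof -
      have "cscale (ev (vvect n b)) (vvect n b) = cscale (- \<i> * of_int (b k)) (vvect n b)"
        by (rule trans[OF ev[OF that(2), symmetric] twisted_mult_simple_root_diagonal[OF k(1,2) B[OF that(1)]]])
      then show ?thesis
        unfolding cvec.scale_cancel_right using vvect_nonzero[OF B[OF that(1)]] by blast
    qed
    have ne: "ev v1 \<noteq> ev v2"
      using eig[OF b(1)] eig[OF b(2)] b v k(3) by simp
    \<comment> \<open>\<open>T - ev v2\<close> removes \<open>v2\<close> from the combination and keeps \<open>v1\<close>\<close>
    let ?a = "\<Sum>v\<in>t. cscale (r v) v"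
    let ?t = "{v \<in> t. ev v \<noteq> ev v2}" and ?r = "\<lambda>v. r v * (ev v - ev v2)"
    have "?T ?a - cscale (ev v2) ?a = (\<Sum>v\<in>t. cscale (?r v) v)"
      unfolding twisted_mult_sum cvec.scale_sum_right sum_subtractf[symmetric]
      by (intro sum.cong) (simp_all add: twisted_mult_cscale ev right_diff_distrib cvec.scale_left_diff_distrib mult.commute)
    also have "\<dots> = (\<Sum>v\<in>?t. cscale (?r v) v)"
      using less.prems(1) by (intro sum.mono_neutral_right) auto
    finally have eq: "?T ?a - cscale (ev v2) ?a = (\<Sum>v\<in>?t. cscale (?r v) v)" .
    have "?T ?a - cscale (ev v2) ?a \<in> M"
      by (rule cvec.subspace_diff[OF M(1) M(2)[OF k(1) less.prems(5)]
            cvec.subspace_scale[OF M(1) less.prems(5)]])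
    then have sum: "(\<Sum>v\<in>?t. cscale (?r v) v) \<in> M"
      unfolding eq .
    have "?t \<subset> t" using v(2) by blast
    then have card: "card ?t < card t"
      by (rule psubset_card_mono[OF less.prems(1)])
    have "\<exists>v\<in>?t. v \<in> M"
    proof (rule less.hyps[OF card _ _ _ _ sum])
      show "finite ?t" "?t \<subseteq> vvect n ` B" "?t \<noteq> {}"
        using less.prems(1,2) v(1) ne by auto
      show "?r v \<noteq> 0" if "v \<in> ?t" for v
        using that less.prems(4) by simp
    qed
    then show ?thesis by blast
  qed
qed

text \<open>
  Irreducibility becomes a matter of sign vectors. From a nonzero submodule one descends to the vacuum,
  isolates some \<open>v(b)\<close> there, reaches all others by the operators \<open>E\<^bsub>\<alpha>\<^sub>k\<^esub>\<close> and climbs up again with the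
  oscillators. The last two steps also show that each \<open>v(b) \<otimes> 1\<close> generates the module. In the hypothesis
  \<open>conn\<close> the predicate \<open>P\<close> will say that \<open>v(d) \<otimes> 1\<close> lies in the given submodule.
\<close>

lemma irreducible_highest_weight_criterion:
  assumes B: "\<And>b. b \<in> B \<Longrightarrow> \<forall>k\<in>{1..n}. b k \<in> {1, -1}"
    and inv: "\<And>b X. b \<in> B \<Longrightarrow> X \<subseteq> {1..n} \<Longrightarrow> (\<lambda>k. b k * flip n X k) \<in> B"
    and sep: "\<And>b b'. b \<in> B \<Longrightarrow> b' \<in> B \<Longrightarrow> \<forall>k\<in>{1..n} - nu_set n. b k = b' k \<Longrightarrow> \<forall>k\<in>{1..n}. b k = b' k"
    and conn: "\<And>P b b'. b \<in> B \<Longrightarrow> b' \<in> B \<Longrightarrow> P b \<Longrightarrow>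
       (\<And>d k. d \<in> B \<Longrightarrow> k \<in> {1..n} \<Longrightarrow> P d \<Longrightarrow> P (\<lambda>l. d l * neigh_sign n k l)) \<Longrightarrow>
       \<exists>d\<in>B. P d \<and> (\<forall>k\<in>{1..n}. d k = b' k)"
    and c: "c \<in> B" and sing: "singular_vector n \<rho> (tensor (vvect n c) 1)"
  shows "irreducible_highest_weight_module n \<rho> (tensor_poly n (cvec.span (vvect n ` B))) (tensor (vvect n c) 1)"
proof -
  let ?A = "cvec.span (vvect n ` B)"
  let ?W = "tensor_poly n ?A"
  have A: "?A \<subseteq> lattice_algebra n"
    by (rule cvec.span_minimal) (auto simp: vvect_in_lattice_algebra lattice_algebra_subspace)
  have W: "ghat_module n \<rho> ?W"
  proof (rule tensor_poly_module[OF A])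
    fix \<alpha> a assume \<alpha>: "\<alpha> \<in> roots n" and "a \<in> ?A"
    from this(2) show "twisted_mult n \<alpha> a \<in> ?A"
    proof (induction rule: cvec.span_induct_alt)
      case base
      then show ?case by (simp add: twisted_mult_zero cvec.span_zero)
    next
      case (step x v y)
      then obtain b where b: "b \<in> B" "v = vvect n b" by blast
      note lat = root_lattice_of_root[OF \<alpha>]
      have "twisted_mult n \<alpha> v \<in> ?A"
        using inv[OF b(1) odd_supp_subset[OF lat]] unfolding b(2) twisted_mult_vvect[OF lat B[OF b(1)]]
        by (intro cvec.span_scale cvec.span_base imageI)
      then show ?case
        using step.IH by (simp add: twisted_mult_add twisted_mult_cscale cvec.span_add cvec.span_scale)
    qed
  qed
  have "vvect n c \<in> ?A" by (intro cvec.span_base imageI c)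
  then have cW: "tensor (vvect n c) 1 \<in> ?W"
    unfolding tensor_poly_def using one_in_poly_space by (blast intro: vvec.span_base)
  \<comment> \<open>connecting and raising: every submodule that contains one \<open>v(b) \<otimes> 1\<close> contains everything\<close>
  have generate: "?W \<subseteq> U" if U: "ghat_module n \<rho> U" and b: "b \<in> B" "tensor (vvect n b) 1 \<in> U" for U b
  proof -
    have sub: "vvec.subspace U" using U by (auto simp: ghat_module_def)
    have "vvect n b' \<in> vacua U" if "b' \<in> B" for b'
    proof -
      have "\<exists>d\<in>B. vvect n d \<in> vacua U \<and> (\<forall>k\<in>{1..n}. d k = b' k)"
      proof (rule conn[OF b(1) that])
        show "vvect n b \<in> vacua U" using b by (simp add: vacua_def vvect_in_lattice_algebra)
        fix d k assume d: "d \<in> B" "k \<in> {1..n}" "vvect n d \<in> vacua U"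
        have dk: "d k \<noteq> 0" using bspec[OF B[OF d(1)] d(2)] by auto
        have "twisted_mult n (simple_root k) (vvect n d) \<in> vacua U"
          using vacua_twisted_mult[OF U simple_root_in_roots d(3)] n_ge_4 d(2) by blast
        then have "cscale (1 / (- \<i> * of_int (d k)))
            (cscale (- \<i> * of_int (d k)) (vvect n (\<lambda>l. d l * neigh_sign n k l))) \<in> vacua U"
          unfolding twisted_mult_simple_root[OF d(2) B[OF d(1)]]
          by (rule cvec.subspace_scale[OF vacua_subspace[OF sub]])
        then show "vvect n (\<lambda>l. d l * neigh_sign n k l) \<in> vacua U"
          using dk by (simp only: cvec.scale_scale) simp
      qed
      then show ?thesis using vvect_cong by metis
    qed
    then have "?A \<subseteq> vacua U"
      by (intro cvec.span_minimal vacua_subspace[OF sub]) auto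
    then show ?thesis
      unfolding tensor_poly_def
      by (intro vvec.span_minimal sub) (auto simp: vacua_def intro: raise_to_polynomials[OF U])
  qed
  have irr: "U = {0} \<or> U = ?W" if U: "ghat_module n \<rho> U" "U \<subseteq> ?W" for U
  proof (cases "U \<subseteq> {0}")
    case True
    have "vvec.subspace U" using U by (auto simp: ghat_module_def)
    then show ?thesis using True vvec.subspace_0 by blast
  next
    case False
    then obtain u where "u \<in> U" "u \<noteq> 0" by blast
    \<comment> \<open>lowering, then separating\<close>
    from lower_to_vacuum[OF U cvec.subspace_span A this]
    obtain a where a: "a \<in> ?A" "a \<noteq> 0" "tensor a 1 \<in> U" by blast
    obtain t r where t: "finite t" "t \<subseteq> vvect n ` B" "a = (\<Sum>v\<in>t. cscale (r v) v)"
      using a(1) unfolding cvec.span_explicit by blast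
    let ?t = "{v \<in> t. r v \<noteq> 0}"
    have a_eq: "a = (\<Sum>v\<in>?t. cscale (r v) v)"
      unfolding t(3) using t(1) by (intro sum.mono_neutral_right) auto
    have sub: "cvec.subspace (vacua U)"
      using U(1) by (intro vacua_subspace) (auto simp: ghat_module_def)
    have "\<exists>v\<in>?t. v \<in> vacua U"
    proof (rule separate_eigenvectors[where B = B and r = r, OF sub])
      show "twisted_mult n (simple_root k) a \<in> vacua U" if "k \<in> {1..n}" "a \<in> vacua U" for k a
        using vacua_twisted_mult[OF U(1) simple_root_in_roots that(2)] n_ge_4 that(1) by blast
      show "(\<Sum>v\<in>?t. cscale (r v) v) \<in> vacua U"
        using a A a_eq[symmetric] by (auto simp: vacua_def)
      show "?t \<noteq> {}"
        using a(2) a_eq by (metis sum.empty)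
    qed (use B sep t in auto)
    then obtain b where "b \<in> B" "vvect n b \<in> vacua U" using t(2) by blast
    then have "?W \<subseteq> U" using generate[OF U(1)] by (auto simp: vacua_def)
    then show ?thesis using U(2) by blast
  qed
  have "tensor (vvect n c) 1 \<noteq> 0"
    using sing by (simp add: singular_vector_def weight_vector_def)
  then have "?W \<noteq> {0}" using cW by blast
  then show ?thesis
    unfolding irreducible_highest_weight_module_def irreducible_module_def
    using W cW sing irr generate[OF _ c] by blast
qed

end

section \<open>Connecting sign vectors by flips\<close>

context vertex_rep
begin

lemma neigh_sign_even_odd:
  assumes i: "1 \<le> i" "2 * i \<in> nu_set n" "2 * i \<le> n - 1" and j: "1 \<le> j" "j \<le> i"
  shows "neigh_sign n (2 * i) (2 * j - 1) = (if j = i then -1 else 1)"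
proof -
  have "joined n (2 * i) (2 * j - 1) \<longleftrightarrow> j = i"
    using assms by (auto simp: joined_def doubleton_eq_iff)
  then show ?thesis using i by (simp add: neigh_sign_def)
qed

text \<open>
  The operator of \<open>\<alpha>\<^bsub>2i\<^esub>\<close> flips the sign at \<open>2 i - 1\<close> and otherwise only signs at later places. Used from left to right,
  these operators correct the signs at odd places one after the other.
\<close>

lemma flips_connect:
  assumes M: "\<And>i. 1 \<le> i \<Longrightarrow> i \<le> M \<Longrightarrow> 2 * i \<in> nu_set n \<and> 2 * i \<le> n - 1"
    and B: "\<And>b. b \<in> B \<Longrightarrow> \<forall>k\<in>{1..n}. b k \<in> {1, -1}"
    and inv: "\<And>b X. b \<in> B \<Longrightarrow> X \<subseteq> {1..n} \<Longrightarrow> (\<lambda>k. b k * flip n X k) \<in> B"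
    and b: "b \<in> B" "b' \<in> B" "P b"
    and P: "\<And>d k. d \<in> B \<Longrightarrow> k \<in> {1..n} \<Longrightarrow> P d \<Longrightarrow> P (\<lambda>l. d l * neigh_sign n k l)"
    and i: "i \<le> M"
  shows "\<exists>d\<in>B. P d \<and> (\<forall>j\<in>{1..i}. d (2 * j - 1) = b' (2 * j - 1))"
  using i
proof (induction i)
  case 0
  then show ?case using b by auto
next
  case (Suc i)
  then obtain d where d: "d \<in> B" "P d" "\<forall>j\<in>{1..i}. d (2 * j - 1) = b' (2 * j - 1)" by auto
  let ?k = "2 * Suc i"
  have k: "?k \<in> nu_set n" "?k \<le> n - 1" using M[of "Suc i"] Suc.prems by auto
  then have kn: "?k \<in> {1..n}" by auto
  show ?case
  proof (cases "d (2 * Suc i - 1) = b' (2 * Suc i - 1)")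
    case True
    have "d (2 * j - 1) = b' (2 * j - 1)" if "j \<in> {1..Suc i}" for j
      using that d(3) True by (cases "j = Suc i") auto
    then show ?thesis using d(1,2) by blast
  next
    case False
    let ?d = "\<lambda>l. d l * neigh_sign n ?k l"
    have ns: "neigh_sign n ?k (2 * j - 1) = (if j = Suc i then -1 else 1)" if "j \<in> {1..Suc i}" for j
      by (rule neigh_sign_even_odd[OF _ k]) (use that in auto)
    have "?d \<in> B" using inv[OF d(1), of "{?k}"] kn by (simp add: flip_def)
    moreover have "P ?d" by (rule P[OF d(1) kn d(2)])
    moreover have "?d (2 * j - 1) = b' (2 * j - 1)" if j: "j \<in> {1..Suc i}" for j
    proof (cases "j = Suc i")
      case True
      have "2 * Suc i - 1 \<in> {1..n}" using kn by auto
      then have "d (2 * Suc i - 1) \<in> {1, -1}" "b' (2 * Suc i - 1) \<in> {1, -1}"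
        using B[OF d(1)] B[OF b(2)] by blast+
      then have "d (2 * Suc i - 1) = - b' (2 * Suc i - 1)" using False by auto
      then show ?thesis using ns[OF j] True by simp
    next
      case False
      then show ?thesis using ns[OF j] d(3) j by simp
    qed
    ultimately show ?thesis by blast
  qed
qed

text \<open>
  The neighbours of these nodes are not in \<open>S\<close>; so these signs are constant on each of the modules.
\<close>

lemma flip_even:
  assumes "even k" "k \<noteq> n \<or> odd n" "k \<le> n" "X \<subseteq> {1..n}"
  shows "flip n X k = 1"
  unfolding flip_def
proof (rule prod.neutral, rule)
  fix l assume "l \<in> X"
  then have l: "l \<in> {1..n}" using assms(4) by blast
  show "neigh_sign n l k = 1"
    using assms l n_ge_4 by (auto simp: neigh_sign_def joined_def nu_set_def doubleton_eq_iff)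
qed

lemma flip_fork: "flip n X n = flip n X (n - 1)"
  unfolding flip_def neigh_sign_fork(2)[OF n_ge_4] ..


lemma has_weight_from_h_values:
  assumes c: "\<forall>k\<in>{1..n}. c k \<in> {1, -1}" and c1: "c 1 = 1"
    and plain: "\<And>j. j \<in> {1..n div 2} \<Longrightarrow> \<mu> (Plain j) = (1 - of_int (c (n - 1) * c n)) / 2 * h_value n c j"
    and primed: "\<And>j. j \<in> {1..n div 2} \<Longrightarrow> \<mu> (Primed j) = (1 + of_int (c (n - 1) * c n)) / 2 * h_value n c j"
    and zero: "\<mu> (Plain 0) = 0"
  shows "has_weight n \<rho> (tensor (vvect n c) 1) \<mu>"
proof -
  have "\<forall>a\<in>nodes n. \<mu> a = node_weight c a"
    unfolding ball_nodes using plain primed zero c1 by simp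
  then show ?thesis by (intro has_weight_vvect[OF c]) simp
qed

end

section \<open>The conditions on the signs\<close>

text \<open>
  Each equation says \<open>x j = 1\<close> or \<open>x (j + 1) = -1\<close>; the value \<open>1\<close> therefore propagates from the right end to the left.
\<close>

lemma downward_ones:
  fixes x :: "nat \<Rightarrow> int"
  assumes "x N = 1" and "\<And>j. j \<in> {1..<N} \<Longrightarrow> (x j - 1) * (x (Suc j) + 1) = 0"
  shows "\<forall>j\<in>{1..N}. x j = 1"
proof
  fix j assume "j \<in> {1..N}"
  then have "j \<le> N" "1 \<le> j" by auto
  then show "x j = 1"
  proof (induction rule: inc_induct)
    case base
    then show ?case using assms(1) by simp
  next
    case (step k)
    then show ?case using assms(2)[of k] by auto
  qed
qed

text \<open>
  The last two generators together force \<open>c\<^bsub>2m-3\<^esub> = 1\<close>, whatever \<open>c\<^bsub>2m-1\<^esub>\<close> is; the others propagate this to the left.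
\<close>

lemma e_value_zero_iff_even:
  assumes "2 \<le> m" "n = 2 * m" and c: "\<forall>k\<in>{1..n}. c k \<in> {1, -1}"
  shows "(\<forall>j\<in>{1..m}. e_value n c j = 0) \<longleftrightarrow> (\<forall>j\<in>{1..m-1}. c (2*j-1) = 1)"
proof -
  define x where "x j = c (2 * j - 1)" for j
  have nz: "c (2 * j) \<noteq> 0" if "j \<in> {1..m}" for j
    using bspec[OF c, of "2 * j"] that assms(2) by auto
  have e: "e_value n c j = 0 \<longleftrightarrow> (x j - 1) * (x (Suc j) + 1) = 0" if "j \<in> {1..<m}" for j
    using nz[of j] that assms(2) by (simp add: e_value_def x_def)
  obtain N where N: "m = Suc N" "1 \<le> N" using assms(1) by (cases m) auto
  have "e_value n c m = 0 \<longleftrightarrow> (x N - 1) * (x (Suc N) - 1) = 0"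
  proof -
    have "2 * m - 2 = 2 * N" "2 * m - 3 = 2 * N - 1" "2 * m - 1 = 2 * Suc N - 1" using N by auto
    then show ?thesis
      using nz[of N] N assms(2) by (simp add: e_value_def x_def)
  qed
  moreover have "{1..m} = insert m (insert N {1..<N})" using N by auto
  ultimately have "(\<forall>j\<in>{1..m}. e_value n c j = 0) \<longleftrightarrow>
      (x N - 1) * (x (Suc N) - 1) = 0 \<and> (x N - 1) * (x (Suc N) + 1) = 0
      \<and> (\<forall>j\<in>{1..<N}. (x j - 1) * (x (Suc j) + 1) = 0)"
    using e N by auto
  also have "\<dots> \<longleftrightarrow> (\<forall>j\<in>{1..N}. x j = 1)"
  proof
    assume *: "(x N - 1) * (x (Suc N) - 1) = 0 \<and> (x N - 1) * (x (Suc N) + 1) = 0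
      \<and> (\<forall>j\<in>{1..<N}. (x j - 1) * (x (Suc j) + 1) = 0)"
    then have "x N = 1" by auto
    then show "\<forall>j\<in>{1..N}. x j = 1" using * by (intro downward_ones) auto
  qed (use N in auto)
  finally show ?thesis by (simp add: x_def N)
qed

lemma e_value_zero_iff_odd:
  assumes "2 \<le> m" "n = 2 * m + 1" and c: "\<forall>k\<in>{1..n}. c k \<in> {1, -1}"
  shows "(\<forall>j\<in>{1..m}. e_value n c j = 0) \<longleftrightarrow> (\<forall>j\<in>{1..m}. c (2*j-1) = 1)"
proof -
  define x where "x j = c (2 * j - 1)" for j
  have nz: "c (2 * j) \<noteq> 0" if "j \<in> {1..m}" for j
    using bspec[OF c, of "2 * j"] that assms(2) by auto
  have e: "e_value n c j = 0 \<longleftrightarrow> (x j - 1) * (x (Suc j) + 1) = 0" if "j \<in> {1..<m}" for j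
    using nz[of j] that assms(2) by (simp add: e_value_def x_def)
  have "c (2 * m - 2) \<noteq> 0"
    using nz[of "m - 1"] assms(1) by (simp add: right_diff_distrib')
  then have "e_value n c m = 0 \<longleftrightarrow> x m = 1"
    using assms(2) by (simp add: e_value_def x_def)
  moreover have "{1..m} = insert m {1..<m}" using assms(1) by auto
  ultimately have "(\<forall>j\<in>{1..m}. e_value n c j = 0) \<longleftrightarrow>
      x m = 1 \<and> (\<forall>j\<in>{1..<m}. (x j - 1) * (x (Suc j) + 1) = 0)"
    using e by auto
  also have "\<dots> \<longleftrightarrow> (\<forall>j\<in>{1..m}. x j = 1)"
    using downward_ones[of x m] assms(1) by auto
  finally show ?thesis by (simp add: x_def)
qed

lemma odd_indices: "{j \<in> {1..2 * m - 1}. odd j} = (\<lambda>j. 2 * j - 1) ` {1..m :: nat}"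
proof (intro equalityI subsetI)
  fix j assume "j \<in> {j \<in> {1..2 * m - 1}. odd j}"
  then have j: "odd j" "1 \<le> j" "j \<le> 2 * m - 1" by auto
  from j(1) obtain i where i: "j = 2 * i + 1" by (rule oddE)
  then have "j = 2 * Suc i - 1" "Suc i \<in> {1..m}" using j by auto
  then show "j \<in> (\<lambda>j. 2 * j - 1) ` {1..m}" by blast
qed auto

lemma prod_odd_indices:
  fixes b :: "nat \<Rightarrow> int"
  shows "(\<Prod>j\<in>{j \<in> {1..2 * m - 1}. odd j}. b j) = (\<Prod>j=1..m. b (2 * j - 1))"
proof -
  have "inj_on (\<lambda>j. 2 * j - 1) {1..m :: nat}" by (auto simp: inj_on_def)
  then show ?thesis unfolding odd_indices by (simp add: prod.reindex)
qed

context vertex_rep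
begin

lemma singular_weight_even:
  assumes m: "2 \<le> m" "n = 2 * m" and c: "\<forall>k\<in>{1..n}. c k \<in> {1, -1}"
    and ones: "\<forall>j\<in>{1..m-1}. c (2*j-1) = 1"
    and \<mu>: "\<And>a. \<mu> a = (if a = Plain (m-1) \<and> c (2*m-1) = -1 \<and> c (2*m) = 1 \<or>
        a = Plain m \<and> c (2*m-1) = 1 \<and> c (2*m) = -1 \<or>
        a = Primed (m-1) \<and> c (2*m-1) = -1 \<and> c (2*m) = -1 \<or>
        a = Primed m \<and> c (2*m-1) = 1 \<and> c (2*m) = 1 then 1 else 0)"
  shows "has_weight n \<rho> (tensor (vvect n c) 1) \<mu>"
proof -
  obtain N where N: "m = Suc N" "1 \<le> N" using m by (cases m) auto
  have h: "h_value n c j = (if j < N then 0 else if j = N then (1 - of_int (c (2*m-1))) / 2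
      else (1 + of_int (c (2*m-1))) / 2)" if j: "j \<in> {1..m}" for j
  proof -
    consider "j < N" | "j = N" | "j = m" using j N by fastforce
    then show ?thesis
    proof cases
      case 1
      then have "c (2 * j - 1) = 1" "c (2 * Suc j - 1) = 1"
        using ones j N by (auto simp del: mult_Suc_right)
      then show ?thesis using 1 N m(2) by (simp add: h_value_def)
    next
      case 2
      then have "c (2 * j - 1) = 1" using ones j N by auto
      then show ?thesis using 2 N m(2) by (simp add: h_value_def)
    next
      case 3
      have "c (2 * N - 1) = 1" using ones N by auto
      moreover have "2 * m - 3 = 2 * N - 1" using N by auto
      ultimately show ?thesis using 3 N m(2) by (simp add: h_value_def)
    qed
  qed
  have "2*m-1 \<in> {1..n}" "2*m \<in> {1..n}" using m by auto
  then have last: "c (2*m-1) = 1 \<or> c (2*m-1) = -1" "c (2*m) = 1 \<or> c (2*m) = -1"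
    using c by blast+
  show ?thesis
  proof (rule has_weight_from_h_values[OF c])
    show "c 1 = 1" using bspec[OF ones, of 1] N by simp
    show "\<mu> (Plain 0) = 0" using N by (simp add: \<mu>)
    have n: "n - 1 = 2 * m - 1" using m(2) by simp
    fix j assume "j \<in> {1..n div 2}"
    then have j: "j \<in> {1..m}" using m(2) by simp
    define x y where "x = c (2*m-1)" and "y = c (2*m)"
    have xy: "x = 1 \<or> x = -1" "y = 1 \<or> y = -1" using last by (simp_all add: x_def y_def)
    have cn: "c n = y" using m(2) by (simp add: y_def)
    note eqs = n cn h[OF j] \<mu> x_def[symmetric] y_def[symmetric]
    consider "j < N" "j \<noteq> m" "j \<noteq> m - 1" | "j = N" "\<not> j < N" "j \<noteq> m" "j = m - 1"
      | "\<not> j < N" "j \<noteq> N" "j = m" "j \<noteq> m - 1"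
      using j N by fastforce
    then show "\<mu> (Plain j) = (1 - of_int (c (n - 1) * c n)) / 2 * h_value n c j"
      "\<mu> (Primed j) = (1 + of_int (c (n - 1) * c n)) / 2 * h_value n c j"
      unfolding eqs using xy by (cases; elim disjE; simp)+
  qed
qed

lemma singular_weight_odd:
  assumes m: "2 \<le> m" "n = 2 * m + 1" and c: "\<forall>k\<in>{1..n}. c k \<in> {1, -1}"
    and ones: "\<forall>j\<in>{1..m}. c (2*j-1) = 1"
    and \<mu>: "\<And>a. \<mu> a = (if a = Primed m \<and> c (2*m) = c (2*m+1) \<or> a = Plain m \<and> c (2*m) \<noteq> c (2*m+1)
      then 1 else 0)"
  shows "has_weight n \<rho> (tensor (vvect n c) 1) \<mu>"
proof -
  have h: "h_value n c j = (if j = m then 1 else 0)" if "j \<in> {1..m}" for j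
  proof (cases "j = m")
    case True
    then show ?thesis using bspec[OF ones, of m] m by (simp add: h_value_def)
  next
    case False
    then have "c (2 * j - 1) = 1" "c (2 * Suc j - 1) = 1"
      using ones that by (auto simp del: mult_Suc_right)
    then show ?thesis using False that m(2) by (simp add: h_value_def)
  qed
  have "2*m \<in> {1..n}" "2*m+1 \<in> {1..n}" using m by auto
  then have last: "c (2*m) = 1 \<or> c (2*m) = -1" "c n = 1 \<or> c n = -1"
    using c m(2) by blast+
  show ?thesis
  proof (rule has_weight_from_h_values[OF c])
    show "c 1 = 1" using bspec[OF ones, of 1] m by simp
    show "\<mu> (Plain 0) = 0" using m by (simp add: \<mu>)
    have n: "n - 1 = 2 * m" using m(2) by simp
    fix j assume "j \<in> {1..n div 2}"
    then have j: "j \<in> {1..m}" using m(2) by simp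
    show "\<mu> (Plain j) = (1 - of_int (c (n - 1) * c n)) / 2 * h_value n c j"
      "\<mu> (Primed j) = (1 + of_int (c (n - 1) * c n)) / 2 * h_value n c j"
      unfolding n h[OF j] \<mu> m(2)[symmetric] using last by auto
  qed
qed

end

section \<open>The sign vectors that occur in one irreducible module\<close>

definition even_signs :: "nat \<Rightarrow> (nat \<Rightarrow> int) \<Rightarrow> (nat \<Rightarrow> int) set" where
  "even_signs m c = {b.
     (\<forall>j\<in>{1..2*m}. b j \<in> {1, -1}) \<and> (\<forall>j\<in>{1..m-1}. b (2*j) = c (2*j)) \<and>
     b (2*m-1) * b (2*m) = c (2*m-1) * c (2*m) \<and> (\<Prod>j\<in>{j\<in>{1..2*m-1}. odd j}. b j) = c (2*m-1)}"

definition odd_signs :: "nat \<Rightarrow> (nat \<Rightarrow> int) \<Rightarrow> (nat \<Rightarrow> int) set" where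
  "odd_signs m c = {b.
     (\<forall>j\<in>{1..2*m+1}. b j \<in> {1, -1}) \<and> (\<forall>j\<in>{1..m-1}. b (2*j) = c (2*j)) \<and>
     b (2*m) = c (2*m) \<and> b (2*m+1) = c (2*m+1)}"

context vertex_rep
begin

text \<open>
  Each node \<open>l \<in> S\<close> flips exactly two signs at odd places, those at \<open>l - 1\<close> and \<open>l + 1\<close>. This is the origin of the
  product condition for \<open>n = 2 m\<close>.
\<close>

lemma flip_prod_odd:
  assumes "n = 2 * m" "X \<subseteq> {1..n}"
  shows "(\<Prod>j\<in>{j \<in> {1..2*m-1}. odd j}. flip n X j) = 1"
proof -
  let ?O = "{j \<in> {1..2*m-1}. odd j}"
  have "(\<Prod>j\<in>?O. neigh_sign n l j) = 1" if "l \<in> X" for l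
  proof (cases "l \<in> nu_set n")
    case False
    then show ?thesis by (simp add: neigh_sign_not_S)
  next
    case True
    then have l: "even l" "2 \<le> l" "l \<le> n - 2" using assms(1) by (auto simp: nu_set_def)
    have "neigh_sign n l j = (if j = l - 1 then -1 else 1) * (if j = l + 1 then -1 else 1)" if j: "j \<in> ?O" for j
    proof -
      have "even n" "odd j" "j \<le> n - 1" using j assms(1) by auto
      then have "j \<noteq> n" "j \<noteq> n - 2" by auto
      then have "{l, j} \<noteq> {n - 2, n}" by blast
      moreover have "l = j + 1 \<longleftrightarrow> j = l - 1" "l - 1 \<noteq> l + 1" using l(2) by auto
      ultimately have "joined n l j \<longleftrightarrow> j = l - 1 \<or> j = l + 1"
        using l(3) \<open>j \<le> n - 1\<close> unfolding joined_def by auto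
      then show ?thesis using True \<open>l - 1 \<noteq> l + 1\<close> by (auto simp: neigh_sign_def)
    qed
    then have "(\<Prod>j\<in>?O. neigh_sign n l j)
        = (\<Prod>j\<in>?O. (if j = l - 1 then -1 else 1) * (if j = l + 1 then -1 else 1))"
      by (rule prod.cong[OF refl])
    also have "\<dots> = (\<Prod>j\<in>?O. if j = l - 1 then -1 else 1) * (\<Prod>j\<in>?O. if j = l + 1 then -1 else 1)"
      by (rule prod.distrib)
    also have "\<dots> = 1"
    proof -
      have "l - 1 \<in> ?O" "l + 1 \<in> ?O" "finite ?O" using l assms(1) by auto
      then show ?thesis by (simp only: prod.delta if_True)
    qed
    finally show ?thesis .
  qed
  then have "(\<Prod>l\<in>X. \<Prod>j\<in>?O. neigh_sign n l j) = 1"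
    by (intro prod.neutral) blast
  then show ?thesis
    unfolding flip_def by (subst prod.swap)
qed

lemma mult_flip_cases: "x \<in> {1, -1} \<Longrightarrow> x * flip n X k \<in> {1, -1}"
  using flip_cases[of n X k] by auto

lemma even_signs_flip:
  assumes m: "2 \<le> m" "n = 2 * m" and b: "b \<in> even_signs m c" and X: "X \<subseteq> {1..n}"
  shows "(\<lambda>k. b k * flip n X k) \<in> even_signs m c"
  unfolding even_signs_def
proof (intro CollectI conjI ballI)
  note b' = b[unfolded even_signs_def, simplified mem_Collect_eq]
  show "b k * flip n X k \<in> {1, -1}" if "k \<in> {1..2*m}" for k
    using b' that by (intro mult_flip_cases) blast
  show "b (2*j) * flip n X (2*j) = c (2*j)" if j: "j \<in> {1..m-1}" for j
  proof -
    have "2 * j \<noteq> n" "2 * j \<le> n" using j m by auto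
    then have "flip n X (2*j) = 1" by (intro flip_even X) auto
    then show ?thesis using b' j by simp
  qed
  have "flip n X (2*m-1) * flip n X (2*m) = 1"
    using flip_fork[of X] flip_cases[of n X n] m(2) by auto
  moreover have "b (2*m-1) * b (2*m) = c (2*m-1) * c (2*m)"
    using b by (simp add: even_signs_def)
  moreover have "b (2*m-1) * flip n X (2*m-1) * (b (2*m) * flip n X (2*m))
      = b (2*m-1) * b (2*m) * (flip n X (2*m-1) * flip n X (2*m))"
    by (simp only: ac_simps)
  ultimately show "b (2*m-1) * flip n X (2*m-1) * (b (2*m) * flip n X (2*m)) = c (2*m-1) * c (2*m)"
    by (simp only: mult_1_right)
  show "(\<Prod>j\<in>{j\<in>{1..2*m-1}. odd j}. b j * flip n X j) = c (2*m-1)"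
    unfolding prod.distrib flip_prod_odd[OF m(2) X] using b' by simp
qed

lemma odd_signs_flip:
  assumes m: "2 \<le> m" "n = 2 * m + 1" and b: "b \<in> odd_signs m c" and X: "X \<subseteq> {1..n}"
  shows "(\<lambda>k. b k * flip n X k) \<in> odd_signs m c"
  unfolding odd_signs_def
proof (intro CollectI conjI ballI)
  note b' = b[unfolded odd_signs_def, simplified mem_Collect_eq]
  show "b k * flip n X k \<in> {1, -1}" if "k \<in> {1..2*m+1}" for k
    using b' that by (intro mult_flip_cases) blast
  show "b (2*j) * flip n X (2*j) = c (2*j)" if j: "j \<in> {1..m-1}" for j
  proof -
    have "2 * j \<noteq> n" "2 * j \<le> n" using j m by auto
    then have "flip n X (2*j) = 1" by (intro flip_even X) auto
    then show ?thesis using b' j by simp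
  qed
  have "flip n X (2*m) = 1" using flip_even[of "2*m" X] m X by simp
  moreover from this have "flip n X (2*m+1) = 1" using flip_fork[of X] m(2) by simp
  ultimately show "b (2*m) * flip n X (2*m) = c (2*m)" "b (2*m+1) * flip n X (2*m+1) = c (2*m+1)"
    using b' by simp_all
qed

text \<open>
  The condition on the product determines the sign at \<open>2 m - 1\<close> from the other signs at odd places, and this sign
  determines the one at \<open>2 m\<close>. So it is enough to connect the signs at \<open>1, 3, \<dots>, 2 m - 3\<close>.
\<close>

lemma even_module:
  assumes m: "2 \<le> m" "n = 2 * m" and c: "\<forall>k\<in>{1..n}. c k \<in> {1, -1}"
    and sing: "singular_vector n \<rho> (tensor (vvect n c) 1)" and ones: "\<forall>j\<in>{1..m-1}. c (2*j-1) = 1"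
  shows "irreducible_highest_weight_module n \<rho>
    (tensor_poly n (cvec.span (vvect n ` even_signs m c))) (tensor (vvect n c) 1)"
proof (rule irreducible_highest_weight_criterion[OF _ _ _ _ _ sing])
  let ?B = "even_signs m c"
  show signs: "\<forall>k\<in>{1..n}. b k \<in> {1, -1}" if "b \<in> ?B" for b
    using that m(2) by (simp add: even_signs_def)
  show flip: "(\<lambda>k. b k * flip n X k) \<in> ?B" if "b \<in> ?B" "X \<subseteq> {1..n}" for b X
    by (rule even_signs_flip[OF m that])
  have evens: "b k = b' k" if "b \<in> ?B" "b' \<in> ?B" "even k" "k \<in> {1..n-2}" for b b' k
  proof -
    from that(3) obtain j where j: "k = 2 * j" by blast
    have "1 \<le> j" "j \<le> m - 1" using that(4) j m by auto
    then show ?thesis using that(1,2) j by (simp add: even_signs_def)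
  qed
  show "\<forall>k\<in>{1..n}. b k = b' k"
    if "b \<in> ?B" "b' \<in> ?B" "\<forall>k\<in>{1..n} - nu_set n. b k = b' k" for b b'
  proof
    fix k assume k: "k \<in> {1..n}"
    show "b k = b' k"
    proof (cases "k \<in> nu_set n")
      case True
      then have "even k" "k \<in> {1..n-2}" using m(2) by (auto simp: nu_set_def)
      then show ?thesis using evens that by blast
    qed (use that k in blast)
  qed
  show "c \<in> ?B"
  proof -
    have "(\<Prod>j\<in>{1..m}. c (2 * j - 1)) = (\<Prod>j\<in>{1..m}. if j = m then c (2 * m - 1) else 1)"
      using ones by (intro prod.cong refl) auto
    then show ?thesis
      using c m unfolding even_signs_def prod_odd_indices by simp
  qed
  show "\<exists>d\<in>?B. P d \<and> (\<forall>k\<in>{1..n}. d k = b' k)"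
    if b: "b \<in> ?B" "b' \<in> ?B" "P b"
      and P: "\<And>d k. d \<in> ?B \<Longrightarrow> k \<in> {1..n} \<Longrightarrow> P d \<Longrightarrow> P (\<lambda>l. d l * neigh_sign n k l)" for P b b'
  proof -
    have "2 * i \<in> nu_set n \<and> 2 * i \<le> n - 1" if "1 \<le> i" "i \<le> m - 1" for i
    proof -
      have "even n" "2 * i \<le> n - 2" "2 \<le> 2 * i" using that m by simp_all
      then show ?thesis unfolding nu_set_def by simp
    qed
    note nu = this
    have "\<exists>d\<in>?B. P d \<and> (\<forall>j\<in>{1..m-1}. d (2 * j - 1) = b' (2 * j - 1))"
      by (rule flips_connect[where M = "m - 1" and P = P and b = b, OF nu signs flip b P order_refl])
    then obtain d where d: "d \<in> ?B" "P d" "\<forall>j\<in>{1..m-1}. d (2 * j - 1) = b' (2 * j - 1)"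
      by blast
    have set: "{1..m} = insert m {1..m-1}" using m by auto
    have "(\<Prod>j\<in>{1..m}. d (2 * j - 1)) = (\<Prod>j\<in>{1..m}. b' (2 * j - 1))"
      using d(1) b(2) unfolding even_signs_def prod_odd_indices by simp
    moreover have "(\<Prod>j\<in>{1..m}. x (2 * j - 1)) = x (2 * m - 1) * (\<Prod>j\<in>{1..m-1}. x (2 * j - 1))"
      for x :: "nat \<Rightarrow> int"
      unfolding set using m by (subst prod.insert) auto
    moreover have "(\<Prod>j\<in>{1..m-1}. d (2 * j - 1)) = (\<Prod>j\<in>{1..m-1}. b' (2 * j - 1))"
      using d(3) by (intro prod.cong) auto
    moreover have "(\<Prod>j\<in>{1..m-1}. b' (2 * j - 1)) \<noteq> 0"
    proof -
      have "b' (2 * j - 1) \<noteq> 0" if "j \<in> {1..m-1}" for j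
      proof -
        have "2 * j - 1 \<in> {1..n}" using that m(2) by simp arith
        then have "b' (2 * j - 1) \<in> {1, -1}" using signs[OF b(2)] by blast
        then show ?thesis by auto
      qed
      then show ?thesis by simp
    qed
    \<comment> \<open>cancel the product of the signs at \<open>1, 3, \<dots>, 2 m - 3\<close>\<close>
    ultimately have last: "d (2 * m - 1) = b' (2 * m - 1)" by simp
    have "d (2 * m - 1) * d (2 * m) = b' (2 * m - 1) * b' (2 * m)"
      using d(1) b(2) by (simp add: even_signs_def)
    moreover have "b' (2 * m - 1) \<noteq> 0"
    proof -
      have "2 * m - 1 \<in> {1..n}" using m by simp
      then have "b' (2 * m - 1) \<in> {1, -1}" using signs[OF b(2)] by blast
      then show ?thesis by auto
    qed
    ultimately have top: "d (2 * m) = b' (2 * m)" using last by simp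
    have "d k = b' k" if k: "k \<in> {1..n}" for k
    proof (cases "even k")
      case True
      then have "k \<in> {1..n-2} \<or> k = 2 * m" using k m by (auto elim!: evenE)
      then show ?thesis using evens[OF d(1) b(2) True] top by blast
    next
      case False
      then obtain i where i: "k = 2 * i + 1" by (rule oddE)
      then have "k = 2 * Suc i - 1" "Suc i \<in> {1..m-1} \<or> Suc i = m" using k m by auto
      then show ?thesis using d(3) last by metis
    qed
    then show ?thesis using d by blast
  qed
qed

text \<open>
  Here \<open>2 m\<close> belongs to \<open>S\<close> as well, and its operator flips the sign at \<open>2 m - 1\<close> alone; all signs at odd places
  below \<open>n\<close> are free.
\<close>

lemma odd_module:
  assumes m: "2 \<le> m" "n = 2 * m + 1" and c: "\<forall>k\<in>{1..n}. c k \<in> {1, -1}"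
    and sing: "singular_vector n \<rho> (tensor (vvect n c) 1)"
  shows "irreducible_highest_weight_module n \<rho>
    (tensor_poly n (cvec.span (vvect n ` odd_signs m c))) (tensor (vvect n c) 1)"
proof (rule irreducible_highest_weight_criterion[OF _ _ _ _ _ sing])
  let ?B = "odd_signs m c"
  show signs: "\<forall>k\<in>{1..n}. b k \<in> {1, -1}" if "b \<in> ?B" for b
    using that m(2) by (simp add: odd_signs_def)
  show flip: "(\<lambda>k. b k * flip n X k) \<in> ?B" if "b \<in> ?B" "X \<subseteq> {1..n}" for b X
    by (rule odd_signs_flip[OF m that])
  have fixed: "b k = b' k" if b: "b \<in> ?B" "b' \<in> ?B" and k: "even k \<or> k = n" "k \<in> {1..n}" for b b' k
  proof (cases "k = n")
    case True
    then show ?thesis using b m(2) by (simp add: odd_signs_def)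
  next
    case False
    then obtain j where j: "k = 2 * j" using k(1) by blast
    then have "j = m \<or> 1 \<le> j \<and> j \<le> m - 1" using k(2) m False by auto
    then show ?thesis using b j by (auto simp: odd_signs_def)
  qed
  show "\<forall>k\<in>{1..n}. b k = b' k"
    if "b \<in> ?B" "b' \<in> ?B" "\<forall>k\<in>{1..n} - nu_set n. b k = b' k" for b b'
  proof
    fix k assume k: "k \<in> {1..n}"
    show "b k = b' k"
    proof (cases "k \<in> nu_set n")
      case True
      then have "even k \<or> k = n" using m(2) by (auto simp: nu_set_def)
      then show ?thesis using fixed that k by blast
    qed (use that k in blast)
  qed
  show "c \<in> ?B" using c m by (simp add: odd_signs_def)
  show "\<exists>d\<in>?B. P d \<and> (\<forall>k\<in>{1..n}. d k = b' k)"
    if b: "b \<in> ?B" "b' \<in> ?B" "P b"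
      and P: "\<And>d k. d \<in> ?B \<Longrightarrow> k \<in> {1..n} \<Longrightarrow> P d \<Longrightarrow> P (\<lambda>l. d l * neigh_sign n k l)" for P b b'
  proof -
    have "2 * i \<in> nu_set n \<and> 2 * i \<le> n - 1" if "1 \<le> i" "i \<le> m" for i
    proof -
      have "odd n" "2 * i \<le> n - 1" "2 \<le> 2 * i" using that m by simp_all
      then show ?thesis unfolding nu_set_def by simp
    qed
    note nu = this
    have "\<exists>d\<in>?B. P d \<and> (\<forall>j\<in>{1..m}. d (2 * j - 1) = b' (2 * j - 1))"
      by (rule flips_connect[where M = m and P = P and b = b, OF nu signs flip b P order_refl])
    then obtain d where d: "d \<in> ?B" "P d" "\<forall>j\<in>{1..m}. d (2 * j - 1) = b' (2 * j - 1)"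
      by blast
    have "d k = b' k" if k: "k \<in> {1..n}" for k
    proof (cases "even k \<or> k = n")
      case True
      then show ?thesis using fixed[OF d(1) b(2) _ k] by blast
    next
      case False
      then have "odd k" by simp
      then obtain i where i: "k = 2 * i + 1" by (rule oddE)
      then have "k = 2 * Suc i - 1" "Suc i \<in> {1..m}" using k m False by auto
      then show ?thesis using d(3) by metis
    qed
    then show ?thesis using d by blast
  qed
qed

end

theorem theorem4p1:
  fixes m n :: nat and S :: "nat \<Rightarrow> galg" and \<rho> :: "aff \<Rightarrow> vspace \<Rightarrow> vspace" and c :: "nat \<Rightarrow> int"
  assumes "2 \<le> m"
    and "orthonormal_basis n S"
    and "vertex_representation n S \<rho>"
    and "\<forall>j\<in>{1..n}. c j \<in> {1, -1}"
  shows
    "(n = 2 * m \<longrightarrow>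
       (singular_vector n \<rho> (tensor (vvect n c) 1) \<longleftrightarrow> (\<forall>j\<in>{1..m-1}. c (2*j-1) = 1)) \<and>
       (singular_vector n \<rho> (tensor (vvect n c) 1) \<longrightarrow>
         ((c (2*m-1), c (2*m)) = (1, 1) \<longrightarrow>
            has_weight n \<rho> (tensor (vvect n c) 1) (fund_weight (Primed m))) \<and>
         ((c (2*m-1), c (2*m)) = (1, -1) \<longrightarrow>
            has_weight n \<rho> (tensor (vvect n c) 1) (fund_weight (Plain m))) \<and>
         ((c (2*m-1), c (2*m)) = (-1, 1) \<longrightarrow>
            has_weight n \<rho> (tensor (vvect n c) 1) (fund_weight (Plain (m-1)))) \<and>
         ((c (2*m-1), c (2*m)) = (-1, -1) \<longrightarrow>
            has_weight n \<rho> (tensor (vvect n c) 1) (fund_weight (Primed (m-1))))) \<and>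
       (singular_vector n \<rho> (tensor (vvect n c) 1) \<longrightarrow>
         irreducible_highest_weight_module n \<rho>
           (tensor_poly n
             (cvec.span {vvect n b | b.
                (\<forall>j\<in>{1..2*m}. b j \<in> {1, -1}) \<and>
                (\<forall>j\<in>{1..m-1}. b (2*j) = c (2*j)) \<and>
                b (2*m-1) * b (2*m) = c (2*m-1) * c (2*m) \<and>
                (\<Prod>j\<in>{j\<in>{1..2*m-1}. odd j}. b j) = c (2*m-1)}))
           (tensor (vvect n c) 1))) \<and>
     (n = 2 * m + 1 \<longrightarrow>
       (singular_vector n \<rho> (tensor (vvect n c) 1) \<longleftrightarrow> (\<forall>j\<in>{1..m}. c (2*j-1) = 1)) \<and>
       (singular_vector n \<rho> (tensor (vvect n c) 1) \<longrightarrow>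
         (c (2*m) = c (2*m+1) \<longrightarrow>
            has_weight n \<rho> (tensor (vvect n c) 1) (fund_weight (Primed m))) \<and>
         (c (2*m) = - c (2*m+1) \<longrightarrow>
            has_weight n \<rho> (tensor (vvect n c) 1) (fund_weight (Plain m)))) \<and>
       (singular_vector n \<rho> (tensor (vvect n c) 1) \<longrightarrow>
         irreducible_highest_weight_module n \<rho>
           (tensor_poly n
             (cvec.span {vvect n b | b.
                (\<forall>j\<in>{1..2*m+1}. b j \<in> {1, -1}) \<and>
                (\<forall>j\<in>{1..m-1}. b (2*j) = c (2*j)) \<and>
                b (2*m) = c (2*m) \<and> b (2*m+1) = c (2*m+1)}))
           (tensor (vvect n c) 1)))"
proof (intro conjI[of "n = 2 * m \<longrightarrow> _"] impI)
  note c = assms(4)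
  let ?v = "tensor (vvect n c) 1"
  {
    assume n: "n = 2 * m"
    interpret vertex_rep n S \<rho> by unfold_locales (use assms n in auto)
    have sing: "singular_vector n \<rho> ?v \<longleftrightarrow> (\<forall>j\<in>{1..m-1}. c (2*j-1) = 1)"
      using singular_vvect_iff[OF c] e_value_zero_iff_even[OF assms(1) n c] n by simp
    have weight: "has_weight n \<rho> ?v (fund_weight a)"
      if "singular_vector n \<rho> ?v"
        and "a = Primed m \<and> c (2*m-1) = 1 \<and> c (2*m) = 1 \<or>
          a = Plain m \<and> c (2*m-1) = 1 \<and> c (2*m) = -1 \<or>
          a = Plain (m-1) \<and> c (2*m-1) = -1 \<and> c (2*m) = 1 \<or>
          a = Primed (m-1) \<and> c (2*m-1) = -1 \<and> c (2*m) = -1" for a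
      by (rule singular_weight_even[OF assms(1) n c]) (use that sing in \<open>auto simp: fund_weight_def\<close>)
    have "irreducible_highest_weight_module n \<rho>
        (tensor_poly n (cvec.span (vvect n ` even_signs m c))) ?v" if "singular_vector n \<rho> ?v"
      using even_module[OF assms(1) n c that] that sing by blast
    then show "(singular_vector n \<rho> ?v \<longleftrightarrow> (\<forall>j\<in>{1..m-1}. c (2*j-1) = 1)) \<and>
       (singular_vector n \<rho> ?v \<longrightarrow>
         ((c (2*m-1), c (2*m)) = (1, 1) \<longrightarrow> has_weight n \<rho> ?v (fund_weight (Primed m))) \<and>
         ((c (2*m-1), c (2*m)) = (1, -1) \<longrightarrow> has_weight n \<rho> ?v (fund_weight (Plain m))) \<and>
         ((c (2*m-1), c (2*m)) = (-1, 1) \<longrightarrow> has_weight n \<rho> ?v (fund_weight (Plain (m-1)))) \<and>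
         ((c (2*m-1), c (2*m)) = (-1, -1) \<longrightarrow> has_weight n \<rho> ?v (fund_weight (Primed (m-1))))) \<and>
       (singular_vector n \<rho> ?v \<longrightarrow>
         irreducible_highest_weight_module n \<rho>
           (tensor_poly n
             (cvec.span {vvect n b | b.
                (\<forall>j\<in>{1..2*m}. b j \<in> {1, -1}) \<and>
                (\<forall>j\<in>{1..m-1}. b (2*j) = c (2*j)) \<and>
                b (2*m-1) * b (2*m) = c (2*m-1) * c (2*m) \<and>
                (\<Prod>j\<in>{j\<in>{1..2*m-1}. odd j}. b j) = c (2*m-1)})) ?v)"
      unfolding even_signs_def setcompr_eq_image[symmetric]
      using sing weight by (intro conjI impI; simp)
  }
  {
    assume n: "n = 2 * m + 1"
    interpret vertex_rep n S \<rho> by unfold_locales (use assms n in auto)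
    have sing: "singular_vector n \<rho> ?v \<longleftrightarrow> (\<forall>j\<in>{1..m}. c (2*j-1) = 1)"
      using singular_vvect_iff[OF c] e_value_zero_iff_odd[OF assms(1) n c] n by simp
    have cm: "c (2*m+1) \<noteq> 0" using bspec[OF c, of "2*m+1"] n by auto
    have weight: "has_weight n \<rho> ?v (fund_weight a)"
      if "singular_vector n \<rho> ?v"
        and "a = Primed m \<and> c (2*m) = c (2*m+1) \<or> a = Plain m \<and> c (2*m) \<noteq> c (2*m+1)" for a
      by (rule singular_weight_odd[OF assms(1) n c]) (use that sing in \<open>auto simp: fund_weight_def\<close>)
    have "irreducible_highest_weight_module n \<rho>
        (tensor_poly n (cvec.span (vvect n ` odd_signs m c))) ?v" if "singular_vector n \<rho> ?v"
      by (rule odd_module[OF assms(1) n c that])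
    then show "(singular_vector n \<rho> ?v \<longleftrightarrow> (\<forall>j\<in>{1..m}. c (2*j-1) = 1)) \<and>
       (singular_vector n \<rho> ?v \<longrightarrow>
         (c (2*m) = c (2*m+1) \<longrightarrow> has_weight n \<rho> ?v (fund_weight (Primed m))) \<and>
         (c (2*m) = - c (2*m+1) \<longrightarrow> has_weight n \<rho> ?v (fund_weight (Plain m)))) \<and>
       (singular_vector n \<rho> ?v \<longrightarrow>
         irreducible_highest_weight_module n \<rho>
           (tensor_poly n
             (cvec.span {vvect n b | b.
                (\<forall>j\<in>{1..2*m+1}. b j \<in> {1, -1}) \<and>
                (\<forall>j\<in>{1..m-1}. b (2*j) = c (2*j)) \<and>
                b (2*m) = c (2*m) \<and> b (2*m+1) = c (2*m+1)})) ?v)"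
      unfolding odd_signs_def setcompr_eq_image[symmetric]
      using sing weight cm by (intro conjI impI; simp)
  }
qed

end
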